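(* (a) Let $\mathcal P\in\mathscr P_3$ (so $N=3$) and suppose that for some constant $\bar\sigma>0$ independent of $i$, $$\int_{\overline{P_iM_i}} v_{\mathcal P}(x)\,|x-M_i|\,\mathrm d\mathcal H^1(x)-\int_{\overline{P_{i+1}M_i}} v_{\mathcal P}(x)\,|x-M_i|\,\mathrm d\mathcal H^1(x)=\frac{\bar\sigma\,\ell_i}{2}\bigl(\psi(\theta_i)-\psi(\theta_{i+1})\bigr)\qquad\text{for all } i\in\{1,\dots,N\}. \tag{T'}$$ Then $\mathcal P$ is an equilateral triangle. (b) Let $\mathcal P\in\mathscr P_4$ (so $N=4$) and suppose that for some constant $\bar\sigma>0$ independent of $i$, both (T') and $$\int_{\overline{P_iP_{i+1}}} v_{\mathcal P}(x)\,\mathrm d\mathcal H^1(x)=\bar\sigma\bigl(\psi(\theta_i)+\psi(\theta_{i+1})\bigr)\qquad\text{for all } i\in\{1,\dots,N\}$$ hold (with the same $\bar\sigma$). Then $\mathcal P$ is a square.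
   Context: For $N\ge 3$, $\mathscr P_N$ denotes the class of all (not necessarily convex) polygons in $\mathbb R^2$ with $N$ sides; a polygon is identified with the bounded planar region enclosed by its boundary, a simple closed polygonal line, and no interior angle equals $\pi$. A polygon $\mathcal P\in\mathscr P_N$ has consecutive vertices $P_1,\dots,P_N$, with $P_0=P_N$ and $P_{N+1}=P_1$ (indices taken modulo $N$). For points $P,Q\in\mathbb R^2$, $\overline{PQ}$ is the segment joining them. $\ell_i$ is the length of the side $\overline{P_iP_{i+1}}$, $M_i$ is its midpoint, and $\theta_i$ is the interior angle of $\mathcal P$ at $P_i$. $\mathcal H^1$ is one-dimensional Hausdorff measure. The function $\psi$ is $\psi(\theta)=\cot\theta+\frac1{\sin\theta}$. The kernel $K:(0,\infty)\to\mathbb R$ satisfies: $K\in C^1((0,\infty))$ and $K\ge 0$; $K$ is strictly decreasing; $\int_0^1 K(r)\,r\,\mathrm dr<\infty$. The potential of $\mathcal P$ is $v_{\mathcal P}(x)=\int_{\mathcal P}K(|x-y|)\,\mathrm dy$. *)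

theory Defs
  imports "HOL-Analysis.Analysis"
begin

text \<open>
  The Euclidean plane is the type \<^typ>\<open>complex\<close>.  The vertices of a polygon with \<open>N\<close> sides are
  an \<open>N\<close>-periodic family \<open>P :: int \<Rightarrow> complex\<close>, so indices are automatically taken modulo \<open>N\<close>.
  Both orientations of the boundary are allowed.
\<close>

definition polygon_path :: "nat \<Rightarrow> (int \<Rightarrow> complex) \<Rightarrow> real \<Rightarrow> complex" where
  "polygon_path N P t =
     (let k = \<lfloor>real N * t\<rfloor> in linepath (P k) (P (k + 1)) (frac (real N * t)))"

definition polygon_region :: "nat \<Rightarrow> (int \<Rightarrow> complex) \<Rightarrow> complex set" where
  "polygon_region N P = inside (path_image (polygon_path N P))"

text \<open>
  Turning the side from \<open>P i\<close> to \<open>P (i + 1)\<close> counterclockwise about \<open>P i\<close> by the angle \<open>\<alpha>\<close> makes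
  it point along the side from \<open>P i\<close> to \<open>P (i - 1)\<close>.  These two sides bound two sectors at \<open>P i\<close>,
  of openings \<open>\<alpha>\<close> and \<open>2 * pi - \<alpha>\<close>; the interior angle is the opening of the one that lies in the
  polygon near \<open>P i\<close>.  It takes values in the open interval from \<open>0\<close> to \<open>2 * pi\<close>.
\<close>

definition interior_angle :: "nat \<Rightarrow> (int \<Rightarrow> complex) \<Rightarrow> int \<Rightarrow> real" where
  "interior_angle N P i =
     (let u = P (i + 1) - P i; w = P (i - 1) - P i; \<alpha> = Arg2pi (w / u)
      in if \<exists>r>0. \<forall>\<rho> t. 0 < \<rho> \<and> \<rho> < r \<and> 0 < t \<and> t < \<alpha> \<longrightarrow>
              P i + complex_of_real \<rho> * cis t * u \<in> polygon_region N P
         then \<alpha> else 2 * pi - \<alpha>)"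

definition polygon :: "nat \<Rightarrow> (int \<Rightarrow> complex) \<Rightarrow> bool" where
  "polygon N P \<longleftrightarrow>
     3 \<le> N \<and> (\<forall>i. P (i + int N) = P i) \<and> simple_path (polygon_path N P) \<and>
     (\<forall>i. interior_angle N P i \<noteq> pi)"

definition side_length :: "(int \<Rightarrow> complex) \<Rightarrow> int \<Rightarrow> real" where
  "side_length P i = dist (P i) (P (i + 1))"

definition side_midpoint :: "(int \<Rightarrow> complex) \<Rightarrow> int \<Rightarrow> complex" where
  "side_midpoint P i = midpoint (P i) (P (i + 1))"

definition equilateral_triangle :: "(int \<Rightarrow> complex) \<Rightarrow> bool" where
  "equilateral_triangle P \<longleftrightarrow> polygon 3 P \<and> (\<forall>i j. side_length P i = side_length P j)"

definition is_square :: "(int \<Rightarrow> complex) \<Rightarrow> bool" where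
  "is_square P \<longleftrightarrow>
     polygon 4 P \<and> (\<forall>i j. side_length P i = side_length P j) \<and>
     (\<forall>i. interior_angle 4 P i = pi / 2)"

text \<open>
  One-dimensional Hausdorff measure in the plane: the outer measure, restricted to the Borel sets.
  The library's \<^const>\<open>diameter\<close> is only meaningful for bounded sets, hence the boundedness
  requirement on the members of a covering.
\<close>

definition hausdorff_pre :: "real \<Rightarrow> complex set \<Rightarrow> ennreal" where
  "hausdorff_pre \<delta> A =
     (INF U \<in> {U :: nat \<Rightarrow> complex set. A \<subseteq> (\<Union>n. U n) \<and> (\<forall>n. bounded (U n) \<and> diameter (U n) \<le> \<delta>)}.
        \<Sum>n. ennreal (diameter (U n)))"

definition hausdorff_outer :: "complex set \<Rightarrow> ennreal" where
  "hausdorff_outer A = (SUP \<delta> \<in> {0<..}. hausdorff_pre \<delta> A)"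

definition hausdorff1 :: "complex measure" where
  "hausdorff1 = measure_of UNIV (sets borel) hausdorff_outer"

definition admissible_kernel :: "(real \<Rightarrow> real) \<Rightarrow> bool" where
  "admissible_kernel K \<longleftrightarrow>
     K C1_differentiable_on {0<..} \<and> (\<forall>r>0. 0 \<le> K r) \<and> strict_antimono_on {0<..} K \<and>
     set_integrable lborel {0<..<1} (\<lambda>r. K r * r)"

definition potential :: "(real \<Rightarrow> real) \<Rightarrow> nat \<Rightarrow> (int \<Rightarrow> complex) \<Rightarrow> complex \<Rightarrow> real" where
  "potential K N P x = (LINT y : polygon_region N P | lborel. K (dist x y))"

definition \<psi> :: "real \<Rightarrow> real" where
  "\<psi> \<theta> = cot \<theta> + 1 / sin \<theta>"

definition torque_condition :: "(real \<Rightarrow> real) \<Rightarrow> nat \<Rightarrow> (int \<Rightarrow> complex) \<Rightarrow> real \<Rightarrow> bool" where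
  "torque_condition K N P \<sigma> \<longleftrightarrow>
     (\<forall>i \<in> {1..int N}.
        (LINT x : closed_segment (P i) (side_midpoint P i) | hausdorff1.
            potential K N P x * dist x (side_midpoint P i))
      - (LINT x : closed_segment (P (i + 1)) (side_midpoint P i) | hausdorff1.
            potential K N P x * dist x (side_midpoint P i))
      = \<sigma> * side_length P i / 2 * (\<psi> (interior_angle N P i) - \<psi> (interior_angle N P (i + 1))))"

definition force_condition :: "(real \<Rightarrow> real) \<Rightarrow> nat \<Rightarrow> (int \<Rightarrow> complex) \<Rightarrow> real \<Rightarrow> bool" where
  "force_condition K N P \<sigma> \<longleftrightarrow>
     (\<forall>i \<in> {1..int N}.
        (LINT x : closed_segment (P i) (P (i + 1)) | hausdorff1. potential K N P x)
      = \<sigma> * (\<psi> (interior_angle N P i) + \<psi> (interior_angle N P (i + 1))))"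

end

theory Submission
  imports Defs
begin

text \<open>
  Write \<open>v\<close> for the potential.  The proof speaks about the \<^emph>\<open>load\<close> of a side \<open>AB\<close> at its end \<open>B\<close>: the
  integral of \<open>v\<close> over the side against the affine weight that is \<open>0\<close> at \<open>A\<close> and \<open>1\<close> at \<open>B\<close>.  On each
  side, the torque condition fixes the difference of the loads at the two ends, namely \<open>\<sigma>\<close> times the
  difference of the two values of \<open>\<psi>\<close>, and the force condition fixes their sum in the same way
  (\<open>torque_condition_load\<close>, \<open>force_condition_load\<close>).  On an angle of a convex corner \<open>\<psi>\<close> is the
  cotangent of half the angle, which is an explicit function of the vertices (\<open>half_cot\<close>).

  \<^emph>\<open>Triangles.\<close>  If \<open>C\<close> is closer to \<open>B\<close> than to \<open>A\<close>, then all slices of the triangle parallel to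
  \<open>AB\<close> have their midpoint on the side of \<open>B\<close>, and \<open>v\<close> is larger at a point of the half of \<open>AB\<close>
  next to \<open>B\<close> than at its mirror image.  So the load is larger at \<open>B\<close> (\<open>triangle_load_less\<close>), while
  \<open>\<psi>\<close> is larger at \<open>A\<close>: this contradicts the torque condition.  Hence any two sides are equal.

  \<^emph>\<open>Quadrilaterals.\<close>  Adding and subtracting the two conditions, the load of a side at an end is
  \<open>\<sigma>\<close> times \<open>\<psi>\<close> of the angle there, so the two loads at a vertex agree.  The central inequality
  (\<open>midpoint_force_negative\<close>) concerns any region cut into parallel slices from \<open>a(y)\<close> to \<open>b(y)\<close>
  with midpoint \<open>m(y)\<close>: the integral of \<open>m(y) (v(b(y),y) - v(a(y),y))\<close> over \<open>y\<close> is negative unless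
  \<open>m\<close> is constant.  It is the infinitesimal form of the fact that continuous Steiner symmetrization
  increases the interaction energy.  The difference of the values of \<open>v\<close> is an integral over \<open>y'\<close>
  of the pull of the slice \<open>y'\<close> on the slice \<open>y\<close>; pulls are antisymmetric in \<open>y\<close> and \<open>y'\<close> and point
  towards the midpoint of the pulling slice, so exchanging \<open>y\<close> and \<open>y'\<close> turns \<open>m(y)\<close> into
  \<open>(m(y) - m(y')) / 2\<close> and makes the integrand negative.

  One diagonal, say \<open>AC\<close>, has \<open>B\<close> and \<open>D\<close> on different sides
  (\<open>quadrilateral_diagonal_separates\<close>), also when the polygon is not convex.  With slices parallel
  to \<open>AC\<close> the integral is a combination of the loads at \<open>B\<close> and \<open>D\<close>.  As these are balanced,
  it is nonnegative, so the inequality only leaves the case \<open>|AB| = |CB|\<close> and \<open>|AD| = |CD|\<close>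
  (\<open>kite\<close>).  Then \<open>BD\<close> separates \<open>A\<close> and \<open>C\<close> as well, and the same argument makes all sides equal.
  With slices parallel to a side of this rhombus the inequality compares the loads at two adjacent
  vertices; the explicit values of \<open>\<psi>\<close> contradict it unless the angles are right
  (\<open>parallelogram_load\<close>, \<open>rhombus_half_cot_difference\<close>).

  The measure-theoretic basis is that \<open>hausdorff1\<close> is length on segments
  (\<open>hausdorff1_integral_segment\<close>) and that the regions enclosed by the polygons are the sets filled
  by the slices (\<open>inside_sliced\<close>).
\<close>

section \<open>Hausdorff measure is a measure on the Borel sets\<close>

lemma hausdorff_pre_le_cover:
  assumes "A \<subseteq> (\<Union>n. U n)" "\<And>n. bounded (U n)" "\<And>n. diameter (U n) \<le> \<delta>"
  shows "hausdorff_pre \<delta> A \<le> (\<Sum>n. ennreal (diameter (U n)))"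
  unfolding hausdorff_pre_def using assms by (intro INF_lower) auto

lemma hausdorff_pre_approx:
  assumes "hausdorff_pre \<delta> A < \<infinity>" "(0::ennreal) < e"
  obtains U :: "nat \<Rightarrow> complex set" where "A \<subseteq> (\<Union>n. U n)" "\<And>n. bounded (U n)" "\<And>n. diameter (U n) \<le> \<delta>"
    "(\<Sum>n. ennreal (diameter (U n))) < hausdorff_pre \<delta> A + e"
proof -
  have "hausdorff_pre \<delta> A < hausdorff_pre \<delta> A + e"
    using assms by (metis add.right_neutral ennreal_add_left_cancel_less infinity_ennreal_def less_irrefl)
  then show ?thesis
    using that unfolding hausdorff_pre_def[of \<delta> A] INF_less_iff by auto
qed

lemma hausdorff_pre_mono: "A \<subseteq> B \<Longrightarrow> hausdorff_pre \<delta> A \<le> hausdorff_pre \<delta> B"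
  unfolding hausdorff_pre_def by (intro INF_superset_mono) auto

lemma hausdorff_pre_antimono: "\<delta> \<le> \<delta>' \<Longrightarrow> hausdorff_pre \<delta>' A \<le> hausdorff_pre \<delta> A"
  unfolding hausdorff_pre_def by (intro INF_superset_mono) (auto intro: order_trans)

lemma hausdorff_pre_le_outer: "0 < \<delta> \<Longrightarrow> hausdorff_pre \<delta> A \<le> hausdorff_outer A"
  unfolding hausdorff_outer_def by (intro SUP_upper) auto

lemma hausdorff_outer_mono: "A \<subseteq> B \<Longrightarrow> hausdorff_outer A \<le> hausdorff_outer B"
  unfolding hausdorff_outer_def by (intro SUP_mono) (auto intro: hausdorff_pre_mono)

lemma hausdorff_outer_empty [simp]: "hausdorff_outer {} = 0"
proof -
  have "hausdorff_pre \<delta> {} \<le> 0" if "0 < \<delta>" for \<delta>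
    using hausdorff_pre_le_cover[of "{}" "\<lambda>_. {}" \<delta>] that by simp
  then show ?thesis unfolding hausdorff_outer_def by (auto intro!: antisym SUP_least)
qed

text \<open>
  Covers of the \<open>A i\<close> that miss the infimum by \<open>e / 2 ^ (i + 1)\<close> combine to a cover of the union.
\<close>

lemma hausdorff_pre_subadditive:
  "hausdorff_pre \<delta> (\<Union>i::nat. A i) \<le> (\<Sum>i. hausdorff_pre \<delta> (A i))"
proof (rule ennreal_le_epsilon)
  fix e :: real assume "0 < e" and fin: "(\<Sum>i. hausdorff_pre \<delta> (A i)) < top"
  have *: "hausdorff_pre \<delta> (A i) < \<infinity>" for i
    using fin ennreal_suminf_lessD by fastforce
  have "\<exists>U. A i \<subseteq> (\<Union>n. U n) \<and> (\<forall>n. bounded (U n)) \<and> (\<forall>n. diameter (U n) \<le> \<delta>) \<and>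
      (\<Sum>n. ennreal (diameter (U n))) < hausdorff_pre \<delta> (A i) + ennreal (e * (1/2) ^ Suc i)" for i
    by (rule hausdorff_pre_approx[OF *, of "ennreal (e * (1/2) ^ Suc i)"]) (use \<open>0 < e\<close> in auto)
  then obtain U where U: "\<And>i. A i \<subseteq> (\<Union>n. U i n)" "\<And>i n. bounded (U i n)" "\<And>i n. diameter (U i n) \<le> \<delta>"
      "\<And>i. (\<Sum>n. ennreal (diameter (U i n))) < hausdorff_pre \<delta> (A i) + ennreal (e * (1/2) ^ Suc i)"
    by metis
  define C where "C = case_prod U o prod_decode"
  have cov: "(\<Union>i. A i) \<subseteq> (\<Union>k. C k)"
  proof
    fix x assume "x \<in> (\<Union>i. A i)"
    then obtain i n where "x \<in> U i n" using U(1) by blast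
    then have "x \<in> C (prod_encode (i, n))" by (simp add: C_def)
    then show "x \<in> (\<Union>k. C k)" by blast
  qed
  have "hausdorff_pre \<delta> (\<Union>i. A i) \<le> (\<Sum>k. ennreal (diameter (C k)))"
    by (rule hausdorff_pre_le_cover[OF cov]) (auto simp: C_def U split: prod.split)
  also have "\<dots> = (\<Sum>k. (\<lambda>(i, n). ennreal (diameter (U i n))) (prod_decode k))"
    by (intro suminf_cong) (auto simp: C_def split: prod.split)
  also have "\<dots> = (\<Sum>i. \<Sum>n. ennreal (diameter (U i n)))"
    by (rule suminf_ennreal_2dimen) auto
  also have "\<dots> \<le> (\<Sum>i. hausdorff_pre \<delta> (A i) + ennreal (e * (1/2) ^ Suc i))"
    using U(4) by (intro suminf_le allI summableI) (auto intro: less_imp_le)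
  also have "\<dots> = (\<Sum>i. hausdorff_pre \<delta> (A i)) + (\<Sum>i. ennreal e * ennreal ((1/2) ^ Suc i))"
    using \<open>0 < e\<close> by (subst suminf_add[symmetric])
      (auto simp del: ennreal_suminf_cmult simp add: ennreal_mult[symmetric])
  also have "\<dots> = (\<Sum>i. hausdorff_pre \<delta> (A i)) + ennreal e"
    unfolding ennreal_suminf_cmult
    by (subst suminf_ennreal_eq[OF zero_le_power power_half_series]) auto
  finally show "hausdorff_pre \<delta> (\<Union>i. A i) \<le> (\<Sum>i. hausdorff_pre \<delta> (A i)) + ennreal e" .
qed

lemma hausdorff_outer_subadditive:
  "hausdorff_outer (\<Union>i::nat. A i) \<le> (\<Sum>i. hausdorff_outer (A i))"
  unfolding hausdorff_outer_def[of "\<Union>i. A i"]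
proof (rule SUP_least)
  fix \<delta> :: real assume "\<delta> \<in> {0<..}"
  then have "(\<Sum>i. hausdorff_pre \<delta> (A i)) \<le> (\<Sum>i. hausdorff_outer (A i))"
    by (intro suminf_le summableI hausdorff_pre_le_outer) auto
  then show "hausdorff_pre \<delta> (\<Union>i. A i) \<le> (\<Sum>i. hausdorff_outer (A i))"
    using hausdorff_pre_subadditive order_trans by blast
qed

lemma outer_measure_space_hausdorff: "outer_measure_space (Pow UNIV) hausdorff_outer"
  by (auto simp: outer_measure_space_def positive_def increasing_def countably_subadditive_def
      intro: hausdorff_outer_mono hausdorff_outer_subadditive)

lemma hausdorff_outer_Un_le: "hausdorff_outer (A \<union> B) \<le> hausdorff_outer A + hausdorff_outer B"
proof -
  define C where "C i = (if i = 0 then A else if i = 1 then B else {})" for i :: nat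
  have "A \<union> B = (\<Union>i. C i)" by (auto simp: C_def split: if_splits)
  then have "hausdorff_outer (A \<union> B) \<le> (\<Sum>i. hausdorff_outer (C i))"
    by (simp add: hausdorff_outer_subadditive)
  also have "\<dots> = hausdorff_outer A + hausdorff_outer B"
    by (subst suminf_finite[of "{0, 1}"]) (auto simp: C_def)
  finally show ?thesis .
qed

text \<open>
  A covering set whose diameter is below the distance of \<open>A\<close> and \<open>B\<close> meets only one of them, so a
  cover of the union splits into a cover of \<open>A\<close> and a cover of \<open>B\<close>.
\<close>

lemma hausdorff_pre_metric:
  assumes sep: "\<And>x y. x \<in> A \<Longrightarrow> y \<in> B \<Longrightarrow> \<epsilon> \<le> dist x y" and \<delta>: "0 < \<delta>" "\<delta> < \<epsilon>"
  shows "hausdorff_pre \<delta> A + hausdorff_pre \<delta> B \<le> hausdorff_pre \<delta> (A \<union> B)"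
  unfolding hausdorff_pre_def[of \<delta> "A \<union> B"]
proof (rule INF_greatest)
  fix U :: "nat \<Rightarrow> complex set"
  assume "U \<in> {U. A \<union> B \<subseteq> (\<Union>n. U n) \<and> (\<forall>n. bounded (U n) \<and> diameter (U n) \<le> \<delta>)}"
  then have U: "A \<union> B \<subseteq> (\<Union>n. U n)" "\<And>n. bounded (U n)" "\<And>n. diameter (U n) \<le> \<delta>" by auto
  define UA where "UA n = (if U n \<inter> A = {} then {} else U n)" for n
  define UB where "UB n = (if U n \<inter> B = {} then {} else U n)" for n
  have "hausdorff_pre \<delta> A \<le> (\<Sum>n. ennreal (diameter (UA n)))"
    using U \<delta> by (intro hausdorff_pre_le_cover) (auto simp: UA_def, blast)
  moreover have "hausdorff_pre \<delta> B \<le> (\<Sum>n. ennreal (diameter (UB n)))"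
    using U \<delta> by (intro hausdorff_pre_le_cover) (auto simp: UB_def, blast)
  moreover have "ennreal (diameter (UA n)) + ennreal (diameter (UB n)) \<le> ennreal (diameter (U n))" for n
  proof (cases "U n \<inter> A = {} \<or> U n \<inter> B = {}")
    case False
    then obtain x y where "x \<in> U n" "x \<in> A" "y \<in> U n" "y \<in> B" by blast
    then have "\<epsilon> \<le> dist x y" "dist x y \<le> \<delta>"
      using sep U(3)[of n] diameter_bounded_bound[OF U(2), of x n y] by auto
    with \<delta> show ?thesis by simp
  qed (auto simp: UA_def UB_def)
  ultimately have "hausdorff_pre \<delta> A + hausdorff_pre \<delta> B \<le>
      (\<Sum>n. ennreal (diameter (UA n))) + (\<Sum>n. ennreal (diameter (UB n)))"
    by (intro add_mono)
  also have "\<dots> = (\<Sum>n. ennreal (diameter (UA n)) + ennreal (diameter (UB n)))"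
    by (rule suminf_add) auto
  also have "\<dots> \<le> (\<Sum>n. ennreal (diameter (U n)))"
    by (intro suminf_le summableI) fact
  finally show "hausdorff_pre \<delta> A + hausdorff_pre \<delta> B \<le> (\<Sum>n. ennreal (diameter (U n)))" .
qed

lemma hausdorff_outer_metric:
  assumes sep: "\<And>x y. x \<in> A \<Longrightarrow> y \<in> B \<Longrightarrow> \<epsilon> \<le> dist x y" and "0 < \<epsilon>"
  shows "hausdorff_outer A + hausdorff_outer B = hausdorff_outer (A \<union> B)"
proof (rule antisym)
  have "hausdorff_outer A + hausdorff_outer B =
      (SUP \<delta>\<in>{0<..}. hausdorff_pre \<delta> A + hausdorff_pre \<delta> B)"
    unfolding hausdorff_outer_def
  proof (rule SUP_add_directed_ennreal[symmetric])
    fix i j :: real assume "i \<in> {0<..}" "j \<in> {0<..}"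
    then show "\<exists>k\<in>{0<..}. hausdorff_pre i A + hausdorff_pre j B \<le> hausdorff_pre k A + hausdorff_pre k B"
      by (intro bexI[of _ "min i j"] add_mono hausdorff_pre_antimono) auto
  qed
  also have "\<dots> \<le> hausdorff_outer (A \<union> B)"
  proof (rule SUP_least)
    fix \<delta> :: real assume \<delta>: "\<delta> \<in> {0<..}"
    define \<eta> where "\<eta> = min \<delta> (\<epsilon> / 2)"
    have \<eta>: "0 < \<eta>" "\<eta> < \<epsilon>" "\<eta> \<le> \<delta>" using \<delta> \<open>0 < \<epsilon>\<close> by (auto simp: \<eta>_def)
    have "hausdorff_pre \<delta> A + hausdorff_pre \<delta> B \<le> hausdorff_pre \<eta> A + hausdorff_pre \<eta> B"
      by (intro add_mono hausdorff_pre_antimono \<eta>)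
    also have "\<dots> \<le> hausdorff_pre \<eta> (A \<union> B)" by (rule hausdorff_pre_metric[OF sep \<eta>(1,2)])
    also have "\<dots> \<le> hausdorff_outer (A \<union> B)" by (rule hausdorff_pre_le_outer[OF \<eta>(1)])
    finally show "hausdorff_pre \<delta> A + hausdorff_pre \<delta> B \<le> hausdorff_outer (A \<union> B)" .
  qed
  finally show "hausdorff_outer A + hausdorff_outer B \<le> hausdorff_outer (A \<union> B)" .
qed (rule hausdorff_outer_Un_le)

lemma hausdorff_outer_sum_separated:
  fixes D :: "nat \<Rightarrow> complex set"
  assumes sep: "\<And>i j. i < j \<Longrightarrow> \<exists>\<epsilon>>0. \<forall>x\<in>D i. \<forall>y\<in>D j. \<epsilon> \<le> dist x y"
  shows "(\<Sum>i<n. hausdorff_outer (D i)) = hausdorff_outer (\<Union>i<n. D i)"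
proof (induction n)
  case (Suc n)
  obtain \<epsilon> where \<epsilon>: "\<And>i. i < n \<Longrightarrow> 0 < \<epsilon> i" "\<And>i x y. i < n \<Longrightarrow> x \<in> D i \<Longrightarrow> y \<in> D n \<Longrightarrow> \<epsilon> i \<le> dist x y"
    using sep[of _ n] by metis
  define e where "e = Min (insert 1 (\<epsilon> ` {..<n}))"
  have "0 < e" using \<epsilon>(1) by (auto simp: e_def)
  moreover have "e \<le> dist x y" if "x \<in> (\<Union>i<n. D i)" "y \<in> D n" for x y
  proof -
    from that obtain i where i: "i < n" "x \<in> D i" by auto
    then have "e \<le> \<epsilon> i" by (auto simp: e_def intro: Min_le)
    also have "\<dots> \<le> dist x y" using \<epsilon>(2) i that by auto
    finally show ?thesis .
  qed
  ultimately have "hausdorff_outer (\<Union>i<n. D i) + hausdorff_outer (D n) = hausdorff_outer ((\<Union>i<n. D i) \<union> D n)"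
    by (intro hausdorff_outer_metric)
  then show ?case using Suc by (simp add: lessThan_Suc Un_commute add.commute)
qed auto

lemma ennreal_tail_le:
  fixes f :: "nat \<Rightarrow> ennreal"
  assumes fin: "suminf f < top" and "0 < (e::ennreal)"
  shows "\<exists>n. (\<Sum>k. f (k + n)) \<le> e"
proof -
  obtain n where n: "suminf f \<le> sum f {..<n} + e"
  proof (cases "suminf f = 0")
    case True then show ?thesis using that[of 0] by simp
  next
    case False
    then have "suminf f < suminf f + e"
      using assms by (metis add.right_neutral ennreal_add_left_cancel_less infinity_ennreal_def less_irrefl)
    have "\<exists>n. suminf f < sum f {..<n} + e"
    proof (rule ccontr)
      assume "\<nexists>n. suminf f < sum f {..<n} + e"
      then have "(SUP n. sum f {..<n} + e) \<le> suminf f" by (intro SUP_least) (auto simp: not_less)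
      then have "suminf f + e \<le> suminf f"
        by (simp add: suminf_eq_SUP ennreal_SUP_add_left)
      with \<open>suminf f < suminf f + e\<close> show False by simp
    qed
    then show ?thesis using that less_imp_le by blast
  qed
  have *: "suminf f = sum f {..<n} + (\<Sum>k. f (k + n))"
    using suminf_offset[of f n] by (simp add: add.commute)
  have "sum f {..<n} < top" using fin * by (metis ennreal_add_eq_top less_top)
  with n * show ?thesis by (metis ennreal_add_left_cancel_le infinity_ennreal_def less_irrefl)
qed

text \<open>
  Caratheodory's criterion: an outer measure that is additive on sets of positive distance measures
  all closed sets.  The part of \<open>X\<close> at distance at least \<open>1 / (n + 1)\<close> from \<open>F\<close> has positive distance
  from \<open>F\<close>, and what is missing from \<open>X - F\<close> is a union of shells.  Every second shell has positive
  distance from the next, so the outer measures of the shells have a finite sum, and the tails of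
  this sum tend to \<open>0\<close>.
\<close>

lemma closed_in_lambda_system_hausdorff:
  assumes "closed F"
  shows "F \<in> lambda_system UNIV (Pow UNIV) hausdorff_outer"
proof (cases "F = {}")
  case True then show ?thesis by (simp add: lambda_system_def)
next
  case ne: False
  let ?h = hausdorff_outer
  have "?h (F \<inter> X) + ?h (X - F) \<le> ?h X" for X
  proof (cases "?h X = top")
    case fin: False
    define d where "d x = infdist x F" for x
    define Y where "Y n = {x \<in> X. 1 / (real n + 1) \<le> d x}" for n
    define D where "D n = {x \<in> X. 1 / (real n + 2) \<le> d x \<and> d x < 1 / (real n + 1)}" for n
    have lip: "d x \<le> d y + dist x y" for x y
      unfolding d_def by (metis infdist_triangle add.commute)
    \<comment> \<open>shells with consecutive indices may touch, hence the gap of 2 and the split by parity\<close>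
    have sepD: "\<exists>\<epsilon>>0. \<forall>x\<in>D i. \<forall>y\<in>D j. \<epsilon> \<le> dist x y" if "i + 2 \<le> j" for i j
    proof (intro exI conjI ballI)
      have "1 / (real j + 1) < 1 / (real i + 2)" using that by (intro divide_strict_left_mono) auto
      then show "0 < 1 / (real i + 2) - 1 / (real j + 1)" by simp
      fix x y assume "x \<in> D i" "y \<in> D j"
      then show "1 / (real i + 2) - 1 / (real j + 1) \<le> dist x y"
        using lip[of x y] by (auto simp: D_def)
    qed
    have part: "(\<Sum>n. ?h (D (2 * n + r))) \<le> ?h X" for r
    proof (rule suminf_le_const[OF summableI])
      fix n
      have "(\<Sum>i<n. ?h (D (2 * i + r))) = ?h (\<Union>i<n. D (2 * i + r))"
        by (rule hausdorff_outer_sum_separated) (rule sepD, simp)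
      also have "\<dots> \<le> ?h X" by (rule hausdorff_outer_mono) (auto simp: D_def)
      finally show "(\<Sum>i<n. ?h (D (2 * i + r))) \<le> ?h X" .
    qed
    have "(\<Sum>n. ?h (D n)) \<le> (\<Sum>n. ?h (D (2 * n + 0))) + (\<Sum>n. ?h (D (2 * n + 1)))"
    proof (rule suminf_le_const[OF summableI])
      fix n
      have "(\<Sum>i<n. ?h (D i)) \<le> (\<Sum>i<2*n. ?h (D i))" by (intro sum_mono2) auto
      also have "\<dots> = (\<Sum>i<n. ?h (D (2 * i + 0))) + (\<Sum>i<n. ?h (D (2 * i + 1)))"
        by (induction n) (auto simp: algebra_simps)
      also have "\<dots> \<le> (\<Sum>n. ?h (D (2 * n + 0))) + (\<Sum>n. ?h (D (2 * n + 1)))"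
        by (intro add_mono sum_le_suminf summableI) auto
      finally show "(\<Sum>i<n. ?h (D i)) \<le> (\<Sum>n. ?h (D (2 * n + 0))) + (\<Sum>n. ?h (D (2 * n + 1)))" .
    qed
    also have "\<dots> \<le> ?h X + ?h X" by (intro add_mono part)
    also have "\<dots> < top" using fin by (simp add: less_top)
    finally have sumfin: "(\<Sum>n. ?h (D n)) < top" .
    show ?thesis
    proof (rule ennreal_le_epsilon)
      fix e :: real assume "0 < e"
      obtain n where n: "(\<Sum>k. ?h (D (k + n))) \<le> ennreal e"
        using ennreal_tail_le[OF sumfin, of "ennreal e"] \<open>0 < e\<close> by auto
      have cover: "X - F \<subseteq> Y n \<union> (\<Union>k. D (k + n))"
      proof
        fix x assume x: "x \<in> X - F"
        then have "0 < d x" using in_closed_iff_infdist_zero[OF assms ne] infdist_nonneg[of x F]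
          by (auto simp: d_def less_le)
        show "x \<in> Y n \<union> (\<Union>k. D (k + n))"
        proof (cases "x \<in> Y n")
          case False
          obtain m where m: "1 / (real m + 2) \<le> d x" "d x < 1 / (real m + 1)" "n \<le> m"
          proof -
            \<comment> \<open>the shell of \<open>x\<close>: the first index whose lower bound \<open>d x\<close> reaches\<close>
            define l where "l = (LEAST m. 1 / (real m + 2) \<le> d x)"
            obtain N where "1 / d x < real N" using reals_Archimedean2 by blast
            then have "1 / (real N + 2) \<le> d x" using \<open>0 < d x\<close>
              by (simp add: field_simps)
            then have 1: "1 / (real l + 2) \<le> d x" unfolding l_def by (rule LeastI)
            have dn: "d x < 1 / (real n + 1)" using False x by (auto simp: Y_def)
            have 2: "n \<le> l"
            proof (rule ccontr)
              assume "\<not> n \<le> l"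
              then have "1 / (real n + 1) \<le> 1 / (real l + 2)" by (simp add: field_simps)
              with 1 dn show False by simp
            qed
            have 3: "d x < 1 / (real l + 1)"
            proof (cases l)
              case 0 then show ?thesis using 2 dn by simp
            next
              case (Suc k)
              then have "\<not> 1 / (real k + 2) \<le> d x"
                using not_less_Least[of k "\<lambda>m. 1 / (real m + 2) \<le> d x"] by (simp add: l_def)
              then show ?thesis using Suc by (simp add: algebra_simps)
            qed
            show ?thesis using that 1 2 3 by blast
          qed
          then have "x \<in> D ((m - n) + n)" using x by (auto simp: D_def)
          then show ?thesis by blast
        qed auto
      qed
      have "?h (X - F) \<le> ?h (Y n) + ?h (\<Union>k. D (k + n))"
        using hausdorff_outer_mono[OF cover] hausdorff_outer_Un_le order_trans by blast
      also have "\<dots> \<le> ?h (Y n) + ennreal e"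
        using hausdorff_outer_subadditive[of "\<lambda>k. D (k + n)"] n by (intro add_mono) auto
      finally have "?h (F \<inter> X) + ?h (X - F) \<le> (?h (F \<inter> X) + ?h (Y n)) + ennreal e"
        by (simp add: add_left_mono add.assoc)
      also have "?h (F \<inter> X) + ?h (Y n) = ?h ((F \<inter> X) \<union> Y n)"
      proof (rule hausdorff_outer_metric)
        fix x y assume "x \<in> F \<inter> X" "y \<in> Y n"
        then show "1 / (real n + 1) \<le> dist x y"
          using lip[of y x] by (auto simp: Y_def d_def dist_commute)
      qed auto
      also have "\<dots> \<le> ?h X" by (rule hausdorff_outer_mono) (auto simp: Y_def)
      finally show "?h (F \<inter> X) + ?h (X - F) \<le> ?h X + ennreal e" by simp
    qed
  qed auto
  moreover have "?h X \<le> ?h (F \<inter> X) + ?h (X - F)" for X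
  proof -
    have "(F \<inter> X) \<union> (X - F) = X" by blast
    then show ?thesis using hausdorff_outer_Un_le[of "F \<inter> X" "X - F"] by simp
  qed
  ultimately show ?thesis
    by (auto simp: lambda_system_def Diff_eq Int_commute intro!: antisym)
qed

lemma
  shows sets_hausdorff1 [simp, measurable_cong]: "sets hausdorff1 = sets borel"
    and space_hausdorff1 [simp]: "space hausdorff1 = UNIV"
    and emeasure_hausdorff1: "X \<in> sets borel \<Longrightarrow> emeasure hausdorff1 X = hausdorff_outer X"
proof -
  let ?L = "lambda_system UNIV (Pow UNIV) hausdorff_outer"
  interpret Pow: sigma_algebra "UNIV::complex set" "Pow UNIV" by (rule sigma_algebra_Pow)
  have L: "measure_space UNIV ?L hausdorff_outer"
    by (rule Pow.caratheodory_lemma[OF outer_measure_space_hausdorff])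
  then interpret L: sigma_algebra UNIV ?L by (simp add: measure_space_def)
  have "sets borel = sigma_sets UNIV (Collect (closed :: complex set \<Rightarrow> bool))"
    unfolding borel_eq_closed by simp
  also have "\<dots> \<subseteq> ?L"
    by (rule L.sigma_sets_subset) (use closed_in_lambda_system_hausdorff in auto)
  finally have "sets borel \<subseteq> ?L" .
  then have ms: "measure_space UNIV (sets borel) hausdorff_outer"
    by (rule measure_down[OF L, rotated]) (metis sets.sigma_algebra_axioms space_borel)
  show "sets hausdorff1 = sets borel" "space hausdorff1 = UNIV"
    unfolding hausdorff1_def by (auto simp: sets_measure_of_conv space_measure_of_conv) (metis sets.sigma_sets_eq space_borel)+
  show "emeasure hausdorff1 X = hausdorff_outer X" if "X \<in> sets borel"
    using ms that unfolding hausdorff1_def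
    by (subst emeasure_measure_of_conv) (auto simp: sets.sigma_sets_eq[of borel, simplified])
qed

section \<open>Hausdorff measure of segments\<close>

lemma hausdorff_outer_line_le:
  assumes "cmod e = 1"
  shows "hausdorff_outer ((\<lambda>t. p + of_real t * e) ` {l<..<u}) \<le> ennreal (u - l)"
proof (cases "l < u")
  case True
  let ?g = "\<lambda>t. p + of_real t * e"
  have dg: "cmod (?g s - ?g t) = \<bar>s - t\<bar>" for s t
  proof -
    have "?g s - ?g t = of_real (s - t) * e" by (simp add: algebra_simps)
    then show ?thesis using assms by (metis mult.right_neutral norm_mult norm_of_real)
  qed
  show ?thesis unfolding hausdorff_outer_def
  proof (rule SUP_least)
    fix \<delta> :: real assume "\<delta> \<in> {0<..}"
    obtain n :: nat where n: "(u - l) / \<delta> < real n" using reals_Archimedean2 by blast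
    moreover have "0 < (u - l) / \<delta>" using True \<open>\<delta> \<in> {0<..}\<close> by simp
    ultimately have "0 < n" by linarith
    define w where "w = (u - l) / real n"
    have w: "0 < w" "w \<le> \<delta>" "real n * w = u - l"
      using n True \<open>0 < n\<close> \<open>\<delta> \<in> {0<..}\<close> by (auto simp: w_def field_simps)
    define U where "U k = (if k < n then ?g ` {l + real k * w .. l + (real k + 1) * w} else {})" for k
    have dU: "diameter (U k) \<le> w" for k
    proof (rule diameter_le)
      fix x y assume "x \<in> U k" "y \<in> U k"
      then have "x \<in> ?g ` {l + real k * w .. l + (real k + 1) * w}" "y \<in> ?g ` {l + real k * w .. l + (real k + 1) * w}"
        unfolding U_def by (simp_all only: split: if_splits) auto
      then obtain s t where st: "x = ?g s" "y = ?g t" "s \<in> {l + real k * w .. l + (real k + 1) * w}"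
          "t \<in> {l + real k * w .. l + (real k + 1) * w}" by blast
      show "cmod (x - y) \<le> w" unfolding st(1,2) dg using st(3,4) by (auto simp: abs_le_iff algebra_simps)
    qed (use w in auto)
    have "hausdorff_pre \<delta> (?g ` {l<..<u}) \<le> (\<Sum>k. ennreal (diameter (U k)))"
    proof (rule hausdorff_pre_le_cover)
      show "?g ` {l<..<u} \<subseteq> (\<Union>k. U k)"
      proof clarify
        fix t assume t: "t \<in> {l<..<u}"
        define k where "k = nat \<lfloor>(t - l) / w\<rfloor>"
        have "0 \<le> (t - l) / w" using t w by auto
        then have k: "real k \<le> (t - l) / w" "(t - l) / w < real k + 1"
          by (auto simp: k_def)
        then have k': "real k * w \<le> t - l" "t - l < (real k + 1) * w"
          using w(1) by (auto simp: field_simps)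
        have "real k * w < real n * w" using k' t w(3) by auto
        then have "k < n" using w(1) by simp
        moreover have "t \<in> {l + real k * w .. l + (real k + 1) * w}" using k' by auto
        ultimately have "?g t \<in> U k" by (auto simp: U_def)
        then show "?g t \<in> (\<Union>k. U k)" by blast
      qed
      show "bounded (U k)" for k
        by (auto simp: U_def intro!: compact_imp_bounded compact_continuous_image continuous_intros)
      show "diameter (U k) \<le> \<delta>" for k using dU[of k] w(2) by linarith
    qed
    also have "\<dots> = (\<Sum>k<n. ennreal (diameter (U k)))"
      by (rule suminf_finite) (auto simp: U_def)
    also have "\<dots> \<le> (\<Sum>k<n. ennreal w)"
      by (intro sum_mono ennreal_leI dU)
    also have "\<dots> = ennreal (u - l)"
      using w by (simp add: ennreal_of_nat_eq_real_of_nat flip: ennreal_mult)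
    finally show "hausdorff_pre \<delta> (?g ` {l<..<u}) \<le> ennreal (u - l)" .
  qed
qed auto

lemma line_projection:
  assumes "cmod e = 1"
  shows "Re (cnj e * ((p + of_real t * e) - p)) = t"
proof -
  have "cnj e * e = 1" using assms by (simp add: complex_norm_square[symmetric] mult.commute)
  then have "cnj e * ((p + of_real t * e) - p) = of_real t" by (simp add: algebra_simps)
  then show ?thesis by (simp only: Re_complex_of_real)
qed

text \<open>
  The projection to the line does not increase diameters, so a cover of the segment gives a cover of
  an interval by intervals of no larger total length.
\<close>

lemma hausdorff_outer_line_ge:
  assumes "cmod e = 1" "l \<le> u"
  shows "ennreal (u - l) \<le> hausdorff_outer ((\<lambda>t. p + of_real t * e) ` {l<..<u})"
proof -
  let ?g = "\<lambda>t. p + of_real t * e"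
  define \<pi> where "\<pi> z = Re (cnj e * (z - p))" for z
  have lip: "\<pi> z - \<pi> z' \<le> cmod (z - z')" for z z'
  proof -
    have "\<pi> z - \<pi> z' = Re (cnj e * (z - z'))" by (simp add: \<pi>_def algebra_simps)
    also have "\<dots> \<le> cmod (cnj e * (z - z'))" by (rule complex_Re_le_cmod)
    finally show ?thesis using assms by (simp add: norm_mult)
  qed
  have \<pi>g: "\<pi> (?g t) = t" for t unfolding \<pi>_def by (rule line_projection[OF assms(1)])
  have "ennreal (u - l) \<le> hausdorff_pre 1 (?g ` {l<..<u})"
    unfolding hausdorff_pre_def
  proof (rule INF_greatest)
    fix U :: "nat \<Rightarrow> complex set"
    assume "U \<in> {U. ?g ` {l<..<u} \<subseteq> (\<Union>n. U n) \<and> (\<forall>n. bounded (U n) \<and> diameter (U n) \<le> 1)}"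
    then have U: "?g ` {l<..<u} \<subseteq> (\<Union>n. U n)" "\<And>n. bounded (U n)" by auto
    define V where "V n = (if U n = {} then {} else {Inf (\<pi> ` U n) .. Sup (\<pi> ` U n)})" for n
    have d: "\<pi> x - \<pi> y \<le> diameter (U n)" if "x \<in> U n" "y \<in> U n" for n x y
      using diameter_bounded_bound[OF U(2) that] lip[of x y] by (simp add: dist_norm)
    have bd: "bdd_above (\<pi> ` U n)" "bdd_below (\<pi> ` U n)" for n
    proof -
      show "bdd_above (\<pi> ` U n)"
      proof (cases "U n = {}")
        case False
        then obtain y where "y \<in> U n" by blast
        then show ?thesis using d[of _ n y] by (intro bdd_aboveI[of _ "diameter (U n) + \<pi> y"]) force
      qed auto
      show "bdd_below (\<pi> ` U n)"
      proof (cases "U n = {}")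
        case False
        then obtain y where "y \<in> U n" by blast
        then show ?thesis using d[of y n] by (intro bdd_belowI[of _ "\<pi> y - diameter (U n)"]) force
      qed auto
    qed
    have "{l<..<u} \<subseteq> (\<Union>n. V n)"
    proof
      fix t assume "t \<in> {l<..<u}"
      then obtain n where n: "?g t \<in> U n" using U(1) by blast
      then have "\<pi> (?g t) \<in> \<pi> ` U n" by blast
      then have "t \<in> V n" using n bd[of n]
        unfolding \<pi>g V_def by (auto intro: cInf_lower cSup_upper)
      then show "t \<in> (\<Union>n. V n)" by blast
    qed
    then have "emeasure lborel {l<..<u} \<le> emeasure lborel (\<Union>n. V n)"
      by (intro emeasure_mono) (auto simp: V_def)
    also have "\<dots> \<le> (\<Sum>n. emeasure lborel (V n))"
      by (intro emeasure_subadditive_countably) (auto simp: V_def)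
    also have "\<dots> \<le> (\<Sum>n. ennreal (diameter (U n)))"
    proof (intro suminf_le summableI)
      fix n
      show "emeasure lborel (V n) \<le> ennreal (diameter (U n))"
      proof (cases "U n = {}")
        case False
        have "Sup (\<pi> ` U n) \<le> Inf (\<pi> ` U n) + diameter (U n)"
        proof (rule cSup_least)
          fix x assume "x \<in> \<pi> ` U n"
          then have "x - diameter (U n) \<le> Inf (\<pi> ` U n)"
            using False d[of _ n] by (intro cInf_greatest) force+
          then show "x \<le> Inf (\<pi> ` U n) + diameter (U n)" by simp
        qed (use False in auto)
        moreover have "Inf (\<pi> ` U n) \<le> Sup (\<pi> ` U n)"
          using False bd by (intro cInf_le_cSup) auto
        ultimately show ?thesis using False by (simp add: V_def ennreal_leI)
      qed (simp add: V_def)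
    qed
    finally show "ennreal (u - l) \<le> (\<Sum>n. ennreal (diameter (U n)))"
      using assms by simp
  qed
  also have "\<dots> \<le> hausdorff_outer (?g ` {l<..<u})" by (rule hausdorff_pre_le_outer) simp
  finally show ?thesis .
qed

text \<open>
  On boxes the image measure is interval length, by the two preceding estimates; this characterises
  Lebesgue measure.
\<close>

lemma hausdorff1_on_line:
  fixes p e :: complex
  assumes e: "cmod e = 1"
  defines "g \<equiv> \<lambda>t. p + of_real t * e" and "\<pi> \<equiv> \<lambda>z. Re (cnj e * (z - p))"
  shows "distr (restrict_space hausdorff1 (range g)) borel \<pi> = lborel"
    and "range g \<in> sets borel"
proof -
  have \<pi>g: "\<pi> (g t) = t" for t unfolding \<pi>_def g_def by (rule line_projection[OF e])
  have range: "range g = {z. g (\<pi> z) = z}" using \<pi>g by (auto simp: image_iff) (metis)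
  have cont: "continuous_on UNIV g" "continuous_on UNIV \<pi>"
    unfolding g_def \<pi>_def by (auto intro!: continuous_intros)
  have "closed (range g)" unfolding range
    by (intro closed_Collect_eq continuous_on_compose2[OF cont] continuous_intros) auto
  then show rb: "range g \<in> sets borel" by simp
  have [measurable]: "\<pi> \<in> borel_measurable borel" using cont by (intro borel_measurable_continuous_onI)
  then have m: "\<pi> \<in> measurable (restrict_space hausdorff1 (range g)) borel"
    by (intro measurable_restrict_space1) (simp add: measurable_cong_sets[OF sets_hausdorff1 refl])
  show "distr (restrict_space hausdorff1 (range g)) borel \<pi> = lborel"
  proof (rule lborel_eqI[symmetric])
    fix l u :: real assume "\<And>b. b \<in> Basis \<Longrightarrow> l \<bullet> b \<le> u \<bullet> b"
    then have "l \<le> u" by simp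
    have box: "\<pi> -` {l<..<u} \<inter> range g = g ` {l<..<u}"
      using \<pi>g by (auto simp: image_iff)
    have ib: "g ` {l<..<u} \<in> sets borel"
      unfolding box[symmetric] using rb by (intro sets.Int measurable_sets_borel[of \<pi> borel]) auto
    have "emeasure (distr (restrict_space hausdorff1 (range g)) borel \<pi>) {l<..<u} =
        emeasure (restrict_space hausdorff1 (range g)) (g ` {l<..<u})"
      by (subst emeasure_distr[OF m]) (auto simp: space_restrict_space box)
    also have "\<dots> = hausdorff_outer (g ` {l<..<u})"
      using rb ib by (subst emeasure_restrict_space) (auto simp: emeasure_hausdorff1)
    also have "\<dots> = ennreal (u - l)"
      unfolding g_def using hausdorff_outer_line_le[OF e] hausdorff_outer_line_ge[OF e \<open>l \<le> u\<close>]
      by (rule antisym)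
    finally show "emeasure (distr (restrict_space hausdorff1 (range g)) borel \<pi>) (box l u) = (\<Prod>b\<in>Basis. (u - l) \<bullet> b)"
      by simp
  qed simp
qed

lemma hausdorff1_integral_segment:
  fixes f :: "complex \<Rightarrow> real"
  assumes [measurable]: "f \<in> borel_measurable borel" and "a \<noteq> b"
  shows "(LINT x : closed_segment a b | hausdorff1. f x) =
    dist a b * (LINT s : {0<..<1} | lborel. f (linepath a b s))"
proof -
  define l where "l = dist a b"
  define e where "e = (b - a) / of_real l"
  have l: "0 < l" using assms by (simp add: l_def)
  have e: "cmod e = 1" using l by (simp add: e_def norm_divide) (simp add: l_def dist_norm norm_minus_commute)
  have ba: "b = a + of_real l * e" using l by (simp add: e_def)
  define g where "g t = a + of_real t * e" for t
  define \<pi> where "\<pi> z = Re (cnj e * (z - a))" for z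
  have g': "(\<lambda>t. a + of_real t * e) = g" "(\<lambda>z. Re (cnj e * (z - a))) = \<pi>" by (auto simp: g_def \<pi>_def)
  note line = hausdorff1_on_line(1)[OF e, of a, unfolded g'] hausdorff1_on_line(2)[OF e, of a, unfolded g']
  have \<pi>g: "\<pi> (g t) = t" for t unfolding \<pi>_def g_def by (rule line_projection[OF e])
  have [measurable]: "g \<in> borel_measurable borel" "\<pi> \<in> borel_measurable borel"
    unfolding g_def \<pi>_def by (auto intro!: borel_measurable_continuous_onI continuous_intros)
  have m: "\<pi> \<in> measurable (restrict_space hausdorff1 (range g)) borel"
    by (intro measurable_restrict_space1) (simp add: measurable_cong_sets[OF sets_hausdorff1 refl])
  have seg: "g t \<in> closed_segment a b \<longleftrightarrow> t \<in> {0..l}" for t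
  proof
    assume "g t \<in> closed_segment a b"
    then obtain s where s: "0 \<le> s" "s \<le> 1" "g t = (1 - s) *\<^sub>R a + s *\<^sub>R b" by (auto simp: in_segment)
    have "g t = g (s * l)" unfolding s(3) by (simp add: ba g_def scaleR_conv_of_real algebra_simps)
    then have "\<pi> (g t) = \<pi> (g (s * l))" by (rule arg_cong)
    then have "t = s * l" unfolding \<pi>g .
    then show "t \<in> {0..l}" using s l by (auto simp: mult_left_le_one_le)
  next
    assume t: "t \<in> {0..l}"
    then have "g t = (1 - t / l) *\<^sub>R a + (t / l) *\<^sub>R b"
      using l by (simp add: ba g_def scaleR_conv_of_real field_simps)
    then show "g t \<in> closed_segment a b" using t l by (auto simp: in_segment intro!: exI[of _ "t / l"])
  qed
  have sub: "closed_segment a b \<subseteq> range g"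
  proof
    fix z assume "z \<in> closed_segment a b"
    then obtain s where "z = (1 - s) *\<^sub>R a + s *\<^sub>R b" by (auto simp: in_segment)
    then have "z = g (s * l)" by (simp add: ba g_def scaleR_conv_of_real algebra_simps)
    then show "z \<in> range g" by blast
  qed
  define G where "G t = indicator {0..l} t *\<^sub>R f (g t)" for t
  have [measurable]: "G \<in> borel_measurable borel" unfolding G_def by measurable
  have "(LINT x : closed_segment a b | hausdorff1. f x) =
      (LINT x | hausdorff1. indicator (range g) x *\<^sub>R G (\<pi> x))"
    unfolding set_lebesgue_integral_def
  proof (rule Bochner_Integration.integral_cong[OF refl])
    fix x
    show "indicator (closed_segment a b) x *\<^sub>R f x = indicator (range g) x *\<^sub>R G (\<pi> x)"
    proof (cases "x \<in> range g")
      case True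
      then obtain t where "x = g t" by blast
      then show ?thesis using \<pi>g seg[of t] by (auto simp: G_def indicator_def)
    next
      case False then show ?thesis using sub by (auto simp: indicator_def)
    qed
  qed
  also have "\<dots> = (LINT x | restrict_space hausdorff1 (range g). G (\<pi> x))"
    using line(2) by (subst integral_restrict_space) auto
  also have "\<dots> = (LINT t | distr (restrict_space hausdorff1 (range g)) borel \<pi>. G t)"
    by (rule integral_distr[symmetric, OF m]) measurable
  also have "\<dots> = (LINT t | lborel. G t)" unfolding line(1) ..
  also have "\<dots> = l * (LINT s | lborel. G (0 + l * s))"
    using lborel_integral_real_affine[of l G 0] l by simp
  also have "(LINT s | lborel. G (0 + l * s)) = (LINT s : {0<..<1} | lborel. f (linepath a b s))"
    unfolding set_lebesgue_integral_def
  proof (rule integral_cong_AE)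
    have "AE s in lborel. s \<noteq> 0 \<and> s \<noteq> (1::real)"
      using AE_lborel_singleton[of "0::real"] AE_lborel_singleton[of "1::real"] by eventually_elim auto
    then show "AE s in lborel. G (0 + l * s) = indicator {0<..<1} s *\<^sub>R f (linepath a b s)"
    proof eventually_elim
      case (elim s)
      have "g (l * s) = linepath a b s"
        by (simp add: ba g_def linepath_def scaleR_conv_of_real algebra_simps)
      then show ?case using elim l by (auto simp: G_def indicator_def zero_le_mult_iff mult_le_cancel_left1)
    qed
    show "(\<lambda>s. indicator {0<..<1} s *\<^sub>R f (linepath a b s)) \<in> borel_measurable lborel"
    proof -
      have [measurable]: "linepath a b \<in> borel_measurable borel"
        by (intro borel_measurable_continuous_onI continuous_on_linepath)
      show ?thesis by measurable
    qed
  qed auto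
  finally show ?thesis by (simp add: l_def)
qed

section \<open>Orthonormal frames and Lebesgue measure\<close>

definition frame :: "complex \<Rightarrow> complex \<Rightarrow> complex \<Rightarrow> real \<Rightarrow> real \<Rightarrow> complex" where
  "frame c e f x y = c + of_real x * e + of_real y * f"

text \<open>
  Both orientations are admitted, so that a third point can always be put into the upper half plane.
\<close>

definition orthonormal :: "complex \<Rightarrow> complex \<Rightarrow> bool" where
  "orthonormal e f \<longleftrightarrow> cmod e = 1 \<and> (f = \<i> * e \<or> f = - \<i> * e)"

lemma orthonormal_pow2: "orthonormal e f \<Longrightarrow> (Re e)\<^sup>2 + (Im e)\<^sup>2 = 1"
  unfolding orthonormal_def by (metis cmod_power2 one_power2)

lemma norm_orthonormal:
  assumes "orthonormal e f"
  shows "cmod (of_real x * e + of_real y * f) = sqrt (x\<^sup>2 + y\<^sup>2)"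
proof -
  have "(cmod (of_real x * e + of_real y * f))\<^sup>2 = (x\<^sup>2 + y\<^sup>2) * ((Re e)\<^sup>2 + (Im e)\<^sup>2)"
    using assms unfolding orthonormal_def cmod_power2 by (auto simp: power2_eq_square algebra_simps)
  then show ?thesis using orthonormal_pow2[OF assms] by (simp add: real_sqrt_unique)
qed

lemma dist_frame:
  assumes "orthonormal e f"
  shows "dist (frame c e f x y) (frame c e f x' y') = sqrt ((x - x')\<^sup>2 + (y - y')\<^sup>2)"
proof -
  have "frame c e f x y - frame c e f x' y' = of_real (x - x') * e + of_real (y - y') * f"
    by (simp add: frame_def algebra_simps)
  then show ?thesis by (simp only: dist_norm norm_orthonormal[OF assms])
qed

lemma frame_eq_iff:
  assumes "orthonormal e f"
  shows "frame c e f x y = frame c e f x' y' \<longleftrightarrow> x = x' \<and> y = y'"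
proof -
  have "frame c e f x y = frame c e f x' y' \<longleftrightarrow> (x - x')\<^sup>2 + (y - y')\<^sup>2 = 0"
    using dist_frame[OF assms, of c x y x' y'] by (metis dist_eq_0_iff real_sqrt_eq_0_iff)
  then show ?thesis by (simp add: sum_power2_eq_zero_iff)
qed

lemma frame_coordinates:
  assumes "orthonormal e f"
  shows "frame c e f (Re (cnj e * (w - c))) (Re (cnj f * (w - c))) = w"
proof -
  have s: "Re e * Re e + Im e * Im e = 1" using orthonormal_pow2[OF assms] by (simp add: power2_eq_square)
  define u where "u = w - c"
  have "of_real (Re (cnj e * u)) * e + of_real (Re (cnj f * u)) * f
      = of_real (Re e * Re e + Im e * Im e) * u"
    using assms by (auto simp: orthonormal_def complex_eq_iff algebra_simps)
  then have "frame c e f (Re (cnj e * u)) (Re (cnj f * u)) = c + u"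
    unfolding s frame_def by (metis add.assoc mult_1 of_real_1)
  then show ?thesis by (simp only: u_def add_diff_cancel_left' diff_add_cancel add_diff_eq)
qed

abbreviation "plane \<equiv> (lborel \<Otimes>\<^sub>M lborel :: (real \<times> real) measure)"

lemma plane_shear_fst:
  fixes \<phi> :: "real \<Rightarrow> real"
  assumes [measurable]: "\<phi> \<in> borel_measurable borel" and r: "\<bar>r\<bar> = 1"
  shows "distr plane plane (\<lambda>(x, y). (r * x + \<phi> y, y)) = plane"
proof (rule measure_eqI)
  fix A assume "A \<in> sets (distr plane plane (\<lambda>(x, y). (r * x + \<phi> y, y)))"
  then have [measurable]: "A \<in> sets plane" by simp
  have "emeasure (distr plane plane (\<lambda>(x, y). (r * x + \<phi> y, y))) A =
      (\<integral>\<^sup>+ z. indicator A z \<partial>distr plane plane (\<lambda>(x, y). (r * x + \<phi> y, y)))"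
    by (rule nn_integral_indicator[symmetric]) measurable
  also have "\<dots> = (\<integral>\<^sup>+ z. indicator A (case z of (x, y) \<Rightarrow> (r * x + \<phi> y, y)) \<partial>plane)"
    by (rule nn_integral_distr) measurable
  also have "\<dots> = (\<integral>\<^sup>+ y. \<integral>\<^sup>+ x. indicator A (r * x + \<phi> y, y) \<partial>lborel \<partial>lborel)"
    by (subst lborel_pair.nn_integral_snd[symmetric]) (auto simp: split_def)
  also have "\<dots> = (\<integral>\<^sup>+ y. \<integral>\<^sup>+ x. indicator A (x, y) \<partial>lborel \<partial>lborel)"
  proof (rule nn_integral_cong)
    fix y
    have "(\<integral>\<^sup>+ x. indicator A (x, y) \<partial>lborel) = ennreal \<bar>r\<bar> * (\<integral>\<^sup>+ x. indicator A (\<phi> y + r * x, y) \<partial>lborel)"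
      using r by (intro nn_integral_real_affine) auto
    then show "(\<integral>\<^sup>+ x. indicator A (r * x + \<phi> y, y) \<partial>lborel) = (\<integral>\<^sup>+ x. indicator A (x, y) \<partial>lborel)"
      using r by (simp add: add.commute)
  qed
  also have "\<dots> = (\<integral>\<^sup>+ z. indicator A z \<partial>plane)"
    by (subst lborel_pair.nn_integral_snd[symmetric]) auto
  also have "\<dots> = emeasure plane A" by (rule nn_integral_indicator) measurable
  finally show "emeasure (distr plane plane (\<lambda>(x, y). (r * x + \<phi> y, y))) A = emeasure plane A" .
qed simp

lemma plane_swap: "distr plane plane (\<lambda>(x, y). (y, x)) = plane"
  by (rule lborel_pair.distr_pair_swap[symmetric])

lemma plane_comp:
  assumes "distr plane plane S = plane" "distr plane plane T = plane"
    "S \<in> measurable plane plane" "T \<in> measurable plane plane"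
  shows "distr plane plane (S \<circ> T) = plane"
  using distr_distr[OF assms(3,4)] assms by simp

lemma plane_shear_snd:
  fixes \<phi> :: "real \<Rightarrow> real"
  assumes [measurable]: "\<phi> \<in> borel_measurable borel" and r: "\<bar>r\<bar> = 1"
  shows "distr plane plane (\<lambda>(x, y). (x, r * y + \<phi> x)) = plane"
proof -
  have "(\<lambda>(x, y). (x, r * y + \<phi> x)) =
      (\<lambda>(x, y). (y, x)) \<circ> ((\<lambda>(x, y). (r * x + \<phi> y, y)) \<circ> (\<lambda>(x, y). (y, x)))"
    by (auto simp: fun_eq_iff)
  moreover have "distr plane plane ((\<lambda>(x, y). (y, x)) \<circ> ((\<lambda>(x, y). (r * x + \<phi> y, y)) \<circ> (\<lambda>(x, y). (y, x)))) = plane"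
    by (intro plane_comp plane_swap plane_shear_fst r assms) measurable
  ultimately show ?thesis by simp
qed

text \<open>
  A rotation with \<open>b \<noteq> 0\<close> is a product of three shears, and a shear preserves the plane measure by
  Fubini's theorem and the translation invariance on the line.
\<close>

lemma plane_rotation:
  assumes ab: "a\<^sup>2 + b\<^sup>2 = 1"
  shows "distr plane plane (\<lambda>(x, y). (a * x - b * y, b * x + a * y)) = plane"
proof (cases "b = 0")
  case True
  then have "\<bar>a\<bar> = 1" using ab by (auto simp: power2_eq_1_iff)
  have "(\<lambda>(x, y). (a * x - b * y, b * x + a * y)) =
      (\<lambda>(x, y). (a * x + 0, y)) \<circ> (\<lambda>(x, y). (x, a * y + 0))" using True by (auto simp: fun_eq_iff)
  moreover have "distr plane plane ((\<lambda>(x, y). (a * x + 0, y)) \<circ> (\<lambda>(x, y). (x, a * y + 0))) = plane"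
    using \<open>\<bar>a\<bar> = 1\<close> by (intro plane_comp plane_shear_fst plane_shear_snd) measurable
  ultimately show ?thesis by simp
next
  case False
  \<comment> \<open>minus the tangent of half the rotation angle\<close>
  define s where "s = (a - 1) / b"
  have s1: "1 + b * s = a" using False by (simp add: s_def)
  have s2: "s + a * s = - b"
  proof -
    have "s + a * s = (a\<^sup>2 - 1) / b" by (simp add: s_def diff_divide_distrib algebra_simps power2_eq_square)
    also have "a\<^sup>2 - 1 = - (b * b)" using ab by (simp add: power2_eq_square)
    finally show ?thesis using False by simp
  qed
  let ?X = "\<lambda>(x, y). (1 * x + s * y, y)" and ?Y = "\<lambda>(x, y). (x, 1 * y + b * x)"
  have "(\<lambda>(x, y). (a * x - b * y, b * x + a * y)) = ?X \<circ> (?Y \<circ> ?X)"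
  proof (rule ext, clarsimp)
    fix x y :: real
    have "x + s * y + s * (y + b * (x + s * y)) = (1 + b * s) * x + (s + (1 + b * s) * s) * y"
      by (simp add: algebra_simps)
    moreover have "y + b * (x + s * y) = b * x + (1 + b * s) * y"
      by (simp add: algebra_simps)
    ultimately show "a * x - b * y = x + s * y + s * (y + b * (x + s * y)) \<and>
        b * x + a * y = y + b * (x + s * y)" unfolding s1 s2 by simp
  qed
  moreover have "distr plane plane (?X \<circ> (?Y \<circ> ?X)) = plane"
    by (intro plane_comp plane_shear_fst plane_shear_snd) measurable
  ultimately show ?thesis by simp
qed

lemma plane_Complex: "distr plane borel (\<lambda>(x, y). Complex x y) = lborel"
proof (rule lborel_eqI[symmetric])
  fix l u :: complex assume le: "\<And>b. b \<in> Basis \<Longrightarrow> l \<bullet> b \<le> u \<bullet> b"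
  have le': "Re l \<le> Re u" "Im l \<le> Im u" using le[of 1] le[of \<i>] by (auto simp: Basis_complex_def)
  have m: "(\<lambda>(x, y). Complex x y) \<in> measurable plane borel"
    unfolding Complex_eq by measurable
  have v: "(\<lambda>(x, y). Complex x y) -` box l u \<inter> space plane = {Re l<..<Re u} \<times> {Im l<..<Im u}"
    by (auto simp: in_box_complex_iff space_pair_measure)
  show "emeasure (distr plane borel (\<lambda>(x, y). Complex x y)) (box l u) = ennreal (\<Prod>b\<in>Basis. (u - l) \<bullet> b)"
    using le' unfolding emeasure_distr[OF m borel_open[OF open_box]] v
    by (subst lborel.emeasure_pair_measure_Times) (auto simp: Basis_complex_def ennreal_mult)
qed simp

lemma borel_measurable_frame [measurable]: "(\<lambda>(x, y). frame c e f x y) \<in> borel_measurable plane"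
  unfolding frame_def by measurable

lemma plane_frame:
  assumes "orthonormal e f"
  shows "distr plane borel (\<lambda>(x, y). frame c e f x y) = lborel"
proof -
  define a b where "a = Re e" and "b = Im e"
  define r :: real where "r = (if f = \<i> * e then 1 else -1)"
  have ab: "a\<^sup>2 + b\<^sup>2 = 1" using orthonormal_pow2[OF assms] by (simp add: a_def b_def)
  have r: "\<bar>r\<bar> = 1" by (simp add: r_def)
  have f: "f = of_real r * \<i> * e" using assms by (auto simp: r_def orthonormal_def)
  let ?C = "\<lambda>(x, y). Complex x y"
  let ?T = "(\<lambda>(x, y). (1 * x + Re c, y)) \<circ> ((\<lambda>(x, y). (x, 1 * y + Im c)) \<circ>
      ((\<lambda>(x, y). (a * x - b * y, b * x + a * y)) \<circ> (\<lambda>(x, y). (x, r * y + 0))))"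
  have T: "distr plane plane ?T = plane"
    by (intro plane_comp plane_shear_fst plane_shear_snd plane_rotation ab r) measurable
  have "(\<lambda>(x, y). frame c e f x y) = ?C \<circ> ?T"
    by (auto simp: fun_eq_iff frame_def f complex_eq_iff a_def b_def)
  then have "distr plane borel (\<lambda>(x, y). frame c e f x y) = distr plane borel (?C \<circ> ?T)" by simp
  also have "\<dots> = distr (distr plane plane ?T) borel ?C"
    by (rule distr_distr[symmetric]) (unfold Complex_eq, measurable)
  also have "\<dots> = lborel" unfolding T by (rule plane_Complex)
  finally show ?thesis .
qed

section \<open>Kernels with bounded potentials\<close>

text \<open>
  The kernels of the theorem, normalised to be nonnegative and Borel on the whole line.
\<close>

definition pair_kernel :: "(real \<Rightarrow> real) \<Rightarrow> bool" where
  "pair_kernel k \<longleftrightarrow> (\<forall>r. 0 \<le> k r) \<and> k \<in> borel_measurable borel \<and> continuous_on {0<..} k \<and>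
     strict_antimono_on {0<..} k \<and> set_integrable lborel {0<..<1} (\<lambda>r. k r * r)"

lemma pair_kernel_antimono:
  assumes "pair_kernel k" "0 < r" "r \<le> s"
  shows "k s \<le> k r"
  using assms by (cases "r = s") (auto simp: pair_kernel_def monotone_on_def intro: less_imp_le)

lemma pair_kernel_strict:
  assumes "pair_kernel k" "0 < r" "r < s"
  shows "k s < k r"
  using assms by (auto simp: pair_kernel_def monotone_on_def)

lemma pair_kernel_measurable: "pair_kernel k \<Longrightarrow> k \<in> borel_measurable borel"
  by (simp add: pair_kernel_def)

lemma pair_kernel_nonneg: "pair_kernel k \<Longrightarrow> 0 \<le> k r"
  by (simp add: pair_kernel_def)

text \<open>
  Polar coordinates are avoided: since \<open>k\<close> decreases, \<open>k (sqrt (x\<^sup>2 + y\<^sup>2))\<close> is at most \<open>k\<close> of the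
  larger of \<open>\<bar>x\<bar>\<close> and \<open>\<bar>y\<bar>\<close>, and integrating the smaller coordinate out first leaves
  \<open>2 * \<bar>x\<bar> * k \<bar>x\<bar>\<close>, which is integrable near \<open>0\<close>.
\<close>

lemma pair_kernel_square_finite:
  assumes k: "pair_kernel k"
  shows "(\<integral>\<^sup>+ (x, y). ennreal (k (sqrt (x\<^sup>2 + y\<^sup>2))) * indicator ({-1<..<1} \<times> {-1<..<1}) (x, y) \<partial>plane) < top"
proof -
  note [measurable] = pair_kernel_measurable[OF k]
  define h where "h x y = ennreal (k \<bar>x\<bar>) * indicator {-1<..<1} x * indicator {-\<bar>x\<bar>..\<bar>x\<bar>} y" for x y :: real
  have [measurable]: "case_prod h \<in> borel_measurable plane"
  proof -
    have "case_prod h = (\<lambda>(x, y). ennreal (k \<bar>x\<bar>) * indicator {-1<..<1} x * (if -\<bar>x\<bar> \<le> y \<and> y \<le> \<bar>x\<bar> then 1 else 0))"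
      by (auto simp: h_def fun_eq_iff indicator_def)
    then show ?thesis by simp
  qed
  have [measurable]: "(\<lambda>(x, y). h y x) \<in> borel_measurable plane"
    using measurable_compose[OF measurable_pair_swap' \<open>case_prod h \<in> borel_measurable plane\<close>] by (simp add: split_def)
  have "integrable lborel (\<lambda>r. indicator {0<..<1} r *\<^sub>R (k r * r))" (is "integrable _ ?g")
    using k by (simp add: pair_kernel_def set_integrable_def)
  then have "integrable lborel (\<lambda>r. 2 * (?g r + ?g (0 + (-1) * r)))"
    by (intro integrable_mult_right Bochner_Integration.integrable_add lborel_integrable_real_affine) auto
  then have fin: "(\<integral>\<^sup>+ r. ennreal (2 * (?g r + ?g (- r))) \<partial>lborel) < top"
    using integrableD(2) by (fastforce simp: less_top[symmetric])
  have inner: "(\<integral>\<^sup>+ y. h x y \<partial>lborel) = ennreal (2 * (?g x + ?g (- x)))" for x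
  proof -
    have "(\<integral>\<^sup>+ y. h x y \<partial>lborel) = ennreal (k \<bar>x\<bar>) * indicator {-1<..<1} x * ennreal (2 * \<bar>x\<bar>)"
      unfolding h_def by (subst nn_integral_cmult_indicator) auto
    also have "\<dots> = ennreal (2 * (?g x + ?g (- x)))"
      using pair_kernel_nonneg[OF k] by (auto simp: indicator_def abs_if mult_ac simp flip: ennreal_mult')
    finally show ?thesis .
  qed
  have H: "(\<integral>\<^sup>+ (x, y). h x y \<partial>plane) = (\<integral>\<^sup>+ r. ennreal (2 * (?g r + ?g (- r))) \<partial>lborel)"
    by (subst lborel.nn_integral_fst[symmetric]) (auto simp: inner)
  have H': "(\<integral>\<^sup>+ (x, y). h y x \<partial>plane) = (\<integral>\<^sup>+ r. ennreal (2 * (?g r + ?g (- r))) \<partial>lborel)"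
    by (subst lborel_pair.nn_integral_snd[symmetric]) (auto simp: inner)
  have "(\<integral>\<^sup>+ (x, y). ennreal (k (sqrt (x\<^sup>2 + y\<^sup>2))) * indicator ({-1<..<1} \<times> {-1<..<1}) (x, y) \<partial>plane)
      \<le> (\<integral>\<^sup>+ (x, y). h x y + h y x \<partial>plane)"
  proof (rule nn_integral_mono, clarify)
    fix x y :: real
    have *: "k (sqrt (u\<^sup>2 + v\<^sup>2)) \<le> k \<bar>u\<bar>" if "\<bar>v\<bar> \<le> \<bar>u\<bar>" for u v
    proof (cases "u = 0")
      case False
      then show ?thesis by (intro pair_kernel_antimono[OF k]) auto
    qed (use that in auto)
    show "ennreal (k (sqrt (x\<^sup>2 + y\<^sup>2))) * indicator ({-1<..<1} \<times> {-1<..<1}) (x, y) \<le> h x y + h y x"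
    proof (cases "(x, y) \<in> {-1<..<1} \<times> {-1<..<1}")
      case True
      show ?thesis
      proof (cases "\<bar>y\<bar> \<le> \<bar>x\<bar>")
        case le: True
        then have "ennreal (k (sqrt (x\<^sup>2 + y\<^sup>2))) \<le> h x y" using True *[of y x]
          by (auto simp: h_def ennreal_leI abs_le_iff)
        then show ?thesis using True by (auto intro: add_increasing2)
      next
        case le: False
        then have "\<bar>x\<bar> \<le> \<bar>y\<bar>" by simp
        then have "ennreal (k (sqrt (x\<^sup>2 + y\<^sup>2))) \<le> h y x" using True *[of x y]
          by (auto simp: h_def ennreal_leI add.commute abs_le_iff)
        then show ?thesis using True by (auto intro: add_increasing)
      qed
    qed auto
  qed
  also have "\<dots> = (\<integral>\<^sup>+ z. case_prod h z + (case z of (x, y) \<Rightarrow> h y x) \<partial>plane)"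
    by (simp add: split_def)
  also have "\<dots> = (\<integral>\<^sup>+ (x, y). h x y \<partial>plane) + (\<integral>\<^sup>+ (x, y). h y x \<partial>plane)"
    by (rule nn_integral_add) measurable
  also have "\<dots> < top" unfolding H H' using fin by simp
  finally show ?thesis .
qed

text \<open>
  Near \<open>z\<close> the bound is the integral over a square, which does not depend on \<open>z\<close>; outside the square
  the kernel is at most \<open>k 1\<close>.
\<close>

lemma pair_kernel_potential_bound:
  assumes k: "pair_kernel k" and S: "S \<in> sets borel" "emeasure lborel S < top"
  obtains C :: real where "0 \<le> C" "\<And>z :: complex. (\<integral>\<^sup>+ w. ennreal (k (dist z w)) * indicator S w \<partial>lborel) \<le> ennreal C"
proof -
  note [measurable] = pair_kernel_measurable[OF k] S(1)
  define A where "A = (\<integral>\<^sup>+ (x, y). ennreal (k (sqrt (x\<^sup>2 + y\<^sup>2))) * indicator ({-1<..<1} \<times> {-1<..<1}) (x, y) \<partial>plane)"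
  have A: "A < top" unfolding A_def by (rule pair_kernel_square_finite[OF k])
  have on: "orthonormal 1 \<i>" by (simp add: orthonormal_def)
  have bd: "(\<integral>\<^sup>+ w. ennreal (k (dist z w)) * indicator S w \<partial>lborel) \<le> A + ennreal (k 1) * emeasure lborel S" for z
  proof -
    define Q where "Q = {w. Re w - Re z \<in> {-1<..<1} \<and> Im w - Im z \<in> {-1<..<1}}"
    have [measurable]: "Q \<in> sets borel"
    proof -
      have "Q = box (z - Complex 1 1) (z + Complex 1 1)" by (auto simp: Q_def in_box_complex_iff)
      then show ?thesis by simp
    qed
    have "(\<integral>\<^sup>+ w. ennreal (k (dist z w)) * indicator S w \<partial>lborel) \<le>
        (\<integral>\<^sup>+ w. ennreal (k (dist z w)) * indicator Q w + ennreal (k 1) * indicator S w \<partial>lborel)"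
    proof (rule nn_integral_mono)
      fix w
      have "k (dist z w) \<le> k 1" if "w \<notin> Q"
      proof (rule pair_kernel_antimono[OF k])
        have "1 \<le> \<bar>Re (w - z)\<bar> \<or> 1 \<le> \<bar>Im (w - z)\<bar>" using that by (auto simp: Q_def)
        then show "1 \<le> dist z w"
          using abs_Re_le_cmod[of "w - z"] abs_Im_le_cmod[of "w - z"] by (auto simp: dist_norm norm_minus_commute)
      qed auto
      then show "ennreal (k (dist z w)) * indicator S w \<le> ennreal (k (dist z w)) * indicator Q w + ennreal (k 1) * indicator S w"
        by (auto simp: indicator_def ennreal_leI)
    qed
    also have "\<dots> = (\<integral>\<^sup>+ w. ennreal (k (dist z w)) * indicator Q w \<partial>lborel) + ennreal (k 1) * emeasure lborel S"
      by (subst nn_integral_add) (auto simp: nn_integral_cmult)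
    also have "(\<integral>\<^sup>+ w. ennreal (k (dist z w)) * indicator Q w \<partial>lborel) =
        (\<integral>\<^sup>+ w. ennreal (k (dist z w)) * indicator Q w \<partial>distr plane borel (\<lambda>(x, y). frame z 1 \<i> x y))"
      unfolding plane_frame[OF on] ..
    also have "\<dots> = (\<integral>\<^sup>+ p. ennreal (k (dist z (case p of (x, y) \<Rightarrow> frame z 1 \<i> x y))) * indicator Q (case p of (x, y) \<Rightarrow> frame z 1 \<i> x y) \<partial>plane)"
      by (rule nn_integral_distr) measurable
    also have "\<dots> = A" unfolding A_def
    proof (rule nn_integral_cong, clarify)
      fix x y :: real
      have "dist z (frame z 1 \<i> x y) = sqrt (x\<^sup>2 + y\<^sup>2)"
        using dist_frame[OF on, of z 0 0 x y] by (simp add: frame_def)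
      moreover have "frame z 1 \<i> x y \<in> Q \<longleftrightarrow> (x, y) \<in> {-1<..<1} \<times> {-1<..<1}"
        by (auto simp: Q_def frame_def)
      ultimately show "ennreal (k (dist z (frame z 1 \<i> x y))) * indicator Q (frame z 1 \<i> x y) =
          ennreal (k (sqrt (x\<^sup>2 + y\<^sup>2))) * indicator ({-1<..<1} \<times> {-1<..<1}) (x, y)"
        by (auto simp: indicator_def)
    qed
    finally show ?thesis .
  qed
  have "A + ennreal (k 1) * emeasure lborel S < top"
    using A S(2) by (simp add: ennreal_mult_less_top)
  then obtain C where "0 \<le> C" "A + ennreal (k 1) * emeasure lborel S = ennreal C"
    by (metis less_top_ennreal)
  then show ?thesis using that bd by metis
qed

section \<open>The pull of one slice on another\<close>

text \<open>
  The potential, at horizontal position \<open>x\<close> and vertical distance \<open>d\<close>, of the horizontal segment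
  from \<open>\<alpha>\<close> to \<open>\<beta>\<close>.  The value at \<open>b\<close> minus the value at \<open>a\<close> is the pull of this segment on the
  segment from \<open>a\<close> to \<open>b\<close>.
\<close>

definition slab :: "(real \<Rightarrow> real) \<Rightarrow> real \<Rightarrow> real \<Rightarrow> real \<Rightarrow> real \<Rightarrow> real" where
  "slab k d \<alpha> \<beta> x = (LINT t:{\<alpha><..<\<beta>} | lborel. k (sqrt ((x - t)\<^sup>2 + d\<^sup>2)))"

text \<open>
  For \<open>d \<noteq> 0\<close> the integrand is a continuous even function, so it has an odd antiderivative.  All
  facts about pulls become identities and monotonicity properties of this function.
\<close>

lemma slab_antiderivative:
  assumes k: "pair_kernel k" and d: "d \<noteq> 0"
  obtains \<Phi> where
    "\<And>t. (\<Phi> has_real_derivative k (sqrt (t\<^sup>2 + d\<^sup>2))) (at t)"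
    "\<And>t. \<Phi> (- t) = - \<Phi> t"
    "\<And>\<alpha> \<beta> x. \<alpha> \<le> \<beta> \<Longrightarrow> slab k d \<alpha> \<beta> x = \<Phi> (x - \<alpha>) - \<Phi> (x - \<beta>)"
proof -
  define \<kappa> where "\<kappa> t = k (sqrt (t\<^sup>2 + d\<^sup>2))" for t
  have pos: "0 < t\<^sup>2 + d\<^sup>2" for t using d by (simp add: add_nonneg_pos)
  have cont: "continuous_on UNIV \<kappa>"
    unfolding \<kappa>_def
  proof (rule continuous_on_compose2[of "{0<..}" k])
    show "continuous_on {0<..} k" using k by (simp add: pair_kernel_def)
  qed (use pos in \<open>auto intro!: continuous_intros\<close>)
  then have iso: "isCont \<kappa> t" for t by (simp add: continuous_on_eq_continuous_at)
  obtain F where F: "\<And>t. (F has_vector_derivative \<kappa> t) (at t)"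
    using einterval_antiderivative[of "-\<infinity>" "\<infinity>" \<kappa>] iso by auto
  \<comment> \<open>the odd part of an arbitrary antiderivative\<close>
  define \<Phi> where "\<Phi> t = (F t - F (- t)) / 2" for t
  have F': "(F has_real_derivative \<kappa> t) (at t)" for t
    using F by (simp add: has_real_derivative_iff_has_vector_derivative)
  have ev: "\<kappa> (- t) = \<kappa> t" for t by (simp add: \<kappa>_def)
  have 1: "(\<Phi> has_real_derivative \<kappa> t) (at t)" for t
    unfolding \<Phi>_def
    by (rule derivative_eq_intros DERIV_chain2[OF F'] F' refl | simp add: ev)+
  have 2: "\<Phi> (- t) = - \<Phi> t" for t by (simp add: \<Phi>_def field_simps)
  have 3: "slab k d \<alpha> \<beta> x = \<Phi> (x - \<alpha>) - \<Phi> (x - \<beta>)" if "\<alpha> \<le> \<beta>" for \<alpha> \<beta> x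
  proof -
    have "slab k d \<alpha> \<beta> x = (LINT t:{\<alpha><..<\<beta>} | lborel. \<kappa> (x - t))"
      by (simp add: slab_def \<kappa>_def)
    also have "\<dots> = (LBINT t=\<alpha>..\<beta>. \<kappa> (x - t))"
      using that by (subst interval_integral_Ioo) auto
    also have "\<dots> = (- \<Phi> (x - \<beta>)) - (- \<Phi> (x - \<alpha>))"
    proof (rule interval_integral_FTC_finite)
      show "continuous_on {min \<alpha> \<beta>..max \<alpha> \<beta>} (\<lambda>t. \<kappa> (x - t))"
        by (rule continuous_on_compose2[OF cont]) (auto intro!: continuous_intros)
      fix t
      have "((\<lambda>t. - \<Phi> (x - t)) has_real_derivative \<kappa> (x - t)) (at t)"
        by (rule derivative_eq_intros DERIV_chain2[OF 1] refl | simp)+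
      then show "((\<lambda>t. - \<Phi> (x - t)) has_vector_derivative \<kappa> (x - t)) (at t within {min \<alpha> \<beta>..max \<alpha> \<beta>})"
        by (simp add: has_real_derivative_iff_has_vector_derivative has_vector_derivative_at_within)
    qed
    finally show ?thesis by simp
  qed
  show ?thesis using that 1 2 3 unfolding \<kappa>_def by blast
qed

text \<open>
  Action equals reaction: this is oddness of the antiderivative.
\<close>

lemma slab_difference_antisym:
  assumes "pair_kernel k" "d \<noteq> 0" "\<alpha> \<le> \<beta>" "a \<le> b"
  shows "slab k d \<alpha> \<beta> b - slab k d \<alpha> \<beta> a = - (slab k d a b \<beta> - slab k d a b \<alpha>)"
proof -
  obtain \<Phi> where \<Phi>: "\<And>t. \<Phi> (- t) = - \<Phi> t"
    "\<And>\<alpha> \<beta> x. \<alpha> \<le> \<beta> \<Longrightarrow> slab k d \<alpha> \<beta> x = \<Phi> (x - \<alpha>) - \<Phi> (x - \<beta>)"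
    using slab_antiderivative[OF assms(1,2)] by metis
  have swap: "\<Phi> (s - t) = - \<Phi> (t - s)" for s t using \<Phi>(1)[of "t - s"] by simp
  show ?thesis unfolding \<Phi>(2)[OF assms(3)] \<Phi>(2)[OF assms(4)]
    using swap[of \<beta> a] swap[of \<beta> b] swap[of \<alpha> a] swap[of \<alpha> b] by linarith
qed

text \<open>
  In terms of the distance \<open>D\<close> of the midpoints and of half the sum \<open>p\<close> and half the difference \<open>q\<close>
  of the two lengths, the pull is \<open>\<Delta> p - \<Delta> q\<close> with \<open>\<Delta> t = \<Phi> (t + D) - \<Phi> (t - D)\<close>.  The function
  \<open>\<Delta>\<close> is even, and decreasing for \<open>t \<ge> 0\<close> because the kernel is; moreover \<open>\<bar>q\<bar> < p\<close>.
\<close>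

lemma slab_difference_neg:
  assumes k: "pair_kernel k" "d \<noteq> 0" and ab: "\<alpha> < \<beta>" "a < b" and mid: "\<alpha> + \<beta> < a + b"
  shows "slab k d \<alpha> \<beta> b < slab k d \<alpha> \<beta> a"
proof -
  obtain \<Phi> where der: "\<And>t. (\<Phi> has_real_derivative k (sqrt (t\<^sup>2 + d\<^sup>2))) (at t)"
    and odd: "\<And>t. \<Phi> (- t) = - \<Phi> t"
    and slab: "\<And>\<alpha> \<beta> x. \<alpha> \<le> \<beta> \<Longrightarrow> slab k d \<alpha> \<beta> x = \<Phi> (x - \<alpha>) - \<Phi> (x - \<beta>)"
    using slab_antiderivative[OF k] by metis
  define D where "D = ((a + b) - (\<alpha> + \<beta>)) / 2"
  define p where "p = ((b - a) + (\<beta> - \<alpha>)) / 2"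
  define q where "q = ((b - a) - (\<beta> - \<alpha>)) / 2"
  define \<Delta> where "\<Delta> t = \<Phi> (t + D) - \<Phi> (t - D)" for t
  have "0 < D" using mid by (simp add: D_def)
  have even: "\<Delta> (- t) = \<Delta> t" for t
    using odd[of "t - D"] odd[of "t + D"] by (simp add: \<Delta>_def)
  have dec: "\<Delta> s < \<Delta> r" if "0 \<le> r" "r < s" for r s
  proof (rule DERIV_neg_imp_decreasing_open[OF \<open>r < s\<close>])
    have derD: "(\<Delta> has_real_derivative k (sqrt ((t + D)\<^sup>2 + d\<^sup>2)) - k (sqrt ((t - D)\<^sup>2 + d\<^sup>2))) (at t)" for t
      unfolding \<Delta>_def by (rule derivative_eq_intros DERIV_chain2[OF der] refl | simp)+
    then show "continuous_on {r..s} \<Delta>"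
      by (meson DERIV_isCont continuous_at_imp_continuous_on)
    fix t assume "r < t"
    then have "(t - D)\<^sup>2 < (t + D)\<^sup>2"
      using that \<open>0 < D\<close> by (simp add: power2_eq_square algebra_simps)
    moreover have "0 < (t - D)\<^sup>2 + d\<^sup>2" using k(2) by (simp add: add_nonneg_pos)
    ultimately have "k (sqrt ((t + D)\<^sup>2 + d\<^sup>2)) < k (sqrt ((t - D)\<^sup>2 + d\<^sup>2))"
      by (intro pair_kernel_strict[OF k(1)]) auto
    with derD show "\<exists>y. DERIV \<Delta> t :> y \<and> y < 0" by (intro exI conjI) auto
  qed
  have "\<Delta> p < \<Delta> \<bar>q\<bar>" by (rule dec) (use ab in \<open>auto simp: p_def q_def\<close>)
  moreover have "\<Delta> \<bar>q\<bar> = \<Delta> q" using even by (simp add: abs_if)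
  moreover have eqs: "b - \<alpha> = p + D" "b - \<beta> = q + D" "a - \<alpha> = - (q - D)" "a - \<beta> = - (p - D)"
    by (auto simp: p_def q_def D_def field_simps)
  have "slab k d \<alpha> \<beta> b - slab k d \<alpha> \<beta> a = \<Delta> p - \<Delta> q"
    using ab unfolding slab[OF less_imp_le[OF ab(1)]] eqs odd \<Delta>_def by simp
  ultimately show ?thesis by simp
qed

lemma slab_difference_pos:
  assumes k: "pair_kernel k" "d \<noteq> 0" and ab: "\<alpha> < \<beta>" "a < b" and mid: "a + b < \<alpha> + \<beta>"
  shows "slab k d \<alpha> \<beta> a < slab k d \<alpha> \<beta> b"
  using slab_difference_neg[OF k ab(2,1) mid] slab_difference_antisym[OF k, of \<alpha> \<beta> a b] ab by simp

lemma slab_nonneg: "pair_kernel k \<Longrightarrow> 0 \<le> slab k d \<alpha> \<beta> x"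
  unfolding slab_def set_lebesgue_integral_def
  by (intro Bochner_Integration.integral_nonneg) (simp add: pair_kernel_nonneg)

section \<open>Potentials of regions cut into slices\<close>

text \<open>
  Open at both ends of each slice and in the range of \<open>y\<close>, so that it is exactly the region inside the
  corresponding polygonal line.
\<close>

definition sliced :: "complex \<Rightarrow> complex \<Rightarrow> complex \<Rightarrow> real \<Rightarrow> real \<Rightarrow> (real \<Rightarrow> real) \<Rightarrow> (real \<Rightarrow> real) \<Rightarrow> complex set" where
  "sliced c e f y0 y1 a b = {frame c e f x y | x y. y0 < y \<and> y < y1 \<and> a y < x \<and> x < b y}"

lemma frame_in_sliced_iff:
  assumes "orthonormal e f"
  shows "frame c e f x y \<in> sliced c e f y0 y1 a b \<longleftrightarrow> y0 < y \<and> y < y1 \<and> a y < x \<and> x < b y"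
  unfolding sliced_def using frame_eq_iff[OF assms] by auto

lemma open_sliced:
  assumes on: "orthonormal e f" and cont: "continuous_on UNIV a" "continuous_on UNIV b"
  shows "open (sliced c e f y0 y1 a b)"
proof -
  let ?x = "\<lambda>w. Re (cnj e * (w - c))" and ?y = "\<lambda>w. Re (cnj f * (w - c))"
  have cx: "continuous_on UNIV ?x" "continuous_on UNIV ?y" by (intro continuous_intros)+
  have "sliced c e f y0 y1 a b = {w. y0 < ?y w \<and> ?y w < y1 \<and> a (?y w) < ?x w \<and> ?x w < b (?y w)}"
  proof (rule set_eqI)
    fix w
    show "w \<in> sliced c e f y0 y1 a b \<longleftrightarrow> w \<in> {w. y0 < ?y w \<and> ?y w < y1 \<and> a (?y w) < ?x w \<and> ?x w < b (?y w)}"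
      using frame_in_sliced_iff[OF on, of c "?x w" "?y w" y0 y1 a b]
      unfolding frame_coordinates[OF on] by simp
  qed
  moreover have "open \<dots>"
    by (intro open_Collect_conj open_Collect_less continuous_on_const cx
        continuous_on_compose2[OF cont(1) cx(2)] continuous_on_compose2[OF cont(2) cx(2)]) auto
  ultimately show ?thesis by simp
qed

lemma bounded_sliced:
  assumes on: "orthonormal e f" and cont: "continuous_on UNIV a" "continuous_on UNIV b"
  shows "bounded (sliced c e f y0 y1 a b)"
proof -
  have "bounded (a ` {y0..y1})" "bounded (b ` {y0..y1})"
    by (intro compact_imp_bounded compact_continuous_image continuous_on_subset[OF cont(1)]
        continuous_on_subset[OF cont(2)] compact_Icc subset_UNIV)+
  then obtain A B where AB: "\<And>y. y \<in> {y0..y1} \<Longrightarrow> \<bar>a y\<bar> \<le> A" "\<And>y. y \<in> {y0..y1} \<Longrightarrow> \<bar>b y\<bar> \<le> B"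
    unfolding bounded_iff by (metis imageI real_norm_def)
  have ef: "cmod e = 1" "cmod f = 1" using on by (auto simp: orthonormal_def norm_mult)
  show ?thesis unfolding bounded_iff
  proof (intro exI ballI)
    fix w assume "w \<in> sliced c e f y0 y1 a b"
    then obtain x y where w: "w = frame c e f x y" "y0 < y" "y < y1" "a y < x" "x < b y"
      by (auto simp: sliced_def)
    have "\<bar>x\<bar> \<le> A + B" using AB[of y] w by (auto simp: abs_le_iff)
    moreover have "\<bar>y\<bar> \<le> \<bar>y0\<bar> + \<bar>y1\<bar>" using w by auto
    moreover have "cmod w \<le> cmod c + \<bar>x\<bar> + \<bar>y\<bar>"
      unfolding w(1) frame_def using ef
      by (intro order_trans[OF norm_triangle_ineq] add_mono) (auto simp: norm_mult intro: order_trans[OF norm_triangle_ineq])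
    ultimately show "cmod w \<le> cmod c + (A + B) + (\<bar>y0\<bar> + \<bar>y1\<bar>)" by linarith
  qed
qed

definition pot :: "(real \<Rightarrow> real) \<Rightarrow> complex set \<Rightarrow> complex \<Rightarrow> real" where
  "pot k S z = (LINT w : S | lborel. k (dist z w))"

lemma pot_nonneg: "pair_kernel k \<Longrightarrow> 0 \<le> pot k S z"
  unfolding pot_def set_lebesgue_integral_def
  by (intro Bochner_Integration.integral_nonneg) (simp add: pair_kernel_nonneg)

lemma pot_measurable:
  assumes k: "pair_kernel k" and [measurable]: "S \<in> sets borel"
  shows "pot k S \<in> borel_measurable borel"
proof -
  note [measurable] = pair_kernel_measurable[OF k]
  show ?thesis unfolding pot_def[abs_def] set_lebesgue_integral_def
    by (rule lborel.borel_measurable_lebesgue_integral) measurable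
qed

lemma pot_bounded:
  assumes k: "pair_kernel k" and S: "S \<in> sets borel" "bounded S"
  obtains C where "0 \<le> C" "\<And>z. pot k S z \<le> C"
    "\<And>z. integrable lborel (\<lambda>w. indicator S w * k (dist z w))"
proof -
  note [measurable] = pair_kernel_measurable[OF k] S(1)
  have "emeasure lborel S < top" using S(2) using emeasure_bounded_finite by (simp add: less_top)
  from pair_kernel_potential_bound[OF k S(1) this] obtain C
    where C: "0 \<le> C" "\<And>z. (\<integral>\<^sup>+ w. ennreal (k (dist z w)) * indicator S w \<partial>lborel) \<le> ennreal C" by metis
  have nn: "(\<integral>\<^sup>+ w. ennreal (indicator S w * k (dist z w)) \<partial>lborel) \<le> ennreal C" for z
  proof -
    have "(\<integral>\<^sup>+ w. ennreal (indicator S w * k (dist z w)) \<partial>lborel) =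
        (\<integral>\<^sup>+ w. ennreal (k (dist z w)) * indicator S w \<partial>lborel)"
      by (intro nn_integral_cong) (auto simp: indicator_def)
    then show ?thesis using C(2) by simp
  qed
  have int: "integrable lborel (\<lambda>w. indicator S w * k (dist z w))" for z
  proof (rule integrableI_nonneg)
    show "(\<integral>\<^sup>+ w. ennreal (indicator S w * k (dist z w)) \<partial>lborel) < \<infinity>"
      using nn[of z] by (simp add: le_less_trans)
  qed (auto simp: pair_kernel_nonneg[OF k])
  have "pot k S z \<le> C" for z
  proof -
    have "ennreal (pot k S z) = (\<integral>\<^sup>+ w. ennreal (indicator S w * k (dist z w)) \<partial>lborel)"
      unfolding pot_def set_lebesgue_integral_def using int[of z]
      by (subst nn_integral_eq_integral) (auto simp: pair_kernel_nonneg[OF k])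
    then have "ennreal (pot k S z) \<le> ennreal C" using nn[of z] by simp
    then show ?thesis using C(1) by (simp only: ennreal_le_iff)
  qed
  then show ?thesis using that C(1) int by blast
qed

lemma slab_measurable:
  assumes k: "pair_kernel k" and [measurable]: "a \<in> borel_measurable borel" "b \<in> borel_measurable borel"
    "u \<in> borel_measurable M" "d \<in> borel_measurable M" "y \<in> borel_measurable M"
  shows "(\<lambda>p. slab k (d p) (a (y p)) (b (y p)) (u p)) \<in> borel_measurable M"
proof -
  note [measurable] = pair_kernel_measurable[OF k]
  have eq: "slab k (d p) (a (y p)) (b (y p)) (u p) =
      (LINT t | lborel. (if a (y p) < t \<and> t < b (y p) then k (sqrt ((u p - t)\<^sup>2 + (d p)\<^sup>2)) else 0))" for p
    unfolding slab_def set_lebesgue_integral_def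
    by (intro Bochner_Integration.integral_cong) (auto simp: indicator_def)
  show ?thesis unfolding eq
    by (rule lborel.borel_measurable_lebesgue_integral) measurable
qed

text \<open>
  Fubini's theorem in the coordinates of the frame.
\<close>

lemma pot_sliced:
  assumes k: "pair_kernel k" and on: "orthonormal e f"
    and cont: "continuous_on UNIV a" "continuous_on UNIV b"
  shows "pot k (sliced c e f y0 y1 a b) (frame c e f x y) =
      (LINT y' : {y0<..<y1} | lborel. slab k (y - y') (a y') (b y') x)"
    and "set_integrable lborel {y0<..<y1} (\<lambda>y'. slab k (y - y') (a y') (b y') x)"
proof -
  note [measurable] = pair_kernel_measurable[OF k]
    borel_measurable_continuous_onI[OF cont(1)] borel_measurable_continuous_onI[OF cont(2)]
  \<comment> \<open>exchanging the axes makes \<open>y\<close> the outer variable of integration\<close>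
  have fe: "orthonormal f e" using on by (auto simp: orthonormal_def norm_mult)
  let ?S = "sliced c e f y0 y1 a b"
  let ?T = "\<lambda>(y', x'). frame c f e y' x'"
  have fr: "frame c f e y' x' = frame c e f x' y'" for x' y' by (simp add: frame_def)
  have [measurable]: "?S \<in> sets borel" using open_sliced[OF on cont] by simp
  define H where "H w = indicator ?S w * k (dist (frame c e f x y) w)" for w
  have [measurable]: "H \<in> borel_measurable borel" unfolding H_def by measurable
  have int: "integrable lborel H"
    using pot_bounded[OF k \<open>?S \<in> sets borel\<close> bounded_sliced[OF on cont]] unfolding H_def by metis
  then have "integrable (distr plane borel ?T) H" unfolding plane_frame[OF fe] .
  then have int': "integrable plane (\<lambda>p. H (?T p))"
    by (subst (asm) integrable_distr_eq) auto
  have HT: "(LINT x' | lborel. H (?T (y', x'))) = indicator {y0<..<y1} y' *\<^sub>R slab k (y - y') (a y') (b y') x" for y'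
  proof -
    have "H (?T (y', x')) = indicator {y0<..<y1} y' * (indicator {a y'<..<b y'} x' *\<^sub>R k (sqrt ((x - x')\<^sup>2 + (y - y')\<^sup>2)))" for x'
      unfolding H_def by (auto simp: fr dist_frame[OF on] frame_in_sliced_iff[OF on] indicator_def)
    then show ?thesis by (simp add: slab_def set_lebesgue_integral_def)
  qed
  have "pot k ?S (frame c e f x y) = (LINT w | lborel. H w)"
    by (simp add: pot_def set_lebesgue_integral_def H_def)
  also have "\<dots> = (LINT w | distr plane borel ?T. H w)" unfolding plane_frame[OF fe] ..
  also have "\<dots> = (LINT p | plane. H (?T p))" by (rule integral_distr) measurable
  also have "\<dots> = (LINT y' | lborel. LINT x' | lborel. H (?T (y', x')))"
    by (rule lborel_pair.integral_fst'[OF int', symmetric])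
  finally show "pot k ?S (frame c e f x y) = (LINT y' : {y0<..<y1} | lborel. slab k (y - y') (a y') (b y') x)"
    unfolding HT by (simp add: set_lebesgue_integral_def)
  show "set_integrable lborel {y0<..<y1} (\<lambda>y'. slab k (y - y') (a y') (b y') x)"
    using lborel_pair.integrable_fst'[OF int'] unfolding HT set_integrable_def .
qed

section \<open>The symmetrization inequality\<close>

lemma set_integral_interval_pos:
  fixes f :: "real \<Rightarrow> real"
  assumes int: "set_integrable lborel {l<..<u} f" and "l < u"
    and nonneg: "\<And>x. l < x \<Longrightarrow> x < u \<Longrightarrow> 0 \<le> f x"
    and pos: "\<And>x. l < x \<Longrightarrow> x < u \<Longrightarrow> x \<noteq> m \<Longrightarrow> 0 < f x"
  shows "0 < (LINT x : {l<..<u} | lborel. f x)"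
proof (rule ccontr)
  let ?g = "\<lambda>x. indicator {l<..<u} x *\<^sub>R f x"
  have nn: "0 \<le> ?g x" for x using nonneg[of x] by (auto simp: indicator_def)
  assume "\<not> ?thesis"
  then have "(LINT x | lborel. ?g x) = 0"
    using Bochner_Integration.integral_nonneg[of lborel ?g] nn
    by (metis less_le set_lebesgue_integral_def)
  then have "AE x in lborel. ?g x = 0"
    using int nn by (subst (asm) integral_nonneg_eq_0_iff_AE) (auto simp: set_integrable_def)
  then have "AE x in lebesgue. ?g x = 0" by (rule AE_completion)
  then have "AE x \<in> {l<..<u} in lebesgue. x \<in> {m}"
  proof eventually_elim
    case (elim x) then show ?case using pos[of x] by (auto simp: indicator_def)
  qed
  note sub = mem_closed_if_AE_lebesgue_open[OF open_greaterThanLessThan closed_singleton this]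
  show False using sub[of "(l + u) / 2"] sub[of "(2 * l + u) / 3"] \<open>l < u\<close> by (simp add: field_simps)
qed

text \<open>
  The points \<open>- x\<close> and \<open>x\<close> are the ends of a segment with midpoint \<open>0\<close>, and every slice pulls it towards
  a positive midpoint.
\<close>

lemma potential_increases_along_base:
  assumes k: "pair_kernel k" and on: "orthonormal e f"
    and cont: "continuous_on UNIV a" "continuous_on UNIV b"
    and y: "y \<le> y0" "y0 < y1" and x: "0 < x"
    and ab: "\<And>t. y0 < t \<Longrightarrow> t < y1 \<Longrightarrow> a t < b t"
    and mid: "\<And>t. y0 < t \<Longrightarrow> t < y1 \<Longrightarrow> 0 < a t + b t"
  shows "pot k (sliced c e f y0 y1 a b) (frame c e f (- x) y) < pot k (sliced c e f y0 y1 a b) (frame c e f x y)"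
proof -
  note ps = pot_sliced(1)[OF k on cont, where y = y and ?y0.0 = y0 and ?y1.0 = y1 and c = c]
    pot_sliced(2)[OF k on cont, where y = y and ?y0.0 = y0 and ?y1.0 = y1]
  have "0 < (LINT t : {y0<..<y1} | lborel. slab k (y - t) (a t) (b t) x - slab k (y - t) (a t) (b t) (- x))"
  proof (rule set_integral_interval_pos[where m = y0])
    show "set_integrable lborel {y0<..<y1} (\<lambda>t. slab k (y - t) (a t) (b t) x - slab k (y - t) (a t) (b t) (- x))"
      by (intro set_integral_diff ps(2))
    fix t assume t: "y0 < t" "t < y1"
    then show "0 < slab k (y - t) (a t) (b t) x - slab k (y - t) (a t) (b t) (- x)"
      using slab_difference_pos[OF k, of "y - t" "a t" "b t" "- x" x] ab[OF t] mid[OF t] x y by simp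
    then show "0 \<le> slab k (y - t) (a t) (b t) x - slab k (y - t) (a t) (b t) (- x)" by simp
  qed (use y in auto)
  also have "\<dots> = pot k (sliced c e f y0 y1 a b) (frame c e f x y) - pot k (sliced c e f y0 y1 a b) (frame c e f (- x) y)"
    unfolding ps(1) by (intro set_integral_diff ps(2))
  finally show ?thesis by simp
qed

text \<open>
  With \<open>E y t\<close> the pull of the slice at \<open>t\<close> on the slice at \<open>y\<close>, the integral is that of
  \<open>G (y, t) = M y * E y t\<close>, where \<open>M = a + b\<close> is twice the midpoint.  As \<open>E\<close> is antisymmetric, adding
  the integral with \<open>y\<close> and \<open>t\<close> exchanged yields the integrand \<open>(M y - M t) * E y t\<close>, which is negative
  wherever \<open>M y \<noteq> M t\<close> since slices attract.  Were the integral nonnegative, \<open>M\<close> would be constant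
  almost everywhere, hence constant by continuity.
\<close>

lemma midpoint_force_negative:
  fixes c :: complex
  assumes k: "pair_kernel k" and on: "orthonormal e f"
    and cont: "continuous_on UNIV a" "continuous_on UNIV b"
    and ab: "\<And>t. y0 < t \<Longrightarrow> t < y1 \<Longrightarrow> a t < b t"
    and nonconst: "\<exists>s\<in>{y0<..<y1}. \<exists>t\<in>{y0<..<y1}. a s + b s \<noteq> a t + b t"
  defines "V \<equiv> pot k (sliced c e f y0 y1 a b)"
  shows "(LINT y : {y0<..<y1} | lborel. (a y + b y) * (V (frame c e f (b y) y) - V (frame c e f (a y) y))) < 0"
proof -
  note [measurable] = borel_measurable_continuous_onI[OF cont(1)] borel_measurable_continuous_onI[OF cont(2)]
  define M where "M y = a y + b y" for y
  have Mcont: "continuous_on UNIV M" unfolding M_def by (intro continuous_intros cont)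
  note [measurable] = borel_measurable_continuous_onI[OF Mcont]
  define Y where "Y = {y0<..<y1}"
  have [measurable]: "Y \<in> sets borel" by (simp add: Y_def)
  define J where "J x y t = slab k (y - t) (a t) (b t) x" for x y t
  have Vint: "V (frame c e f x y) = (LINT t | lborel. indicator Y t *\<^sub>R J x y t)"
    and Jint: "integrable lborel (\<lambda>t. indicator Y t *\<^sub>R J x y t)" for x y
    using pot_sliced(1)[OF k on cont, where y = y and x = x and ?y0.0 = y0 and ?y1.0 = y1 and c = c]
      pot_sliced(2)[OF k on cont, where y = y and x = x and ?y0.0 = y0 and ?y1.0 = y1]
    by (auto simp: V_def J_def Y_def set_lebesgue_integral_def set_integrable_def)
  obtain C where C: "0 \<le> C" "\<And>z. V z \<le> C"
    using pot_bounded[OF k borel_open[OF open_sliced[OF on cont]] bounded_sliced[OF on cont]]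
    unfolding V_def by metis
  have "bounded (M ` {y0..y1})"
    by (intro compact_imp_bounded compact_continuous_image continuous_on_subset[OF Mcont]) auto
  then obtain B where B: "\<And>y. y \<in> {y0..y1} \<Longrightarrow> \<bar>M y\<bar> \<le> B"
    unfolding bounded_iff by (metis imageI real_norm_def)
  have J0: "0 \<le> J x y t" for x y t by (simp add: J_def slab_nonneg[OF k])
  define E where "E y t = J (b y) y t - J (a y) y t" for y t
  have Jm: "(\<lambda>p. J (b (fst p)) (fst p) (snd p)) \<in> borel_measurable plane"
    "(\<lambda>p. J (a (fst p)) (fst p) (snd p)) \<in> borel_measurable plane"
    unfolding J_def by (rule slab_measurable[OF k]; measurable)+
  have Em: "(\<lambda>p. E (fst p) (snd p)) \<in> borel_measurable plane"
    unfolding E_def by (intro borel_measurable_diff Jm)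
  define G where "G p = indicator Y (fst p) * (indicator Y (snd p) * (M (fst p) * E (fst p) (snd p)))" for p
  have Gm [measurable]: "G \<in> borel_measurable plane"
    unfolding G_def using Em by measurable
  have Geq: "G (y, t) = (indicator Y y * M y) * (indicator Y t *\<^sub>R J (b y) y t - indicator Y t *\<^sub>R J (a y) y t)" for y t
    by (simp add: G_def E_def algebra_simps)
  have Gint1: "integrable lborel (\<lambda>t. G (y, t))" for y unfolding Geq using Jint by simp
  have Gval: "(LINT t | lborel. G (y, t)) =
      indicator Y y *\<^sub>R (M y * (V (frame c e f (b y) y) - V (frame c e f (a y) y)))" for y
  proof -
    have "(LINT t | lborel. G (y, t)) = (indicator Y y * M y) *
        ((LINT t | lborel. indicator Y t *\<^sub>R J (b y) y t) - (LINT t | lborel. indicator Y t *\<^sub>R J (a y) y t))"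
      unfolding Geq using Jint by (simp only: integral_mult_right_zero Bochner_Integration.integral_diff)
    then show ?thesis unfolding Vint by simp
  qed
  have "integrable plane G"
  proof (rule lborel_pair.Fubini_integrable[OF Gm])
    show "integrable lborel (\<lambda>y. LINT t | lborel. norm (G (y, t)))"
    proof (rule Bochner_Integration.integrable_bound)
      show "integrable lborel (\<lambda>y. indicator Y y * (B * (2 * C)))"
        using emeasure_bounded_finite[of Y]
        by (intro integrable_mult_left integrable_real_indicator) (auto simp: Y_def)
      show "(\<lambda>y. LINT t | lborel. norm (G (y, t))) \<in> borel_measurable lborel"
        by (rule lborel.borel_measurable_lebesgue_integral) measurable
      show "AE y in lborel. norm (LINT t | lborel. norm (G (y, t))) \<le> norm (indicator Y y * (B * (2 * C)))"
      proof (rule AE_I2)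
        fix y
        show "norm (LINT t | lborel. norm (G (y, t))) \<le> norm (indicator Y y * (B * (2 * C)))"
        proof (cases "y \<in> Y")
          case True
          then have By: "\<bar>M y\<bar> \<le> B" using B[of y] by (simp add: Y_def)
          have "(LINT t | lborel. norm (G (y, t))) \<le>
              (LINT t | lborel. B * (indicator Y t *\<^sub>R J (b y) y t + indicator Y t *\<^sub>R J (a y) y t))"
          proof (rule integral_mono)
            show "integrable lborel (\<lambda>t. norm (G (y, t)))" by (rule integrable_norm[OF Gint1])
            show "integrable lborel (\<lambda>t. B * (indicator Y t *\<^sub>R J (b y) y t + indicator Y t *\<^sub>R J (a y) y t))"
              by (intro integrable_mult_right Bochner_Integration.integrable_add Jint)
            fix t
            have "\<bar>E y t\<bar> \<le> J (b y) y t + J (a y) y t" using J0[of "b y" y t] J0[of "a y" y t] by (auto simp: E_def)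
            then have "\<bar>M y\<bar> * \<bar>E y t\<bar> \<le> B * (J (b y) y t + J (a y) y t)"
              using By by (intro mult_mono) auto
            then show "norm (G (y, t)) \<le> B * (indicator Y t *\<^sub>R J (b y) y t + indicator Y t *\<^sub>R J (a y) y t)"
              using True by (auto simp: G_def abs_mult indicator_def)
          qed
          also have "\<dots> = B * (V (frame c e f (b y) y) + V (frame c e f (a y) y))"
            using Jint by (simp add: Vint)
          also have "\<dots> \<le> B * (2 * C)"
            using C(2)[of "frame c e f (b y) y"] C(2)[of "frame c e f (a y) y"] By
            by (intro mult_left_mono) auto
          finally have "(LINT t | lborel. norm (G (y, t))) \<le> B * (2 * C)" .
          moreover have "0 \<le> (LINT t | lborel. norm (G (y, t)))" by simp
          ultimately show ?thesis using True by simp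
        qed (simp add: G_def)
      qed
    qed
    show "AE y in lborel. integrable lborel (\<lambda>t. G (y, t))" using Gint1 by simp
  qed
  note Gint = this
  have I: "(LINT y : {y0<..<y1} | lborel. (a y + b y) * (V (frame c e f (b y) y) - V (frame c e f (a y) y))) = integral\<^sup>L plane G"
    unfolding lborel_pair.integral_fst'[OF Gint, symmetric] Gval
    by (simp add: set_lebesgue_integral_def Y_def M_def)
  define G' where "G' = (\<lambda>(x, y). G (y, x))"
  have G'int: "integrable plane G'" unfolding G'_def by (rule lborel_pair.integrable_product_swap[OF Gint])
  have G'I: "integral\<^sup>L plane G' = integral\<^sup>L plane G" unfolding G'_def by (rule lborel_pair.integral_product_swap[OF Gm])
  define Q where "Q p = - (G p + G' p)" for p
  have Qint: "integrable plane Q" unfolding Q_def using Gint G'int by simp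
  have QI: "integral\<^sup>L plane Q = - 2 * integral\<^sup>L plane G"
    unfolding Q_def using Gint G'int G'I by simp
  have Qval: "Q (y, t) = (M t - M y) * E y t" if "y \<in> Y" "t \<in> Y" "y \<noteq> t" for y t
  proof -
    have d: "slab k (t - y) = slab k (y - t)"
      by (auto simp: slab_def fun_eq_iff power2_commute)
    have "a y < b y" "a t < b t" using ab that by (auto simp: Y_def)
    then have "E y t = - E t y"
      using slab_difference_antisym[OF k, of "y - t" "a t" "b t" "a y" "b y"] that
      by (simp add: E_def J_def d)
    then show ?thesis using that by (simp add: Q_def G'_def G_def algebra_simps)
  qed
  have Qpos: "0 < Q (y, t)" if "y \<in> Y" "t \<in> Y" "y \<noteq> t" "M y \<noteq> M t" for y t
  proof -
    have yt: "a y < b y" "a t < b t" "y - t \<noteq> 0" using ab that by (auto simp: Y_def)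
    show ?thesis
    proof (cases "M t < M y")
      case True
      then have "E y t < 0" using slab_difference_neg[OF k yt(3,2,1)] by (simp add: E_def J_def M_def)
      then show ?thesis using True by (simp add: Qval[OF that(1-3)] mult_neg_neg)
    next
      case False
      then have lt: "M y < M t" using that by simp
      then have "0 < E y t" using slab_difference_pos[OF k yt(3,2,1)] by (simp add: E_def J_def M_def)
      then show ?thesis using lt by (simp add: Qval[OF that(1-3)])
    qed
  qed
  \<comment> \<open>on the diagonal the kernel may be singular, and the pull is not controlled\<close>
  have off: "AE p in plane. fst p \<noteq> snd p"
  proof (rule lborel_pair.AE_pair_measure)
    show "AE y in lborel. AE t in lborel. fst (y, t) \<noteq> snd (y, t :: real)"
    proof (rule AE_I2)
      fix y :: real
      show "AE t in lborel. fst (y, t) \<noteq> snd (y, t)"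
        using AE_lborel_singleton[of y] by eventually_elim auto
    qed
  qed measurable
  have Qnn: "AE p in plane. 0 \<le> Q p"
    using off
  proof eventually_elim
    case (elim p)
    obtain y t where p: "p = (y, t)" by force
    show ?case
    proof (cases "y \<in> Y \<and> t \<in> Y")
      case True
      then show ?thesis using elim Qpos[of y t] Qval[of y t] p by (cases "M y = M t") auto
    next
      case False
      then show ?thesis unfolding p by (auto simp: Q_def G'_def G_def)
    qed
  qed
  show ?thesis
  proof (rule ccontr)
    assume "\<not> ?thesis"
    then have "integral\<^sup>L plane Q \<le> 0" unfolding I QI by simp
    moreover have "0 \<le> integral\<^sup>L plane Q" by (rule integral_nonneg_AE[OF Qnn])
    ultimately have "AE p in plane. Q p = 0"
      using integral_nonneg_eq_0_iff_AE[OF Qint Qnn] by simp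
    with off have "AE p in plane. fst p \<in> Y \<longrightarrow> snd p \<in> Y \<longrightarrow> M (fst p) = M (snd p)"
    proof eventually_elim
      case (elim p)
      obtain y t where p: "p = (y, t)" by force
      show ?case using elim Qpos[of y t] unfolding p by fastforce
    qed
    from lborel_pair.AE_pair[OF this]
    have ae: "AE y in lborel. AE t in lborel. y \<in> Y \<longrightarrow> t \<in> Y \<longrightarrow> M y = M t" by simp
    have oY: "open Y" by (simp add: Y_def)
    have level: "closed {t. M t = c}" for c
      by (intro closed_Collect_eq Mcont continuous_on_const)
    have "AE y in lborel. y \<in> Y \<longrightarrow> (\<forall>t\<in>Y. M t = M y)"
      using ae
    proof eventually_elim
      case (elim y)
      show ?case
      proof (intro impI ballI)
        fix t assume "y \<in> Y" "t \<in> Y"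
        have "AE t \<in> Y in lebesgue. t \<in> {t. M t = M y}"
          using elim \<open>y \<in> Y\<close> by (intro AE_completion) (auto elim!: eventually_mono)
        from mem_closed_if_AE_lebesgue_open[OF oY level this \<open>t \<in> Y\<close>] show "M t = M y" by simp
      qed
    qed
    then have "AE y in lborel. y \<in> Y \<longrightarrow> y \<in> {}"
    proof eventually_elim
      case (elim y)
      then show ?case using nonconst unfolding Y_def M_def by fastforce
    qed
    then have "AE y \<in> Y in lebesgue. y \<in> {}" by (rule AE_completion)
    then have "y \<notin> Y" for y
      using mem_closed_if_AE_lebesgue_open[OF oY closed_empty] by blast
    then show False using nonconst by (auto simp: Y_def)
  qed
qed

section \<open>Regions enclosed by triangles and quadrilaterals\<close>

lemma connected_disjoint_frontier_subset:
  assumes "connected T" "z \<in> T" "z \<in> S" "T \<inter> frontier S = {}"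
  shows "T \<subseteq> S"
  using connected_Int_frontier[of T S] assms by blast

text \<open>
  The closed slices form a set that is star-shaped about the origin of the frame; this is what the two
  conditions on \<open>a\<close> and \<open>b\<close> express.  A point outside this set escapes to infinity along its ray from
  the origin without meeting \<open>\<gamma>\<close>.  A point of the open set cannot escape: \<open>\<gamma>\<close> contains the frontier,
  so a connected set that avoids \<open>\<gamma>\<close> stays within the bounded open set.
\<close>

lemma inside_sliced:
  assumes on: "orthonormal e f" and cont: "continuous_on UNIV a" "continuous_on UNIV b"
    and y: "y0 \<le> 0" "0 \<le> y1"
    and star_a: "\<And>t y. 0 \<le> t \<Longrightarrow> t \<le> 1 \<Longrightarrow> y0 \<le> y \<Longrightarrow> y \<le> y1 \<Longrightarrow> a (t * y) \<le> t * a y"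
    and star_b: "\<And>t y. 0 \<le> t \<Longrightarrow> t \<le> 1 \<Longrightarrow> y0 \<le> y \<Longrightarrow> y \<le> y1 \<Longrightarrow> t * b y \<le> b (t * y)"
    and \<gamma>: "\<gamma> = {frame c e f x y | x y. y0 \<le> y \<and> y \<le> y1 \<and> a y \<le> x \<and> x \<le> b y \<and>
        (y = y0 \<or> y = y1 \<or> x = a y \<or> x = b y)}"
  shows "inside \<gamma> = sliced c e f y0 y1 a b"
proof -
  let ?F = "frame c e f" and ?S = "sliced c e f y0 y1 a b"
  let ?x = "\<lambda>w. Re (cnj e * (w - c))" and ?y = "\<lambda>w. Re (cnj f * (w - c))"
  define C where "C = {?F x y | x y. y0 \<le> y \<and> y \<le> y1 \<and> a y \<le> x \<and> x \<le> b y}"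
  have Ciff: "?F x y \<in> C \<longleftrightarrow> y0 \<le> y \<and> y \<le> y1 \<and> a y \<le> x \<and> x \<le> b y" for x y
    unfolding C_def using frame_eq_iff[OF on] by auto
  have \<gamma>iff: "?F x y \<in> \<gamma> \<longleftrightarrow> y0 \<le> y \<and> y \<le> y1 \<and> a y \<le> x \<and> x \<le> b y \<and> (y = y0 \<or> y = y1 \<or> x = a y \<or> x = b y)" for x y
    unfolding \<gamma> using frame_eq_iff[OF on] by auto
  have ex: "\<exists>x y. w = ?F x y" for w using frame_coordinates[OF on, of c w] by metis
  have part: "w \<in> C \<longleftrightarrow> w \<in> \<gamma> \<or> w \<in> ?S" for w
  proof -
    obtain x y where w: "w = ?F x y" using ex by blast
    show ?thesis unfolding w Ciff \<gamma>iff frame_in_sliced_iff[OF on] by auto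
  qed
  have disj: "w \<notin> \<gamma>" if "w \<in> ?S" for w
  proof -
    obtain x y where w: "w = ?F x y" using ex by blast
    show ?thesis using that unfolding w \<gamma>iff frame_in_sliced_iff[OF on] by auto
  qed
  have cx: "continuous_on UNIV ?x" "continuous_on UNIV ?y" by (intro continuous_intros)+
  have "closed C"
  proof -
    have "C = {w. y0 \<le> ?y w \<and> ?y w \<le> y1 \<and> a (?y w) \<le> ?x w \<and> ?x w \<le> b (?y w)}"
    proof (rule set_eqI)
      fix w
      show "w \<in> C \<longleftrightarrow> w \<in> {w. y0 \<le> ?y w \<and> ?y w \<le> y1 \<and> a (?y w) \<le> ?x w \<and> ?x w \<le> b (?y w)}"
        using Ciff[of "?x w" "?y w"] unfolding frame_coordinates[OF on] by simp
    qed
    moreover have "closed \<dots>"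
      by (intro closed_Collect_conj closed_Collect_le continuous_on_const cx
          continuous_on_compose2[OF cont(1) cx(2)] continuous_on_compose2[OF cont(2) cx(2)]) auto
    ultimately show ?thesis by simp
  qed
  have opS: "open ?S" by (rule open_sliced[OF on cont])
  have bdS: "bounded ?S" by (rule bounded_sliced[OF on cont])
  have "closure ?S \<subseteq> C" using part by (intro closure_minimal \<open>closed C\<close>) blast
  then have fr: "frontier ?S \<subseteq> \<gamma>" unfolding frontier_def interior_open[OF opS] using part by blast
  show ?thesis
  proof (rule set_eqI)
    fix w
    show "w \<in> inside \<gamma> \<longleftrightarrow> w \<in> ?S"
    proof
      assume w: "w \<in> ?S"
      have "connected_component_set (- \<gamma>) w \<subseteq> ?S"
      proof (rule connected_disjoint_frontier_subset)
        show "w \<in> connected_component_set (- \<gamma>) w" using disj[OF w] by (simp add: connected_component_refl_eq)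
        show "connected_component_set (- \<gamma>) w \<inter> frontier ?S = {}"
          using fr connected_component_subset[of "- \<gamma>" w] by blast
      qed (use w in auto)
      then have "bounded (connected_component_set (- \<gamma>) w)" using bdS bounded_subset by blast
      then show "w \<in> inside \<gamma>" using disj[OF w] by (simp add: inside_def)
    next
      assume ins: "w \<in> inside \<gamma>"
      then have w\<gamma>: "w \<notin> \<gamma>" and bd: "bounded (connected_component_set (- \<gamma>) w)" by (auto simp: inside_def)
      show "w \<in> ?S"
      proof (rule ccontr)
        assume "w \<notin> ?S"
        then have "w \<notin> C" using part w\<gamma> by blast
        obtain x y where w: "w = ?F x y" using ex by blast
        let ?R = "(\<lambda>t. ?F (t * x) (t * y)) ` {1..}"
        have Rconn: "connected ?R"
          unfolding frame_def by (intro connected_continuous_image continuous_intros connected_Ici)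
        have "w \<in> ?R" using w by (auto intro!: image_eqI[of _ _ 1])
        have "?R \<inter> C = {}"
        proof (clarsimp simp: disjoint_iff Ciff)
          fix t :: real assume t: "1 \<le> t" "y0 \<le> t * y" "t * y \<le> y1" "a (t * y) \<le> t * x" "t * x \<le> b (t * y)"
          have i: "0 \<le> 1 / t" "1 / t \<le> 1" "1 / t * (t * y) = y" "1 / t * (t * x) = x" using t by auto
          have "a y \<le> 1 / t * a (t * y)" using star_a[OF i(1,2) t(2,3)] unfolding i(3) .
          also have "\<dots> \<le> 1 / t * (t * x)" using t i by (intro mult_left_mono) auto
          finally have 1: "a y \<le> x" using i by simp
          have "1 / t * (t * x) \<le> 1 / t * b (t * y)" using t i by (intro mult_left_mono) auto
          also have "\<dots> \<le> b y" using star_b[OF i(1,2) t(2,3)] unfolding i(3) .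
          finally have 2: "x \<le> b y" using i by simp
          have "y0 \<le> y" using t y by (cases "0 \<le> y") (auto intro: order_trans[OF t(2)] simp: mult_le_cancel_right1)
          moreover have "y \<le> y1" using t y by (cases "0 \<le> y") (auto intro: order_trans[OF _ t(3)] simp: mult_le_cancel_right1)
          ultimately show False using \<open>w \<notin> C\<close> 1 2 unfolding w Ciff by simp
        qed
        then have "?R \<subseteq> - \<gamma>" using part by blast
        then have "?R \<subseteq> connected_component_set (- \<gamma>) w"
          by (intro connected_component_maximal \<open>w \<in> ?R\<close> Rconn)
        then have "bounded ?R" using bd bounded_subset by blast
        then obtain B where B: "\<And>t. 1 \<le> t \<Longrightarrow> cmod (?F (t * x) (t * y)) \<le> B" by (auto simp: bounded_iff)
        have "?F 0 0 \<in> C" unfolding Ciff using y star_a[of 0 0] star_b[of 0 0] by simp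
        then have "(x, y) \<noteq> (0, 0)" using w \<open>w \<notin> C\<close> by auto
        then have r: "0 < sqrt (x\<^sup>2 + y\<^sup>2)" by (auto simp: sum_power2_gt_zero_iff)
        have "t * sqrt (x\<^sup>2 + y\<^sup>2) \<le> B + cmod c" if "1 \<le> t" for t
        proof -
          have "t * sqrt (x\<^sup>2 + y\<^sup>2) = cmod (?F (t * x) (t * y) - c)"
            using norm_orthonormal[OF on, of "t * x" "t * y"] that
            by (simp add: frame_def power_mult_distrib real_sqrt_mult flip: distrib_left)
          also have "\<dots> \<le> B + cmod c" using B[OF that] norm_triangle_ineq4[of "?F (t * x) (t * y)" c] by linarith
          finally show ?thesis .
        qed
        moreover define t where "t = max 1 ((B + cmod c + 1) / sqrt (x\<^sup>2 + y\<^sup>2))"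
        have "(B + cmod c + 1) / sqrt (x\<^sup>2 + y\<^sup>2) \<le> t" "1 \<le> t" by (simp_all add: t_def)
        moreover from this(1) have "B + cmod c + 1 \<le> t * sqrt (x\<^sup>2 + y\<^sup>2)"
          using r by (simp only: pos_divide_le_eq)
        ultimately show False by force
      qed
    qed
  qed
qed

lemma frame_in_segment_iff:
  assumes "orthonormal e f"
  shows "frame c e f x y \<in> closed_segment (frame c e f x0 y0) (frame c e f x1 y1) \<longleftrightarrow>
    (\<exists>s. 0 \<le> s \<and> s \<le> 1 \<and> x = (1 - s) * x0 + s * x1 \<and> y = (1 - s) * y0 + s * y1)"
proof -
  have "(1 - s) *\<^sub>R frame c e f x0 y0 + s *\<^sub>R frame c e f x1 y1 =
      frame c e f ((1 - s) * x0 + s * x1) ((1 - s) * y0 + s * y1)" for s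
    by (simp add: frame_def scaleR_conv_of_real algebra_simps)
  then show ?thesis unfolding in_segment using frame_eq_iff[OF assms] by metis
qed

lemma linepath_frame:
  "linepath (frame c e f x0 y0) (frame c e f x1 y1) s =
    frame c e f ((1 - s) * x0 + s * x1) ((1 - s) * y0 + s * y1)"
  by (simp add: linepath_def frame_def scaleR_conv_of_real algebra_simps)

lemma frame_set_eqI:
  assumes on: "orthonormal e f"
    and "\<And>x y. frame c e f x y \<in> S \<longleftrightarrow> frame c e f x y \<in> T"
  shows "S = T"
  using assms(2) frame_coordinates[OF on, of c] by (metis subsetI subset_antisym)

lemma frame_in_transversal_iff:
  assumes on: "orthonormal e f" and h: "h \<noteq> 0"
  shows "frame c e f x y \<in> closed_segment (frame c e f u 0) (frame c e f v h) \<longleftrightarrow>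
    0 \<le> y / h \<and> y / h \<le> 1 \<and> x = u + (v - u) * (y / h)"
  unfolding frame_in_segment_iff[OF on]
proof
  assume "\<exists>s. 0 \<le> s \<and> s \<le> 1 \<and> x = (1 - s) * u + s * v \<and> y = (1 - s) * 0 + s * h"
  then obtain s where "0 \<le> s" "s \<le> 1" "x = (1 - s) * u + s * v" "y = (1 - s) * 0 + s * h" by blast
  then show "0 \<le> y / h \<and> y / h \<le> 1 \<and> x = u + (v - u) * (y / h)"
    using h by (simp add: algebra_simps)
next
  assume *: "0 \<le> y / h \<and> y / h \<le> 1 \<and> x = u + (v - u) * (y / h)"
  have "u + (v - u) * s = (1 - s) * u + s * v" for s by (simp add: algebra_simps)
  from this[of "y / h"] * nonzero_divide_eq_eq[OF h, of y "y / h", THEN iffD1, OF refl] show "\<exists>s. 0 \<le> s \<and> s \<le> 1 \<and> x = (1 - s) * u + s * v \<and> y = (1 - s) * 0 + s * h"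
    using h by (intro exI[of _ "y / h"]) (simp del: times_divide_eq_right times_divide_eq_left)
qed

lemma frame_in_horizontal_iff:
  assumes on: "orthonormal e f" and uv: "u \<le> v"
  shows "frame c e f x y \<in> closed_segment (frame c e f u h) (frame c e f v h) \<longleftrightarrow> y = h \<and> u \<le> x \<and> x \<le> v"
  unfolding frame_in_segment_iff[OF on]
proof
  assume "\<exists>s. 0 \<le> s \<and> s \<le> 1 \<and> x = (1 - s) * u + s * v \<and> y = (1 - s) * h + s * h"
  then obtain s where s: "0 \<le> s" "s \<le> 1" "x = (1 - s) * u + s * v" "y = (1 - s) * h + s * h" by blast
  have "0 \<le> s * (v - u)" "s * (v - u) \<le> 1 * (v - u)"
    using s uv mult_right_mono[of s 1 "v - u"] by simp_all
  then show "y = h \<and> u \<le> x \<and> x \<le> v" using s by (simp add: algebra_simps)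
next
  assume xy: "y = h \<and> u \<le> x \<and> x \<le> v"
  then obtain s where "0 \<le> s" "s \<le> 1" "x = (1 - s) * u + s * v"
    using closed_segment_eq_real_ivl[of u v] uv by (auto simp: closed_segment_def set_eq_iff)
  then show "\<exists>s. 0 \<le> s \<and> s \<le> 1 \<and> x = (1 - s) * u + s * v \<and> y = (1 - s) * h + s * h"
    using xy by (intro exI[of _ s]) (simp add: algebra_simps)
qed

abbreviation triangle_boundary :: "complex \<Rightarrow> complex \<Rightarrow> complex \<Rightarrow> complex set" where
  "triangle_boundary A B C \<equiv> closed_segment A B \<union> closed_segment B C \<union> closed_segment C A"

abbreviation quadrilateral_boundary :: "complex \<Rightarrow> complex \<Rightarrow> complex \<Rightarrow> complex \<Rightarrow> complex set" where
  "quadrilateral_boundary A B C D \<equiv>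
    closed_segment A B \<union> closed_segment B C \<union> closed_segment C D \<union> closed_segment D A"

text \<open>
  The upper side may shrink to a point, which gives triangles.
\<close>

lemma inside_trapezoid_sliced:
  fixes c :: complex and u v :: real
  assumes on: "orthonormal e f" and L: "0 < L" "0 < h" and uv: "u \<le> v"
  defines "A \<equiv> frame c e f (- L) 0" and "B \<equiv> frame c e f L 0"
    and "C \<equiv> frame c e f v h" and "D \<equiv> frame c e f u h"
  shows "inside (quadrilateral_boundary A B C D) =
    sliced c e f 0 h (\<lambda>y. - L + (u + L) * (y / h)) (\<lambda>y. L + (v - L) * (y / h))"
proof (rule inside_sliced[OF on])
  let ?a = "\<lambda>y. - L + (u + L) * (y / h)" and ?b = "\<lambda>y. L + (v - L) * (y / h)"
  show "continuous_on UNIV ?a" "continuous_on UNIV ?b" by (intro continuous_intros; use L in simp)+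
  show "?a (t * y) \<le> t * ?a y" "t * ?b y \<le> ?b (t * y)" if "0 \<le> t" "t \<le> 1" for t y
    using mult_right_mono[OF that(2), of L] L by (simp_all add: algebra_simps)
  show "quadrilateral_boundary A B C D = {frame c e f x y | x y. 0 \<le> y \<and> y \<le> h \<and> ?a y \<le> x \<and> x \<le> ?b y \<and>
        (y = 0 \<or> y = h \<or> x = ?a y \<or> x = ?b y)}" (is "_ = ?G")
  proof (rule frame_set_eqI[OF on, of c])
    fix x y
    have G: "frame c e f x y \<in> ?G \<longleftrightarrow> 0 \<le> y \<and> y \<le> h \<and> ?a y \<le> x \<and> x \<le> ?b y \<and>
        (y = 0 \<or> y = h \<or> x = ?a y \<or> x = ?b y)" using frame_eq_iff[OF on] by auto
    have seg: "frame c e f x y \<in> closed_segment A B \<longleftrightarrow> y = 0 \<and> - L \<le> x \<and> x \<le> L"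
      "frame c e f x y \<in> closed_segment B C \<longleftrightarrow> 0 \<le> y \<and> y \<le> h \<and> x = ?b y"
      "frame c e f x y \<in> closed_segment C D \<longleftrightarrow> y = h \<and> u \<le> x \<and> x \<le> v"
      "frame c e f x y \<in> closed_segment D A \<longleftrightarrow> 0 \<le> y \<and> y \<le> h \<and> x = ?a y"
      unfolding closed_segment_commute[of C D] closed_segment_commute[of D A] unfolding A_def B_def C_def D_def
      using L uv by (auto simp: frame_in_horizontal_iff[OF on] frame_in_transversal_iff[OF on] zero_le_divide_iff)
    have ends: "?a h = u" "?b h = v" using L by simp_all
    have "?a y \<le> ?b y" if "0 \<le> y" "y \<le> h"
    proof -
      have ab: "(L + (v - L) * s) - (- L + (u + L) * s) = 2 * L * (1 - s) + (v - u) * s" for s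
        by (simp add: algebra_simps)
      have "0 \<le> 2 * L * (1 - y / h) + (v - u) * (y / h)"
        using that L uv by (intro add_nonneg_nonneg mult_nonneg_nonneg) auto
      with ab[of "y / h"] show ?thesis by linarith
    qed
    with ends show "frame c e f x y \<in> quadrilateral_boundary A B C D \<longleftrightarrow> frame c e f x y \<in> ?G"
      unfolding G Un_iff seg using L by force
  qed
qed (use L in auto)

lemma inside_triangle_sliced:
  assumes on: "orthonormal e f" and L: "0 < L" "0 < h"
  shows "inside (triangle_boundary (frame c e f (- L) 0) (frame c e f L 0) (frame c e f p h)) =
    sliced c e f 0 h (\<lambda>y. - L + (p + L) * (y / h)) (\<lambda>y. L + (p - L) * (y / h))"
proof -
  have "triangle_boundary A B C = quadrilateral_boundary A B C C" for A B C by auto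
  then show ?thesis using inside_trapezoid_sliced[OF on L order_refl] by metis
qed

lemma inside_parallelogram_sliced:
  assumes on: "orthonormal e f" and L: "0 < L" "0 < h"
  shows "inside (quadrilateral_boundary (frame c e f (- L) 0) (frame c e f L 0)
      (frame c e f (L + p) h) (frame c e f (- L + p) h)) =
    sliced c e f 0 h (\<lambda>y. - L + p * (y / h)) (\<lambda>y. L + p * (y / h))"
  using inside_trapezoid_sliced[OF on L, of "- L + p" "L + p" c] L by simp

text \<open>
  Two triangles on the common base \<open>AC\<close>, one above and one below.  The quadrilateral need not be convex,
  but it is star-shaped about the midpoint of the base.
\<close>

lemma inside_quadrilateral_sliced:
  fixes c :: complex and p q :: real
  assumes on: "orthonormal e f" and L: "0 < L" "0 < h" "0 < k"
  defines "A \<equiv> frame c e f (- L) 0" and "B \<equiv> frame c e f p h"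
    and "C \<equiv> frame c e f L 0" and "D \<equiv> frame c e f q (- k)"
  shows "inside (quadrilateral_boundary A B C D) =
    sliced c e f (- k) h (\<lambda>y. - L + (p + L) * (max y 0 / h) + (q + L) * (max (- y) 0 / k))
      (\<lambda>y. L + (p - L) * (max y 0 / h) + (q - L) * (max (- y) 0 / k))"
proof (rule inside_sliced[OF on])
  let ?a = "\<lambda>y. - L + (p + L) * (max y 0 / h) + (q + L) * (max (- y) 0 / k)"
  let ?b = "\<lambda>y. L + (p - L) * (max y 0 / h) + (q - L) * (max (- y) 0 / k)"
  show "continuous_on UNIV ?a" "continuous_on UNIV ?b" by (intro continuous_intros; use L in simp)+
  \<comment> \<open>\<open>max y 0\<close> and \<open>max (- y) 0\<close> are the heights above and below the base\<close>
  have mx: "max (t * y) 0 = t * max y 0" "max (- (t * y)) 0 = t * max (- y) 0" if "0 \<le> t" for t y :: real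
    using that by (auto simp: max_def mult_le_0_iff zero_le_mult_iff)
  show "?a (t * y) \<le> t * ?a y" "t * ?b y \<le> ?b (t * y)" if "0 \<le> t" "t \<le> 1" for t y
    using mult_right_mono[OF that(2), of L] L
    unfolding mx[OF that(1)] times_divide_eq_right[symmetric] by (simp_all add: ring_distribs mult.left_commute)
  show "quadrilateral_boundary A B C D = {frame c e f x y | x y. - k \<le> y \<and> y \<le> h \<and> ?a y \<le> x \<and> x \<le> ?b y \<and>
        (y = - k \<or> y = h \<or> x = ?a y \<or> x = ?b y)}" (is "_ = ?G")
  proof (rule frame_set_eqI[OF on, of c])
    fix x y
    have G: "frame c e f x y \<in> ?G \<longleftrightarrow> - k \<le> y \<and> y \<le> h \<and> ?a y \<le> x \<and> x \<le> ?b y \<and>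
        (y = - k \<or> y = h \<or> x = ?a y \<or> x = ?b y)" using frame_eq_iff[OF on] by auto
    have seg: "frame c e f x y \<in> closed_segment A B \<longleftrightarrow> 0 \<le> y \<and> y \<le> h \<and> x = - L + (p + L) * (y / h)"
      "frame c e f x y \<in> closed_segment B C \<longleftrightarrow> 0 \<le> y \<and> y \<le> h \<and> x = L + (p - L) * (y / h)"
      "frame c e f x y \<in> closed_segment C D \<longleftrightarrow> - k \<le> y \<and> y \<le> 0 \<and> x = L + (q - L) * (- y / k)"
      "frame c e f x y \<in> closed_segment D A \<longleftrightarrow> - k \<le> y \<and> y \<le> 0 \<and> x = - L + (q + L) * (- y / k)"
      unfolding closed_segment_commute[of B C] closed_segment_commute[of D A] unfolding A_def B_def C_def D_def
      using L by (auto simp: frame_in_transversal_iff[OF on] field_simps)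
    have "(L + (p - L) * s + (q - L) * r) - (- L + (p + L) * s + (q + L) * r) = 2 * L * (1 - s - r)" for r s
      by (simp add: algebra_simps)
    then have ab: "?b y - ?a y = 2 * L * (1 - max y 0 / h - max (- y) 0 / k)" by blast
    have le: "?a y \<le> ?b y" if "- k \<le> y" "y \<le> h"
    proof -
      have "0 \<le> 1 - max y 0 / h - max (- y) 0 / k"
        using that L by (cases "0 \<le> y") (auto simp: max_def field_simps)
      then have "0 \<le> 2 * L * (1 - max y 0 / h - max (- y) 0 / k)"
        using L by simp
      with ab show ?thesis by linarith
    qed
    have ends: "?a h = p" "?b h = p" "?a (- k) = q" "?b (- k) = q" using L by (simp_all add: max_def)
    show "frame c e f x y \<in> quadrilateral_boundary A B C D \<longleftrightarrow> frame c e f x y \<in> ?G"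
    proof (cases "0 \<le> y")
      case True
      then have "max y 0 = y" "max (- y) 0 = 0" by auto
      then show ?thesis using True le ends L unfolding G Un_iff seg by force
    next
      case False
      then have "max y 0 = 0" "max (- y) 0 = - y" by auto
      then show ?thesis using False le ends L unfolding G Un_iff seg by force
    qed
  qed
qed (use L in auto)

section \<open>Loads of the sides\<close>

text \<open>
  The integral of the potential over the side \<open>AB\<close> against the weight that rises linearly from \<open>0\<close>
  at \<open>A\<close> to \<open>1\<close> at \<open>B\<close>.  It is the contribution of this side to the first variation of the interaction
  energy when the side turns about \<open>A\<close> with unit normal speed at \<open>B\<close>.
\<close>

definition load :: "(real \<Rightarrow> real) \<Rightarrow> complex set \<Rightarrow> complex \<Rightarrow> complex \<Rightarrow> real" where
  "load k S A B = dist A B * (LINT s:{0<..<1} | lborel. s * pot k S (linepath A B s))"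

lemma weighted_potential_integrable:
  fixes w :: "real \<Rightarrow> real" and g :: "real \<Rightarrow> complex"
  assumes k: "pair_kernel k" and S: "S \<in> sets borel" "bounded S"
    and g: "continuous_on UNIV g" and w: "continuous_on UNIV w"
  shows "set_integrable lborel {0<..<1} (\<lambda>s. w s * pot k S (g s))"
proof -
  obtain C where C: "0 \<le> C" "\<And>z. pot k S z \<le> C" using pot_bounded[OF k S] by metis
  have "bounded (w ` {0..1})"
    by (intro compact_imp_bounded compact_continuous_image continuous_on_subset[OF w]) auto
  then obtain B where B: "\<And>s. s \<in> {0..1} \<Longrightarrow> \<bar>w s\<bar> \<le> B" unfolding bounded_iff by (metis imageI real_norm_def)
  note [measurable] = pot_measurable[OF k S(1)] borel_measurable_continuous_onI[OF g] borel_measurable_continuous_onI[OF w]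
  show ?thesis unfolding set_integrable_def
  proof (rule Bochner_Integration.integrable_bound)
    show "integrable lborel (\<lambda>s::real. indicator {0<..<1} s * (B * C))"
      using emeasure_bounded_finite[of "{0<..<1::real}"]
      by (intro integrable_mult_left integrable_real_indicator) auto
    show "AE s in lborel. norm (indicator {0<..<1} s *\<^sub>R (w s * pot k S (g s))) \<le> norm (indicator {0<..<1} s * (B * C))"
    proof (rule AE_I2)
      fix s :: real
      have "\<bar>w s\<bar> * pot k S (g s) \<le> B * C" if "s \<in> {0<..<1}"
        using C(2)[of "g s"] pot_nonneg[OF k, of S "g s"] B[of s] that by (intro mult_mono) auto
      then show "norm (indicator {0<..<1} s *\<^sub>R (w s * pot k S (g s))) \<le> norm (indicator {0<..<1} s * (B * C))"
        using pot_nonneg[OF k, of S "g s"] abs_ge_self[of "B * C"]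
        by (auto simp: indicator_def abs_mult[of "w s"])
    qed
  qed measurable
qed

lemma load_nonneg: "pair_kernel k \<Longrightarrow> 0 \<le> load k S A B"
  unfolding load_def set_lebesgue_integral_def
  by (intro mult_nonneg_nonneg Bochner_Integration.integral_nonneg) (auto simp: indicator_def pot_nonneg)

text \<open>
  Loads as integrals over the height \<open>y\<close> above the base, for the side that climbs from \<open>A\<close> at height \<open>0\<close>
  to \<open>B\<close> at height \<open>h\<close>; negative \<open>h\<close> serves for triangles below the base.
\<close>

lemma load_rescaled:
  assumes k: "pair_kernel k" and S: "S \<in> sets borel" "bounded S" and h: "h \<noteq> 0" and "A \<noteq> B"
  defines "q \<equiv> \<lambda>y. indicator {0<..<1} (y / h) *\<^sub>R (y / h * pot k S (linepath A B (y / h)))"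
  shows "integrable lborel q" and "(LINT y | lborel. q y) = \<bar>h\<bar> * (load k S A B / dist A B)"
proof -
  let ?g = "\<lambda>s. indicator {0<..<1} s *\<^sub>R (s * pot k S (linepath A B s))"
  have int: "integrable lborel ?g"
    using weighted_potential_integrable[OF k S continuous_on_linepath continuous_on_id, of A B]
    by (simp add: set_integrable_def)
  have q: "q (0 + h * s) = ?g s" for s using h by (simp add: q_def)
  show "integrable lborel q"
    using int lborel_integrable_real_affine_iff[OF h, of q 0] unfolding q by simp
  have "(LINT y | lborel. q y) = \<bar>h\<bar> * (LINT s | lborel. ?g s)"
    using lborel_integral_real_affine[OF h, of q 0] unfolding q by simp
  then show "(LINT y | lborel. q y) = \<bar>h\<bar> * (load k S A B / dist A B)"
    using \<open>A \<noteq> B\<close> by (simp add: load_def set_lebesgue_integral_def)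
qed

lemma unit_interval_integral_reflect:
  fixes g :: "real \<Rightarrow> real"
  shows "(LINT s:{0<..<1} | lborel. g s) = (LINT s:{0<..<1} | lborel. g (1 - s))"
proof -
  let ?q = "\<lambda>s. indicator {0<..<1} s *\<^sub>R g s"
  have "(LINT s | lborel. ?q s) = \<bar>-1\<bar> *\<^sub>R (LINT s | lborel. ?q (1 + (-1) * s))"
    by (rule lborel_integral_real_affine) simp
  also have "(\<lambda>s. ?q (1 + (-1) * s)) = (\<lambda>s. indicator {0<..<1} s *\<^sub>R g (1 - s))"
    by (auto simp: indicator_def fun_eq_iff)
  finally show ?thesis by (simp add: set_lebesgue_integral_def)
qed

lemma linepath_reverse: "linepath B A (1 - s) = linepath A B s"
  by (simp add: linepath_def algebra_simps)

lemma load_reversed: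
  "load k S B A = dist A B * (LINT s:{0<..<1} | lborel. (1 - s) * pot k S (linepath A B s))"
  unfolding load_def
  by (subst unit_interval_integral_reflect) (simp only: linepath_reverse dist_commute)

lemma dist_frame_squared:
  assumes "orthonormal e f"
  shows "(dist (frame c e f x y) (frame c e f x' y'))\<^sup>2 = (x - x')\<^sup>2 + (y - y')\<^sup>2"
  unfolding dist_frame[OF assms] by simp

text \<open>
  The load at \<open>B\<close> minus the load at \<open>A\<close> is the integral of \<open>(2 * s - 1) * V s\<close>.  Averaging with its mirror
  image gives \<open>(2 * s - 1) * (V s - V (1 - s))\<close>, and both factors have the sign of \<open>s - 1 / 2\<close>.
\<close>

lemma triangle_load_less_frame:
  fixes c :: complex and p :: real
  assumes k: "pair_kernel k" and on: "orthonormal e f" and L: "0 < L" "0 < h" and p: "0 < p"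
  defines "A \<equiv> frame c e f (- L) 0" and "B \<equiv> frame c e f L 0" and "C \<equiv> frame c e f p h"
  defines "S \<equiv> inside (triangle_boundary A B C)"
  shows "load k S B A < load k S A B"
proof -
  let ?a = "\<lambda>y. - L + (p + L) * (y / h)" and ?b = "\<lambda>y. L + (p - L) * (y / h)"
  have S: "S = sliced c e f 0 h ?a ?b"
    unfolding S_def A_def B_def C_def by (rule inside_triangle_sliced[OF on L])
  have cont: "continuous_on UNIV ?a" "continuous_on UNIV ?b" by (intro continuous_intros; use L in simp)+
  have Sb: "S \<in> sets borel" "bounded S" unfolding S
    using open_sliced[OF on cont] bounded_sliced[OF on cont] by auto
  have ab: "?a y < ?b y" "0 < ?a y + ?b y" if "0 < y" "y < h" for y
  proof -
    define s where "s = y / h"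
    have s: "0 < s" "s < 1" using that by (auto simp: s_def)
    have "0 < 2 * L * (1 - s)" "0 < 2 * p * s" using s L p by simp_all
    then show "?a y < ?b y" "0 < ?a y + ?b y" unfolding s_def[symmetric] by (simp_all add: algebra_simps)
  qed
  define V where "V s = pot k S (linepath A B s)" for s
  have lin: "linepath A B s = frame c e f (2 * L * s - L) 0" for s
    unfolding A_def B_def linepath_frame by (rule arg_cong2[of _ _ _ _ "frame c e f"]) (auto simp: algebra_simps)
  have less: "V (1 - s) < V s" if "1 / 2 < s" for s
  proof -
    have "2 * L * (1 - s) - L = - (2 * L * s - L)" by (simp add: algebra_simps)
    moreover have "0 < 2 * L * s - L" using that L mult_strict_left_mono[of 1 "2 * s" L] by simp
    ultimately show ?thesis unfolding V_def lin S
      using potential_increases_along_base[OF k on cont, of 0 0 h "2 * L * s - L"] ab L by simp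
  qed
  have d: "0 < dist A B" unfolding A_def B_def dist_frame[OF on] using L by simp
  have int: "set_integrable lborel {0<..<1} (\<lambda>s. w s * V s)" "set_integrable lborel {0<..<1} (\<lambda>s. w s * V (1 - s))"
    if "continuous_on UNIV w" for w
  proof -
    show "set_integrable lborel {0<..<1} (\<lambda>s. w s * V s)" unfolding V_def
      by (rule weighted_potential_integrable[OF k Sb continuous_on_linepath that])
    show "set_integrable lborel {0<..<1} (\<lambda>s. w s * V (1 - s))" unfolding V_def
      by (rule weighted_potential_integrable[OF k Sb _ that]) (auto simp: linepath_def intro!: continuous_intros)
  qed
  have "0 < (LINT s:{0<..<1} | lborel. (2 * s - 1) * V s - (2 * s - 1) * V (1 - s))"
  proof (rule set_integral_interval_pos[where m = "1 / 2"])
    show "set_integrable lborel {0<..<1} (\<lambda>s. (2 * s - 1) * V s - (2 * s - 1) * V (1 - s))"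
      by (intro set_integral_diff int continuous_intros)
    fix s :: real
    show pos: "0 < (2 * s - 1) * V s - (2 * s - 1) * V (1 - s)" if "s \<noteq> 1 / 2"
    proof (cases "1 / 2 < s")
      case True
      then have "0 < (2 * s - 1) * (V s - V (1 - s))" using less[OF True] by simp
      then show ?thesis by (simp add: right_diff_distrib)
    next
      case False
      then have "V s < V (1 - s)" using less[of "1 - s"] that by simp
      then have "0 < (2 * s - 1) * (V s - V (1 - s))" using False that by (intro mult_neg_neg) auto
      then show ?thesis by (simp add: right_diff_distrib)
    qed
    show "0 \<le> (2 * s - 1) * V s - (2 * s - 1) * V (1 - s)"
    proof (cases "s = 1 / 2")
      case True show ?thesis unfolding True by simp
    next
      case False from pos[OF this] show ?thesis by simp
    qed
  qed simp
  also have "\<dots> = (LINT s:{0<..<1} | lborel. (2 * s - 1) * V s) - (LINT s:{0<..<1} | lborel. (2 * s - 1) * V (1 - s))"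
    by (intro set_integral_diff int continuous_intros)
  also have "(LINT s:{0<..<1} | lborel. (2 * s - 1) * V (1 - s)) = (LINT s:{0<..<1} | lborel. - ((2 * s - 1) * V s))"
    by (subst unit_interval_integral_reflect) (simp add: algebra_simps)
  also have "\<dots> = - (LINT s:{0<..<1} | lborel. (2 * s - 1) * V s)"
    by (simp add: set_lebesgue_integral_def)
  finally have "0 < (LINT s:{0<..<1} | lborel. (2 * s - 1) * V s)" by simp
  also have "\<dots> = (LINT s:{0<..<1} | lborel. s * V s - (1 - s) * V s)"
    by (simp add: algebra_simps)
  also have "\<dots> = (LINT s:{0<..<1} | lborel. s * V s) - (LINT s:{0<..<1} | lborel. (1 - s) * V s)"
    by (intro set_integral_diff int continuous_intros)
  finally have "(LINT s:{0<..<1} | lborel. (1 - s) * V s) < (LINT s:{0<..<1} | lborel. s * V s)" by simp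
  then show ?thesis unfolding load_reversed[of k S B A] using d by (simp add: load_def V_def)
qed

text \<open>
  The midpoint of the slice at height \<open>y\<close> is \<open>p * y / h\<close>, so the symmetrization inequality is a statement
  about the loads at the upper ends of the two lateral sides, which have equal length.
\<close>

lemma parallelogram_load_frame:
  fixes c :: complex
  assumes k: "pair_kernel k" and on: "orthonormal e f" and L: "0 < L" "0 < h" and p: "p \<noteq> 0"
  defines "A \<equiv> frame c e f (- L) 0" and "B \<equiv> frame c e f L 0"
    and "C \<equiv> frame c e f (L + p) h" and "D \<equiv> frame c e f (- L + p) h"
  defines "S \<equiv> inside (quadrilateral_boundary A B C D)"
  shows "p * (load k S B C - load k S A D) < 0"
proof -
  let ?a = "\<lambda>y. - L + p * (y / h)" and ?b = "\<lambda>y. L + p * (y / h)"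
  have S: "S = sliced c e f 0 h ?a ?b"
    unfolding S_def A_def B_def C_def D_def by (rule inside_parallelogram_sliced[OF on L])
  have cont: "continuous_on UNIV ?a" "continuous_on UNIV ?b" by (intro continuous_intros; use L in simp)+
  have Sb: "S \<in> sets borel" "bounded S" unfolding S
    using open_sliced[OF on cont] bounded_sliced[OF on cont] by auto
  let ?V = "pot k S"
  have dBC: "dist B C = dist A D" unfolding A_def B_def C_def D_def dist_frame[OF on] by (simp add: power2_commute)
  have ne: "B \<noteq> C" "A \<noteq> D" unfolding A_def B_def C_def D_def frame_eq_iff[OF on] using L by auto
  have "(LINT y:{0<..<h} | lborel. (?a y + ?b y) * (?V (frame c e f (?b y) y) - ?V (frame c e f (?a y) y))) < 0"
    unfolding S
  proof (rule midpoint_force_negative[OF k on cont])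
    show "\<exists>s\<in>{0<..<h}. \<exists>t\<in>{0<..<h}. ?a s + ?b s \<noteq> ?a t + ?b t"
      using L p by (intro bexI[of _ "h / 2"] bexI[of _ "h / 3"]) auto
  qed (use L in auto)
  moreover have "indicator {0<..<h} y *\<^sub>R ((?a y + ?b y) * (?V (frame c e f (?b y) y) - ?V (frame c e f (?a y) y))) =
      2 * p * (indicator {0<..<1} (y / h) *\<^sub>R (y / h * ?V (linepath B C (y / h)))
        - indicator {0<..<1} (y / h) *\<^sub>R (y / h * ?V (linepath A D (y / h))))" for y
  proof -
    define s where "s = y / h"
    have y: "y = s * h" using L by (simp add: s_def)
    have "linepath B C s = frame c e f (?b y) y" "linepath A D s = frame c e f (?a y) y"
      unfolding A_def B_def C_def D_def linepath_frame s_def[symmetric]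
      by (rule arg_cong2[of _ _ _ _ "frame c e f"]; simp add: y algebra_simps)+
    moreover have "indicator {0<..<h} y = (indicator {0<..<1} s :: real)"
      using L by (auto simp: indicator_def s_def zero_less_divide_iff)
    ultimately show ?thesis unfolding s_def[symmetric] by (simp add: algebra_simps)
  qed
  ultimately have "(LINT y | lborel. 2 * p * (indicator {0<..<1} (y / h) *\<^sub>R (y / h * ?V (linepath B C (y / h)))
        - indicator {0<..<1} (y / h) *\<^sub>R (y / h * ?V (linepath A D (y / h))))) < 0"
    by (simp only: set_lebesgue_integral_def)
  moreover have hn: "h \<noteq> 0" using L by simp
  note r = load_rescaled[OF k Sb hn ne(1)] load_rescaled[OF k Sb hn ne(2)]
  ultimately have "2 * p * (\<bar>h\<bar> * (load k S B C / dist B C) - \<bar>h\<bar> * (load k S A D / dist A D)) < 0"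
    by (simp only: integral_mult_right_zero Bochner_Integration.integral_diff[OF r(1,3)] r(2,4))
  then have "(2 * h / dist A D) * (p * (load k S B C - load k S A D)) < 0"
    unfolding dBC using L by (simp add: algebra_simps diff_divide_distrib)
  moreover have "0 < 2 * h / dist A D" using L ne by simp
  ultimately show ?thesis by (meson less_imp_le mult_nonneg_nonneg not_less)
qed

text \<open>
  At height \<open>y > 0\<close> the midpoint is \<open>p * y / h\<close>, and the upper half contributes
  \<open>2 * p * h * g * (1 / |CB| - 1 / |AB|)\<close> to the integral, where \<open>g\<close> is the common load at \<open>B\<close>.  This is
  nonnegative: if \<open>p > 0\<close> then \<open>B\<close> is closer to \<open>C\<close>, and if \<open>p < 0\<close> closer to \<open>A\<close>.  The same holds for
  the lower half with \<open>q\<close>, so the symmetrization inequality only leaves \<open>p = q = 0\<close>.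
\<close>

lemma kite_frame:
  fixes c :: complex and p q :: real
  assumes k: "pair_kernel k" and on: "orthonormal e f" and L: "0 < L" "0 < h" "0 < l"
  defines "A \<equiv> frame c e f (- L) 0" and "B \<equiv> frame c e f p h"
    and "C \<equiv> frame c e f L 0" and "D \<equiv> frame c e f q (- l)"
  defines "S \<equiv> inside (quadrilateral_boundary A B C D)"
  assumes bal: "load k S A B = load k S C B" "load k S A D = load k S C D"
  shows "p = 0 \<and> q = 0"
proof (rule ccontr)
  assume pq: "\<not> (p = 0 \<and> q = 0)"
  let ?a = "\<lambda>y. - L + (p + L) * (max y 0 / h) + (q + L) * (max (- y) 0 / l)"
  let ?b = "\<lambda>y. L + (p - L) * (max y 0 / h) + (q - L) * (max (- y) 0 / l)"
  have S: "S = sliced c e f (- l) h ?a ?b"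
    unfolding S_def A_def B_def C_def D_def by (rule inside_quadrilateral_sliced[OF on L])
  have cont: "continuous_on UNIV ?a" "continuous_on UNIV ?b" by (intro continuous_intros; use L in simp)+
  have Sb: "S \<in> sets borel" "bounded S" unfolding S
    using open_sliced[OF on cont] bounded_sliced[OF on cont] by auto
  let ?V = "pot k S"
  have ne: "A \<noteq> B" "C \<noteq> B" "A \<noteq> D" "C \<noteq> D"
    unfolding A_def B_def C_def D_def frame_eq_iff[OF on] using L by auto
  have neg: "(LINT y:{- l<..<h} | lborel. (?a y + ?b y) * (?V (frame c e f (?b y) y) - ?V (frame c e f (?a y) y))) < 0"
    unfolding S
  proof (rule midpoint_force_negative[OF k on cont])
    fix y assume y: "- l < y" "y < h"
    have "(L + (p - L) * s + (q - L) * r) - (- L + (p + L) * s + (q + L) * r) = 2 * L * (1 - s - r)" for r s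
      by (simp add: algebra_simps)
    from this[of "max y 0 / h" "max (- y) 0 / l"]
    moreover have "0 < 1 - max y 0 / h - max (- y) 0 / l"
      using y L by (cases "0 \<le> y") (auto simp: max_def field_simps)
    then have "0 < 2 * L * (1 - max y 0 / h - max (- y) 0 / l)" using L by simp
    ultimately show "?a y < ?b y" by linarith
  next
    have "?a 0 + ?b 0 = 0" "?a (h / 2) + ?b (h / 2) = p" "?a (- l / 2) + ?b (- l / 2) = q"
      using L by (simp_all add: max_def field_simps)
    then have "?a 0 + ?b 0 \<noteq> ?a (h / 2) + ?b (h / 2) \<or> ?a 0 + ?b 0 \<noteq> ?a (- l / 2) + ?b (- l / 2)"
      using pq by simp
    moreover have "h / 2 \<in> {- l<..<h}" "- l / 2 \<in> {- l<..<h}" "0 \<in> {- l<..<h}" using L by auto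
    ultimately show "\<exists>s\<in>{- l<..<h}. \<exists>t\<in>{- l<..<h}. ?a s + ?b s \<noteq> ?a t + ?b t"
      by blast
  qed
  let ?q = "\<lambda>U W h y. indicator {0<..<1} (y / h) *\<^sub>R (y / h * ?V (linepath U W (y / h)))"
  \<comment> \<open>the base line \<open>y = 0\<close> carries no weight, as the midpoint of its slice is \<open>0\<close>\<close>
  have dec: "indicator {- l<..<h} y *\<^sub>R ((?a y + ?b y) * (?V (frame c e f (?b y) y) - ?V (frame c e f (?a y) y))) =
      2 * p * (?q C B h y - ?q A B h y) + 2 * q * (?q C D (- l) y - ?q A D (- l) y)" for y
  proof -
    consider "0 < y" | "y = 0" | "y < 0" by linarith
    then show ?thesis
    proof cases
      case 1
      define s where "s = y / h"
      have y: "y = s * h" "max y 0 = y" "max (- y) 0 = 0" using L 1 by (auto simp: s_def)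
      have lin: "linepath C B s = frame c e f (?b y) y" "linepath A B s = frame c e f (?a y) y"
        unfolding A_def B_def C_def linepath_frame y(2,3) s_def[symmetric]
        by (rule arg_cong2[of _ _ _ _ "frame c e f"]; simp add: y(1) algebra_simps)+
      have i1: "indicator {- l<..<h} y = (indicator {0<..<1} s :: real)"
        using L 1 by (auto simp: indicator_def s_def)
      have "indicator {0<..<1} (y / - l) = (0::real)" using L 1 by (auto simp: indicator_def divide_less_0_iff)
      moreover have "?a y + ?b y = 2 * p * s" unfolding y(2,3) s_def[symmetric] by (simp add: algebra_simps)
      ultimately show ?thesis unfolding s_def[symmetric] lin i1 by (simp add: algebra_simps)
    next
      case 2 then show ?thesis by simp
    next
      case 3
      define s where "s = y / - l"
      have y: "y = - s * l" "max y 0 = 0" "max (- y) 0 = - y" using L 3 by (auto simp: s_def)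
      have sl: "- y / l = s" by (simp add: s_def)
      have lin: "linepath C D s = frame c e f (?b y) y" "linepath A D s = frame c e f (?a y) y"
        unfolding A_def D_def C_def linepath_frame y(2,3) sl
        by (rule arg_cong2[of _ _ _ _ "frame c e f"]; simp add: y(1) algebra_simps)+
      have i1: "indicator {- l<..<h} y = (indicator {0<..<1} s :: real)"
        using L 3 by (auto simp: indicator_def s_def field_simps)
      have "indicator {0<..<1} (y / h) = (0::real)" using L 3 by (auto simp: indicator_def zero_less_divide_iff)
      moreover have "?a y + ?b y = 2 * q * s" unfolding y(2,3) sl by (simp add: algebra_simps)
      ultimately show ?thesis unfolding s_def[symmetric] lin i1 by (simp add: algebra_simps)
    qed
  qed
  have hn: "h \<noteq> 0" "- l \<noteq> 0" using L by auto
  note r = load_rescaled[OF k Sb hn(1) ne(2)] load_rescaled[OF k Sb hn(1) ne(1)]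
    load_rescaled[OF k Sb hn(2) ne(4)] load_rescaled[OF k Sb hn(2) ne(3)]
  have "(LINT y | lborel. 2 * p * (?q C B h y - ?q A B h y) + 2 * q * (?q C D (- l) y - ?q A D (- l) y)) =
     2 * p * (\<bar>h\<bar> * (load k S C B / dist C B) - \<bar>h\<bar> * (load k S A B / dist A B)) +
     2 * q * (\<bar>- l\<bar> * (load k S C D / dist C D) - \<bar>- l\<bar> * (load k S A D / dist A D))"
    by (simp only: Bochner_Integration.integral_add Bochner_Integration.integral_diff integral_mult_right_zero
      integrable_mult_right Bochner_Integration.integrable_diff r)
  with neg have "2 * p * (\<bar>h\<bar> * (load k S C B / dist C B) - \<bar>h\<bar> * (load k S A B / dist A B)) +
     2 * q * (\<bar>- l\<bar> * (load k S C D / dist C D) - \<bar>- l\<bar> * (load k S A D / dist A D)) < 0"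
    unfolding set_lebesgue_integral_def dec by simp
  moreover have *: "0 \<le> 2 * x * (h * (g / dC) - h * (g / dA))"
    if "0 \<le> g" "0 < h" "0 < dC" "0 < dA" "dA\<^sup>2 - dC\<^sup>2 = 4 * x * L" for x h g dC dA :: real
  proof -
    have eq: "h * (g / dC) - h * (g / dA) = h * g * (dA - dC) / (dA * dC)"
      using that by (simp add: field_simps)
    have "(dA - dC) * (dA + dC) = 4 * x * L" using that by (simp add: power2_eq_square algebra_simps)
    then have "0 \<le> x * (dA - dC)"
    proof -
      have "4 * L * (x * (dA - dC)) = (dA + dC) * (dA - dC)\<^sup>2"
        using \<open>(dA - dC) * (dA + dC) = 4 * x * L\<close> by (simp add: power2_eq_square) (metis mult.assoc mult.commute)
      moreover have "0 \<le> (dA + dC) * (dA - dC)\<^sup>2" using that by simp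
      moreover have "0 < 4 * L" using L by simp
      ultimately show ?thesis by (metis mult_pos_neg not_less)
    qed
    then have "0 \<le> 2 * (x * (dA - dC)) * (h * g / (dA * dC))" using that by simp
    moreover have "2 * x * (h * g * (dA - dC) / (dA * dC)) = 2 * (x * (dA - dC)) * (h * g / (dA * dC))"
      by (simp only: times_divide_eq_right times_divide_eq_left mult_ac)
    ultimately show ?thesis unfolding eq by (simp only:)
  qed
  have dd: "(dist A B)\<^sup>2 - (dist C B)\<^sup>2 = 4 * p * L" "(dist A D)\<^sup>2 - (dist C D)\<^sup>2 = 4 * q * L"
    unfolding A_def B_def C_def D_def dist_frame_squared[OF on] by (simp_all add: power2_eq_square algebra_simps)
  have "0 \<le> 2 * p * (\<bar>h\<bar> * (load k S C B / dist C B) - \<bar>h\<bar> * (load k S A B / dist A B))"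
    unfolding bal(1) using L ne dd(1) by (intro *) (simp_all add: load_nonneg[OF k])
  moreover have "0 \<le> 2 * q * (\<bar>- l\<bar> * (load k S C D / dist C D) - \<bar>- l\<bar> * (load k S A D / dist A D))"
    unfolding bal(2) using L ne dd(2) by (intro *) (simp_all add: load_nonneg[OF k])
  ultimately show False by linarith
qed

section \<open>Coordinate-free consequences\<close>

text \<open>
  Twice the signed area of the triangle \<open>ABC\<close>.
\<close>

definition orient :: "complex \<Rightarrow> complex \<Rightarrow> complex \<Rightarrow> real" where
  "orient A B C = Im (cnj (B - A) * (C - A))"

lemma orient_frame:
  assumes on: "orthonormal e f"
  shows "orient (frame c e f x0 y0) (frame c e f x1 y1) (frame c e f x2 y2) =
    (if f = \<i> * e then 1 else - 1) * ((x1 - x0) * (y2 - y0) - (y1 - y0) * (x2 - x0))"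
proof -
  have s: "Re e * Re e + Im e * Im e = 1" using orthonormal_pow2[OF on] by (simp add: power2_eq_square)
  define X1 Y1 X2 Y2 where "X1 = x1 - x0" and "Y1 = y1 - y0" and "X2 = x2 - x0" and "Y2 = y2 - y0"
  have d: "frame c e f x1 y1 - frame c e f x0 y0 = of_real X1 * e + of_real Y1 * f"
    "frame c e f x2 y2 - frame c e f x0 y0 = of_real X2 * e + of_real Y2 * f"
    by (auto simp: frame_def X1_def X2_def Y1_def Y2_def algebra_simps)
  define r :: real where "r = (if f = \<i> * e then 1 else - 1)"
  have f: "Re f = - r * Im e" "Im f = r * Re e" using on by (auto simp: r_def orthonormal_def)
  have "orient (frame c e f x0 y0) (frame c e f x1 y1) (frame c e f x2 y2) =
      r * (X1 * Y2 - Y1 * X2) * (Re e * Re e + Im e * Im e)"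
    unfolding orient_def d by (simp add: f algebra_simps)
  then show ?thesis unfolding s by (simp add: r_def X1_def X2_def Y1_def Y2_def)
qed

lemma obtain_frame:
  assumes "orient A B C \<noteq> 0"
  obtains c e f L p h where "orthonormal e f" "0 < L" "0 < h"
    "A = frame c e f (- L) 0" "B = frame c e f L 0" "C = frame c e f p h"
proof -
  define c where "c = (A + B) / 2"
  define L where "L = cmod (B - A) / 2"
  define e where "e = (B - A) / of_real (2 * L)"
  have "A \<noteq> B" using assms by (auto simp: orient_def)
  then have L: "0 < L" by (simp add: L_def)
  have e1: "cmod e = 1" using L by (simp add: e_def norm_divide L_def)
  have BA: "B - A = of_real (2 * L) * e" using L by (simp add: e_def)
  have A: "A = frame c e f (- L) 0" and B: "B = frame c e f L 0" for f
  proof -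
    have "of_real L * e = (B - A) / 2" using BA by (simp add: mult.assoc)
    then show "A = frame c e f (- L) 0" "B = frame c e f L 0" by (simp_all add: frame_def c_def field_simps)
  qed
  have on: "orthonormal e (\<i> * e)" "orthonormal e (- \<i> * e)" using e1 by (auto simp: orthonormal_def)
  define h0 where "h0 = Re (cnj (\<i> * e) * (C - c))"
  define p where "p = Re (cnj e * (C - c))"
  have C: "C = frame c e (\<i> * e) p h0" "C = frame c e (- \<i> * e) p (- h0)"
  proof -
    show C1: "C = frame c e (\<i> * e) p h0" unfolding h0_def p_def by (rule frame_coordinates[OF on(1), symmetric])
    show "C = frame c e (- \<i> * e) p (- h0)" by (subst C1) (simp add: frame_def)
  qed
  have "orient A B C = 2 * L * h0"
    using orient_frame[OF on(1), of c "- L" 0 L 0 p h0] by (simp flip: A B C)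
  then have "h0 \<noteq> 0" using assms by auto
  then consider "0 < h0" | "0 < - h0" by linarith
  then show ?thesis
  proof cases
    case 1 show ?thesis by (rule that[OF on(1) L 1 A B C(1)])
  next
    case 2 show ?thesis by (rule that[OF on(2) L 2 A B C(2)])
  qed
qed

text \<open>
  The product of the orientations is negative when \<open>B\<close> and \<open>D\<close> lie strictly on different sides of the
  line \<open>AC\<close>.
\<close>

lemma obtain_diagonal_frame:
  assumes sep: "orient A C B * orient A C D < 0"
  obtains c e f L p h q l where "orthonormal e f" "0 < L" "0 < h" "0 < l"
    "A = frame c e f (- L) 0" "C = frame c e f L 0" "B = frame c e f p h" "D = frame c e f q (- l)"
proof -
  have "orient A C B \<noteq> 0" using sep by auto
  then obtain c e f L p h where F: "orthonormal e f" "0 < L" "0 < h"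
    "A = frame c e f (- L) 0" "C = frame c e f L 0" "B = frame c e f p h"
    using obtain_frame by metis
  obtain q l' where "D = frame c e f q l'" using frame_coordinates[OF F(1), of c D] by metis
  then obtain l where D: "D = frame c e f q (- l)" by (metis minus_minus)
  have "orient A C B * orient A C D = - (4 * L\<^sup>2 * h * l)"
    unfolding F(4-6) D orient_frame[OF F(1)] by (simp add: power2_eq_square)
  then have "0 < 4 * L\<^sup>2 * h * l" using sep by simp
  moreover have "0 < 4 * L\<^sup>2 * h" using F(2,3) by simp
  ultimately have "0 < l" by (rule zero_less_mult_pos)
  with F D that show ?thesis by blast
qed

lemma triangle_load_less:
  assumes k: "pair_kernel k" and "orient A B C \<noteq> 0" and less: "dist C B < dist C A"
  defines "S \<equiv> inside (triangle_boundary A B C)"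
  shows "load k S B A < load k S A B"
proof -
  obtain c e f L p h where F: "orthonormal e f" "0 < L" "0 < h"
    "A = frame c e f (- L) 0" "B = frame c e f L 0" "C = frame c e f p h"
    using obtain_frame[OF assms(2)] by metis
  have "(dist C B)\<^sup>2 < (dist C A)\<^sup>2" using less by (simp add: power_strict_mono)
  then have "0 < 4 * L * p" unfolding F(4-6) dist_frame_squared[OF F(1)] by (simp add: power2_eq_square algebra_simps)
  then have "0 < p" using F(2) by (simp add: zero_less_mult_iff)
  from triangle_load_less_frame[OF k F(1-3) this] show ?thesis unfolding S_def F(4-6) .
qed

text \<open>
  In the frame of the diagonal, \<open>B\<close> and \<open>D\<close> end up on its perpendicular bisector.  In particular the
  other diagonal separates \<open>A\<close> and \<open>C\<close>, which allows a second application with the roles exchanged.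
\<close>

lemma kite:
  assumes k: "pair_kernel k" and sep: "orient A C B * orient A C D < 0"
  defines "S \<equiv> inside (quadrilateral_boundary A B C D)"
  assumes bal: "load k S A B = load k S C B" "load k S A D = load k S C D"
  shows "dist A B = dist C B" "dist A D = dist C D" "orient B D A * orient B D C < 0"
proof -
  obtain c e f L p h q l where F: "orthonormal e f" "0 < L" "0 < h" and l: "0 < l"
    and pts: "A = frame c e f (- L) 0" "C = frame c e f L 0" "B = frame c e f p h" "D = frame c e f q (- l)"
    using obtain_diagonal_frame[OF sep] by metis
  have pq: "p = 0" "q = 0"
    using kite_frame[OF k F(1-3) l, of c p q] bal unfolding S_def pts by auto
  show "dist A B = dist C B" "dist A D = dist C D"
    unfolding pts dist_frame[OF F(1)] pq by (simp_all add: power2_eq_square)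
  have "orient B D A * orient B D C = - (L\<^sup>2 * (h + l)\<^sup>2)"
    unfolding pts orient_frame[OF F(1)] pq by (simp add: power2_eq_square algebra_simps)
  then show "orient B D A * orient B D C < 0" using F(2,3) l by simp
qed

lemma rhombus_diagonals:
  assumes sep: "orient A C B * orient A C D < 0"
    and "dist A B = dist C B" "dist A D = dist C D" "dist A B = dist A D"
  shows "A + C = B + D"
proof -
  obtain c e f L p h q l where F: "orthonormal e f" "0 < L" "0 < h" and l: "0 < l"
    and pts: "A = frame c e f (- L) 0" "C = frame c e f L 0" "B = frame c e f p h" "D = frame c e f q (- l)"
    using obtain_diagonal_frame[OF sep] by metis
  have "(dist A B)\<^sup>2 = (dist C B)\<^sup>2" "(dist A D)\<^sup>2 = (dist C D)\<^sup>2" "(dist A B)\<^sup>2 = (dist A D)\<^sup>2"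
    using assms by auto
  then have "L * p = 0" "L * q = 0" "(L + p)\<^sup>2 + h\<^sup>2 = (L + q)\<^sup>2 + l\<^sup>2"
    unfolding pts dist_frame_squared[OF F(1)] by (auto simp: power2_eq_square algebra_simps)
  then have "p = 0" "q = 0" "h\<^sup>2 = l\<^sup>2" using F(2) by auto
  then have "h = l" using F(3) l by (simp add: power2_eq_iff)
  then show ?thesis unfolding pts frame_def using \<open>p = 0\<close> \<open>q = 0\<close> by simp
qed

lemma parallelogram_load:
  assumes k: "pair_kernel k" and nc: "orient A B D \<noteq> 0" and par: "A + C = B + D"
    and "(B - A) \<bullet> (D - A) \<noteq> 0"
  defines "S \<equiv> inside (quadrilateral_boundary A B C D)"
  shows "((B - A) \<bullet> (D - A)) * (load k S B C - load k S A D) < 0"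
proof -
  obtain c e f L p' h where F: "orthonormal e f" "0 < L" "0 < h"
    "A = frame c e f (- L) 0" "B = frame c e f L 0" "D = frame c e f p' h"
    using obtain_frame[OF nc] by metis
  define p where "p = p' + L"
  have D: "D = frame c e f (- L + p) h" by (simp add: F(6) p_def)
  have "C = B + D - A" using par by (simp add: algebra_simps)
  then have C: "C = frame c e f (L + p) h" unfolding F(4,5) D by (simp add: frame_def algebra_simps)
  have "2 * ((B - A) \<bullet> (D - A)) = (dist B A)\<^sup>2 + (dist D A)\<^sup>2 - (dist B D)\<^sup>2"
  proof -
    have "B - D = (B - A) - (D - A)" by simp
    then have "(dist B D)\<^sup>2 = (norm ((B - A) - (D - A)))\<^sup>2" by (simp add: dist_norm)
    then show ?thesis unfolding dist_norm by (simp add: power2_norm_eq_inner inner_diff inner_commute)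
  qed
  also have "\<dots> = 4 * L * p"
    unfolding F(4,5) D dist_frame_squared[OF F(1)] by (simp add: power2_eq_square algebra_simps)
  finally have ip: "(B - A) \<bullet> (D - A) = 2 * L * p" by simp
  then have "p \<noteq> 0" using assms(4) by auto
  from parallelogram_load_frame[OF k F(1-3) this, of c]
  have "p * (load k S B C - load k S A D) < 0" unfolding S_def F(4,5) C D .
  moreover have "0 < 2 * L" using F(2) by simp
  ultimately have "2 * L * (p * (load k S B C - load k S A D)) < 0" by (rule mult_pos_neg[rotated])
  then show ?thesis unfolding ip by (simp add: mult.assoc)
qed

section \<open>Interior angles at convex corners\<close>

lemma inside_triangle_cone:
  assumes "orient A B C \<noteq> 0"
  shows "inside (triangle_boundary A B C) =
    {A + of_real s * (B - A) + of_real t * (C - A) | s t. 0 < s \<and> 0 < t \<and> s + t < 1}"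
proof -
  obtain c e f L p h where F: "orthonormal e f" "0 < L" "0 < h"
    "A = frame c e f (- L) 0" "B = frame c e f L 0" "C = frame c e f p h"
    using obtain_frame[OF assms] by metis
  have pt: "A + of_real s * (B - A) + of_real t * (C - A) = frame c e f (- L + 2 * L * s + (p + L) * t) (h * t)" for s t
    unfolding F(4-6) by (simp add: frame_def algebra_simps)
  show ?thesis unfolding pt unfolding F(4-6) inside_triangle_sliced[OF F(1-3)] sliced_def
  proof (intro set_eqI iffI; clarsimp)
    fix x y assume xy: "0 < y" "y < h" "(p + L) * y / h - L < x" "x < L + (p - L) * y / h"
    define t where "t = y / h"
    define s where "s = (x + L - (p + L) * t) / (2 * L)"
    have y: "y = h * t" using F(3) by (simp add: t_def)
    have x: "x = - L + 2 * L * s + (p + L) * t" using F(2) by (simp add: s_def)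
    have yt: "(p + L) * y / h = (p + L) * t" "(p - L) * y / h = (p - L) * t" by (simp_all add: t_def)
    have "0 < 2 * L * s" "0 < 2 * L * (1 - s - t)"
      using xy(3,4) unfolding yt unfolding x by (simp_all add: algebra_simps)
    moreover have "0 < 2 * L" using F(2) by simp
    ultimately have "0 < s" "0 < 1 - s - t" by (metis zero_less_mult_pos)+
    then have "0 < s" "s + t < 1" by simp_all
    moreover have "0 < t" using xy F(3) by (simp add: t_def)
    ultimately show "\<exists>s t. frame c e f x y = frame c e f (2 * L * s - L + (p + L) * t) (h * t) \<and> 0 < s \<and> 0 < t \<and> s + t < 1"
      unfolding x y by - (rule exI[of _ s], rule exI[of _ t], simp)
  next
    fix s t :: real assume st: "0 < s" "0 < t" "s + t < 1"
    have "0 < 2 * L * s" "0 < 2 * L * (1 - s - t)" using st F(2) by simp_all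
    moreover have "(p + L) * (h * t) / h = (p + L) * t" "(p - L) * (h * t) / h = (p - L) * t" using F(3) by simp_all
    ultimately show "\<exists>x y. frame c e f (2 * L * s - L + (p + L) * t) (h * t) = frame c e f x y \<and> 0 < y \<and> y < h \<and>
        (p + L) * y / h - L < x \<and> x < L + (p - L) * y / h"
      using st F(3) by - (rule exI[of _ "2 * L * s - L + (p + L) * t"], rule exI[of _ "h * t"], simp only:, simp add: algebra_simps)
  qed
qed

lemma inside_parallelogram_cone:
  assumes nc: "orient A B D \<noteq> 0" and par: "A + C = B + D"
  shows "inside (quadrilateral_boundary A B C D) =
    {A + of_real s * (B - A) + of_real t * (D - A) | s t. 0 < s \<and> s < 1 \<and> 0 < t \<and> t < 1}"
proof -
  obtain c e f L p' h where F: "orthonormal e f" "0 < L" "0 < h"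
    "A = frame c e f (- L) 0" "B = frame c e f L 0" "D = frame c e f p' h"
    using obtain_frame[OF nc] by metis
  define p where "p = p' + L"
  have D: "D = frame c e f (- L + p) h" by (simp add: F(6) p_def)
  have "C = B + D - A" using par by (simp add: algebra_simps)
  then have C: "C = frame c e f (L + p) h" unfolding F(4,5) D by (simp add: frame_def algebra_simps)
  have pt: "A + of_real s * (B - A) + of_real t * (D - A) = frame c e f (- L + 2 * L * s + p * t) (h * t)" for s t
    unfolding F(4,5) D by (simp add: frame_def algebra_simps)
  show ?thesis unfolding pt unfolding F(4,5) C D inside_parallelogram_sliced[OF F(1-3)] sliced_def
  proof (intro set_eqI iffI; clarsimp)
    fix x y assume xy: "0 < y" "y < h" "p * y / h - L < x" "x < L + p * y / h"
    define t where "t = y / h"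
    define s where "s = (x + L - p * t) / (2 * L)"
    have y: "y = h * t" using F(3) by (simp add: t_def)
    have x: "x = - L + 2 * L * s + p * t" using F(2) by (simp add: s_def)
    have yt: "p * y / h = p * t" by (simp add: t_def)
    have "0 < 2 * L * s" "0 < 2 * L - 2 * L * s"
      using xy(3,4) unfolding yt unfolding x by linarith+
    then have "0 < 2 * L * s" "0 < 2 * L * (1 - s)" by (simp_all only: right_diff_distrib mult_1_right)
    moreover have "0 < 2 * L" using F(2) by simp
    ultimately have "0 < s" "0 < 1 - s" by (metis zero_less_mult_pos)+
    then have "0 < s" "s < 1" by simp_all
    moreover have "0 < t" "t < 1" using xy F(3) by (simp_all add: t_def)
    ultimately show "\<exists>s t. frame c e f x y = frame c e f (2 * L * s - L + p * t) (h * t) \<and> 0 < s \<and> s < 1 \<and> 0 < t \<and> t < 1"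
      unfolding x y by - (rule exI[of _ s], rule exI[of _ t], simp)
  next
    fix s t :: real assume st: "0 < s" "s < 1" "0 < t" "t < 1"
    have "0 < 2 * L * s" "0 < 2 * L * (1 - s)" using st F(2) by (simp_all only: mult_pos_pos zero_less_numeral diff_gt_0_iff_gt)
    then show "\<exists>x y. frame c e f (2 * L * s - L + p * t) (h * t) = frame c e f x y \<and> 0 < y \<and> y < h \<and>
        p * y / h - L < x \<and> x < L + p * y / h"
      using st F(3) by - (rule exI[of _ "2 * L * s - L + p * t"], rule exI[of _ "h * t"], simp add: algebra_simps)
  qed
qed

text \<open>
  If the angle \<open>\<alpha>\<close> from the next side to the previous one is below \<open>pi\<close>, the sector of opening \<open>\<alpha>\<close>
  consists of positive combinations of \<open>u\<close> and \<open>w\<close> and lies in the region near the vertex.  Otherwise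
  this sector contains points on the wrong side of the line along \<open>u\<close>, and the interior angle is
  \<open>2 * pi - \<alpha>\<close>.  In both cases it is the unoriented angle between \<open>u\<close> and \<open>w\<close>.
\<close>

lemma interior_angle_convex_corner:
  fixes P :: "int \<Rightarrow> complex" and i :: int
  defines "u \<equiv> P (i + 1) - P i" and "w \<equiv> P (i - 1) - P i"
  assumes nc: "Im (w / u) \<noteq> 0"
    and cone: "0 < \<epsilon>" "\<And>a b. 0 < a \<Longrightarrow> 0 < b \<Longrightarrow> a + b < \<epsilon> \<Longrightarrow> P i + of_real a * u + of_real b * w \<in> polygon_region N P"
    and side: "polygon_region N P \<subseteq> {P i + of_real a * u + of_real b * w | a b. 0 < b}"
  shows "0 < interior_angle N P i" "interior_angle N P i < pi"
    "cos (interior_angle N P i) = Re (w / u) / cmod (w / u)"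
    "sin (interior_angle N P i) = \<bar>Im (w / u)\<bar> / cmod (w / u)"
proof -
  define z where "z = w / u"
  define \<alpha> where "\<alpha> = Arg2pi z"
  define \<theta> where "\<theta> = interior_angle N P i"
  have "u \<noteq> 0" using nc by auto
  have "z \<noteq> 0" using nc by (auto simp: z_def)
  then have r: "0 < cmod z" by simp
  have wz: "w = z * u" using \<open>u \<noteq> 0\<close> by (simp add: z_def)
  have z: "z = of_real (cmod z) * cis \<alpha>" unfolding \<alpha>_def cis_conv_exp by (rule Arg2pi_eq)
  have cs: "cos \<alpha> = Re z / cmod z" "sin \<alpha> = Im z / cmod z"
  proof -
    have "Re z = cmod z * cos \<alpha>" "Im z = cmod z * sin \<alpha>"
      by (subst z, simp)+
    then show "cos \<alpha> = Re z / cmod z" "sin \<alpha> = Im z / cmod z" using r by simp_all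
  qed
  have \<alpha>: "0 \<le> \<alpha>" "\<alpha> < 2 * pi" unfolding \<alpha>_def by (auto simp: Arg2pi_ge_0 Arg2pi_lt_2pi)
  have "sin \<alpha> \<noteq> 0" using nc r by (simp add: cs z_def)
  then have \<alpha>': "\<alpha> \<noteq> 0" "\<alpha> \<noteq> pi" by auto
  let ?cond = "\<exists>r>0. \<forall>\<rho> t. 0 < \<rho> \<and> \<rho> < r \<and> 0 < t \<and> t < \<alpha> \<longrightarrow> P i + of_real \<rho> * cis t * u \<in> polygon_region N P"
  have \<theta>: "\<theta> = (if ?cond then \<alpha> else 2 * pi - \<alpha>)"
    unfolding \<theta>_def interior_angle_def Let_def u_def[symmetric] w_def[symmetric] \<alpha>_def z_def by simp
  have "0 < \<theta> \<and> \<theta> < pi \<and> cos \<theta> = Re z / cmod z \<and> sin \<theta> = \<bar>Im z\<bar> / cmod z"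
  proof (cases "\<alpha> < pi")
    case True
    then have sp: "0 < sin \<alpha>" using \<alpha> \<alpha>' by (intro sin_gt_zero) auto
    have ?cond
    proof (intro exI conjI allI impI)
      \<comment> \<open>\<open>?M\<close> bounds the sum of the coefficients of \<open>cis t * u\<close> with respect to \<open>u\<close> and \<open>w\<close>\<close>
      let ?M = "1 / sin \<alpha> + 1 / (sin \<alpha> * cmod z)"
      have M: "0 < ?M" using sp r by (simp add: add_pos_pos)
      then show "0 < \<epsilon> / ?M" using cone(1) by simp
      fix \<rho> t assume t: "0 < \<rho> \<and> \<rho> < \<epsilon> / ?M \<and> 0 < t \<and> t < \<alpha>"
      define a where "a = \<rho> * sin (\<alpha> - t) / sin \<alpha>"
      define b where "b = \<rho> * sin t / (sin \<alpha> * cmod z)"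
      have st: "0 < sin (\<alpha> - t)" "0 < sin t" using t True by (auto intro!: sin_gt_zero)
      have ab: "0 < a" "0 < b" unfolding a_def b_def using st t sp r by simp_all
      have "a + b \<le> \<rho> / sin \<alpha> + \<rho> / (sin \<alpha> * cmod z)"
        unfolding a_def b_def using t sp r by (intro add_mono divide_right_mono) (auto simp: mult_left_le)
      also have "\<dots> = \<rho> * ?M" by (simp add: distrib_left)
      also have "\<dots> < \<epsilon>" using t M by (simp add: pos_less_divide_eq)
      finally have "P i + of_real a * u + of_real b * w \<in> polygon_region N P" by (intro cone ab)
      moreover have "of_real \<rho> * cis t = of_real a + of_real b * z"
      proof -
        have "a + b * (cmod z * cos \<alpha>) = \<rho> * (sin (\<alpha> - t) + sin t * cos \<alpha>) / sin \<alpha>"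
          using r by (simp add: a_def b_def add_divide_distrib distrib_left)
        also have "sin (\<alpha> - t) + sin t * cos \<alpha> = sin \<alpha> * cos t" by (simp add: sin_diff)
        also have "\<rho> * (sin \<alpha> * cos t) / sin \<alpha> = \<rho> * cos t" using sp by simp
        finally have re: "\<rho> * cos t = a + b * (cmod z * cos \<alpha>)" by (rule sym)
        have im: "\<rho> * sin t = b * (cmod z * sin \<alpha>)" using sp r by (simp add: b_def)
        have "Im z = cmod z * sin \<alpha>" "Re z = cmod z * cos \<alpha>" using cs r by simp_all
        then show ?thesis by (simp only: complex_eq_iff re im cis.simps Re_complex_of_real Im_complex_of_real
            plus_complex.simps times_complex.simps) simp
      qed
      ultimately show "P i + of_real \<rho> * cis t * u \<in> polygon_region N P" by (simp add: wz algebra_simps)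
    qed
    then have "\<theta> = \<alpha>" unfolding \<theta> by (rule if_P)
    then show ?thesis using True \<alpha> \<alpha>' cs sp r by (simp add: zero_less_divide_iff)
  next
    case False
    then have sn: "sin \<alpha> < 0" using \<alpha> \<alpha>' by (intro sin_lt_zero) auto
    then have iz: "Im z < 0" using r by (simp add: cs divide_less_0_iff)
    have "\<not> ?cond"
    proof (intro notI, elim exE conjE)
      fix r :: real
      assume "0 < r" and H: "\<forall>\<rho> t. 0 < \<rho> \<and> \<rho> < r \<and> 0 < t \<and> t < \<alpha> \<longrightarrow> P i + of_real \<rho> * cis t * u \<in> polygon_region N P"
      have "0 < r / 2 \<and> r / 2 < r \<and> 0 < pi / 2 \<and> pi / 2 < \<alpha>"
        using \<open>0 < r\<close> False pi_gt_zero by linarith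
      then have "P i + of_real (r / 2) * cis (pi / 2) * u \<in> polygon_region N P"
        using H by blast
      then obtain a b where ab: "P i + of_real (r / 2) * cis (pi / 2) * u = P i + of_real a * u + of_real b * w" "0 < b"
        using side by blast
      then have "(of_real (r / 2) * cis (pi / 2)) * u = (of_real a + of_real b * z) * u"
        by (simp add: wz algebra_simps)
      then have "of_real (r / 2) * cis (pi / 2) = of_real a + of_real b * z" using \<open>u \<noteq> 0\<close> by simp
      from arg_cong[OF this, of Im] have "r / 2 = b * Im z" by simp
      moreover have "b * Im z < 0" using ab iz by (simp add: mult_pos_neg)
      ultimately show False using \<open>0 < r\<close> by simp
    qed
    then have "\<theta> = 2 * pi - \<alpha>" unfolding \<theta> by (rule if_not_P)
    then show ?thesis using False \<alpha> \<alpha>' cs iz by simp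
  qed
  then show "0 < interior_angle N P i" "interior_angle N P i < pi"
    "cos (interior_angle N P i) = Re (w / u) / cmod (w / u)"
    "sin (interior_angle N P i) = \<bar>Im (w / u)\<bar> / cmod (w / u)"
    unfolding \<theta>_def z_def by auto
qed

lemma psi_convex_corner:
  assumes "u \<noteq> 0" "cos \<theta> = Re (w / u) / cmod (w / u)" "sin \<theta> = \<bar>Im (w / u)\<bar> / cmod (w / u)"
  shows "\<psi> \<theta> = (cmod u * cmod w + u \<bullet> w) / \<bar>Im (cnj u * w)\<bar>"
proof -
  have u2: "0 < (cmod u)\<^sup>2" using assms by simp
  have q: "w / u = of_real (1 / (cmod u)\<^sup>2) * (cnj u * w)"
    using complex_div_cnj[of w u] by (simp add: mult.commute)
  have re: "Re (w / u) = (u \<bullet> w) / (cmod u)\<^sup>2" and im: "Im (w / u) = Im (cnj u * w) / (cmod u)\<^sup>2"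
    unfolding q by (simp_all add: inner_complex_def)
  have n: "cmod (w / u) = cmod u * cmod w / (cmod u)\<^sup>2"
    using assms(1) by (simp add: norm_divide power2_eq_square)
  show ?thesis
  proof (cases "w = 0")
    case True then show ?thesis using assms by (simp add: \<psi>_def cot_def)
  next
    case False
    then have c0: "cmod (w / u) \<noteq> 0" using assms(1) by simp
    have "\<psi> \<theta> = (cos \<theta> + 1) / sin \<theta>" by (simp add: \<psi>_def cot_def add_divide_distrib)
    also have "\<dots> = (Re (w / u) + cmod (w / u)) / \<bar>Im (w / u)\<bar>"
    proof -
      have "cos \<theta> + 1 = (Re (w / u) + cmod (w / u)) / cmod (w / u)"
        unfolding assms(2) using c0 by (simp add: add_divide_distrib)
      then show ?thesis unfolding assms(3) using c0 by simp
    qed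
    also have "\<dots> = ((u \<bullet> w + cmod u * cmod w) / (cmod u)\<^sup>2) / (\<bar>Im (cnj u * w)\<bar> / (cmod u)\<^sup>2)"
      unfolding re im n by (simp add: add_divide_distrib abs_divide)
    also have "\<dots> = (u \<bullet> w + cmod u * cmod w) / \<bar>Im (cnj u * w)\<bar>"
      using u2 by simp
    finally show ?thesis by (simp add: add.commute)
  qed
qed

section \<open>Simple polygons\<close>

lemma polygon_path_at:
  assumes N: "0 < N" and s: "0 \<le> s" "s < 1"
  shows "polygon_path N P ((of_int k + s) / real N) = linepath (P k) (P (k + 1)) s"
proof -
  have "real N * ((of_int k + s) / real N) = of_int k + s" using N by simp
  moreover have "\<lfloor>of_int k + s\<rfloor> = k" using s by (simp add: floor_unique)
  ultimately show ?thesis unfolding polygon_path_def by (simp add: Let_def frac_def)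
qed

lemma periodic_shift:
  fixes P :: "int \<Rightarrow> 'a"
  assumes "\<And>i. P (i + n) = P i"
  shows "P (i + m * n) = P i"
proof (induction m rule: int_induct[where k = 0])
  case (step1 m)
  have "P (i + (m + 1) * n) = P ((i + m * n) + n)" by (simp add: algebra_simps)
  then show ?case using step1 assms by simp
next
  case (step2 m)
  have "P (i + (m - 1) * n) = P (i + (m - 1) * n + n)" using assms by simp
  also have "\<dots> = P (i + m * n)" by (simp add: algebra_simps)
  finally show ?case using step2 by simp
qed simp

lemma periodic_mod:
  fixes P :: "int \<Rightarrow> 'a"
  assumes "\<And>i. P (i + n) = P i"
  shows "P (i mod n + j) = P (i + j)"
  using periodic_shift[of P n, OF assms, of "i mod n + j" "i div n"] by (simp add: add.commute add.left_commute)

lemma path_image_polygon_path: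
  assumes N: "0 < N" and per: "\<And>i. P (i + int N) = P i"
  shows "path_image (polygon_path N P) = (\<Union>k. closed_segment (P k) (P (k + 1)))"
proof (intro equalityI subsetI)
  fix z assume "z \<in> path_image (polygon_path N P)"
  then obtain t where "z = polygon_path N P t" by (auto simp: path_image_def)
  then have "z = linepath (P \<lfloor>real N * t\<rfloor>) (P (\<lfloor>real N * t\<rfloor> + 1)) (frac (real N * t))"
    by (simp add: polygon_path_def Let_def)
  then have "z \<in> closed_segment (P \<lfloor>real N * t\<rfloor>) (P (\<lfloor>real N * t\<rfloor> + 1))"
    using frac_lt_1[of "real N * t"] by (simp add: linepath_in_path frac_ge_0 less_imp_le)
  then show "z \<in> (\<Union>k. closed_segment (P k) (P (k + 1)))" by blast
next
  have half_open: "linepath (P k) (P (k + 1)) s \<in> path_image (polygon_path N P)" if s: "0 \<le> s" "s < 1" for k s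
  proof -
    define j where "j = k mod int N"
    have j: "0 \<le> j" "j < int N" using N by (auto simp: j_def)
    have "P j = P k" "P (j + 1) = P (k + 1)"
      using periodic_mod[of P "int N", OF per, of k 0] periodic_mod[of P "int N", OF per, of k 1] by (auto simp: j_def)
    then have "linepath (P k) (P (k + 1)) s = polygon_path N P ((of_int j + s) / real N)"
      using polygon_path_at[OF N s, of P j] by simp
    moreover have "of_int j + s \<le> real N" using j s by linarith
    then have "(of_int j + s) / real N \<in> {0..1}" using j s N by simp
    ultimately show ?thesis by (auto simp: path_image_def)
  qed
  fix z assume "z \<in> (\<Union>k. closed_segment (P k) (P (k + 1)))"
  then obtain k s where s: "0 \<le> s" "s \<le> 1" and z: "z = linepath (P k) (P (k + 1)) s"
    by (auto simp: in_segment linepath_def)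
  show "z \<in> path_image (polygon_path N P)"
  proof (cases "s = 1")
    case True
    then have "z = linepath (P (k + 1)) (P (k + 1 + 1)) 0" using z by (simp add: linepath_def)
    then show ?thesis using half_open[of 0 "k + 1"] by simp
  next
    case False
    then show ?thesis using half_open[of s k] s z by simp
  qed
qed

lemma polygon_sides_disjoint:
  assumes poly: "polygon N P" and s: "0 \<le> s" "s < 1" and r: "0 \<le> r" "r < 1"
    and eq: "linepath (P j) (P (j + 1)) s = linepath (P k) (P (k + 1)) r"
  shows "j mod int N = k mod int N \<and> s = r"
proof -
  have N: "3 \<le> N" and per: "\<And>i. P (i + int N) = P i" and sp: "simple_path (polygon_path N P)"
    using poly by (auto simp: polygon_def)
  have N0: "0 < N" using N by simp
  define j' k' where "j' = j mod int N" and "k' = k mod int N"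
  have jk: "0 \<le> j'" "j' < int N" "0 \<le> k'" "k' < int N" using N0 by (auto simp: j'_def k'_def)
  have P: "P j' = P j" "P (j' + 1) = P (j + 1)" "P k' = P k" "P (k' + 1) = P (k + 1)"
    using periodic_mod[of P "int N", OF per, of j 0] periodic_mod[of P "int N", OF per, of j 1]
      periodic_mod[of P "int N", OF per, of k 0] periodic_mod[of P "int N", OF per, of k 1] by (auto simp: j'_def k'_def)
  define t1 t2 where "t1 = (of_int j' + s) / real N" and "t2 = (of_int k' + r) / real N"
  have "of_int j' + s < real N" "of_int k' + r < real N" using jk s r by linarith+
  then have t: "0 \<le> t1" "t1 < 1" "0 \<le> t2" "t2 < 1" using jk s r N0 by (auto simp: t1_def t2_def)
  have "polygon_path N P t1 = polygon_path N P t2"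
    unfolding t1_def t2_def polygon_path_at[OF N0 s] polygon_path_at[OF N0 r] P by (rule eq)
  then have "t1 = t2" using sp t unfolding simple_path_def loop_free_def by fastforce
  then have e: "of_int j' + s = of_int k' + r" using N0 by (simp add: t1_def t2_def)
  have "\<lfloor>of_int j' + s\<rfloor> = j'" "\<lfloor>of_int k' + r\<rfloor> = k'" using s r by (simp_all add: floor_unique)
  then have "j' = k'" using e by metis
  then show ?thesis using e by (simp add: j'_def k'_def)
qed

text \<open>
  If three consecutive vertices were collinear, the two sides would either overlap, against simplicity,
  or form a straight angle.
\<close>

lemma polygon_corner_nondegenerate:
  assumes poly: "polygon N P"
  shows "P (i + 1) \<noteq> P i" "Im ((P (i - 1) - P i) / (P (i + 1) - P i)) \<noteq> 0"
proof -
  have N: "3 \<le> N" and ang: "interior_angle N P i \<noteq> pi" using poly by (auto simp: polygon_def)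
  have nmod: "(j + 1) mod int N \<noteq> j mod int N" for j :: int
  proof
    assume "(j + 1) mod int N = j mod int N"
    then have "int N dvd (j + 1) - j" by (rule mod_eq_dvd_iff[THEN iffD1])
    then show False using N by simp
  qed
  have step: "P (j + 1) \<noteq> P j" for j
  proof
    assume "P (j + 1) = P j"
    then have "linepath (P (j + 1)) (P (j + 1 + 1)) 0 = linepath (P j) (P (j + 1)) 0" by (simp add: linepath_def)
    then show False using polygon_sides_disjoint[OF poly, of 0 0 "j + 1" j] nmod by simp
  qed
  show "P (i + 1) \<noteq> P i" by (rule step)
  define u w where "u = P (i + 1) - P i" and "w = P (i - 1) - P i"
  have u: "u \<noteq> 0" using step[of i] by (simp add: u_def)
  have w: "w \<noteq> 0" using step[of "i - 1"] by (simp add: w_def)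
  show "Im ((P (i - 1) - P i) / (P (i + 1) - P i)) \<noteq> 0"
  proof
    assume "Im ((P (i - 1) - P i) / (P (i + 1) - P i)) = 0"
    then have im: "Im (w / u) = 0" by (simp add: u_def w_def)
    define r where "r = Re (w / u)"
    have r: "w / u = of_real r" using im by (simp add: r_def complex_eq_iff)
    then have wr: "w = of_real r * u" using u by (simp add: field_simps)
    have "r \<noteq> 0" using w wr by auto
    show False
    proof (cases "0 < r")
      case True
      define t where "t = min (1 / 2) r"
      have t: "0 < t" "t < 1" "t \<le> r" using True by (auto simp: t_def)
      then have q: "0 \<le> 1 - t / r" "1 - t / r < 1" using True by auto
      have "linepath (P i) (P (i + 1)) t = P i + of_real t * u"
        by (simp add: linepath_def u_def scaleR_conv_of_real algebra_simps)
      moreover have "linepath (P (i - 1)) (P (i - 1 + 1)) (1 - t / r) = P i + of_real (t / r) * w"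
        by (simp add: linepath_def w_def scaleR_conv_of_real algebra_simps)
      moreover have "of_real (t / r) * w = of_real t * u" using True by (simp add: wr)
      ultimately have "linepath (P i) (P (i + 1)) t = linepath (P (i - 1)) (P (i - 1 + 1)) (1 - t / r)" by simp
      then have "i mod int N = (i - 1) mod int N"
        using polygon_sides_disjoint[OF poly _ _ q, of t i "i - 1"] t by simp
      then show False using nmod[of "i - 1"] by simp
    next
      case False
      then have "r < 0" using \<open>r \<noteq> 0\<close> by simp
      have "Arg2pi (w / u) = pi"
        unfolding r using \<open>r < 0\<close> Arg2pi_of_real[of r] by simp
      then have "interior_angle N P i = pi"
        unfolding interior_angle_def Let_def u_def[symmetric] w_def[symmetric] by simp
      with ang show False by contradiction
    qed
  qed
qed

lemma orient_eq_Im_divide: "u \<noteq> 0 \<Longrightarrow> Im (w / u) = Im (cnj u * w) / (cmod u)\<^sup>2"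
  by (simp add: complex_div_cnj[of w u] Im_divide_of_real[symmetric] mult.commute flip: of_real_power)

lemma polygon_orient_nonzero:
  assumes "polygon N P"
  shows "orient (P i) (P (i + 1)) (P (i - 1)) \<noteq> 0"
proof -
  have "P (i + 1) - P i \<noteq> 0" using polygon_corner_nondegenerate(1)[OF assms, of i] by simp
  from orient_eq_Im_divide[OF this, of "P (i - 1) - P i"] show ?thesis
    using polygon_corner_nondegenerate(2)[OF assms, of i] by (auto simp: orient_def)
qed

text \<open>
  By Cramer's rule; the identity \<open>id\<close> is the linear dependence of three vectors in the plane.
\<close>

lemma segments_cross:
  assumes "orient A B C * orient A B D < 0" "orient C D A * orient C D B < 0"
  obtains s r where "0 < s" "s < 1" "0 < r" "r < 1" "linepath A B s = linepath C D r"
proof -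
  have frac: "0 < x / (x - y)" "x / (x - y) < 1" if "x * y < 0" for x y :: real
    using that by (auto simp: mult_less_0_iff zero_less_divide_iff divide_less_eq)
  define a where "a = orient C D A"
  define c where "c = orient A B C"
  define \<Delta> where "\<Delta> = c - orient A B D"
  have \<Delta>: "a - orient C D B = - \<Delta>" by (simp add: \<Delta>_def a_def c_def orient_def algebra_simps)
  have "c \<noteq> 0" "\<Delta> \<noteq> 0" using assms(1) unfolding \<Delta>_def c_def by (auto simp: mult_less_0_iff)
  have s: "0 < a / - \<Delta>" "a / - \<Delta> < 1" using frac[OF assms(2)] unfolding \<Delta>[symmetric] a_def by auto
  have r: "0 < c / \<Delta>" "c / \<Delta> < 1" using frac[OF assms(1)] unfolding \<Delta>_def c_def by auto
  have id: "of_real \<Delta> * (C - A) + of_real c * (D - C) + of_real a * (B - A) = 0"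
    by (simp add: complex_eq_iff \<Delta>_def a_def c_def orient_def algebra_simps)
  have lin: "linepath U W t = U + of_real t * (W - U)" for U W t
    by (simp add: linepath_def scaleR_conv_of_real algebra_simps)
  have "linepath A B (a / - \<Delta>) = A - of_real (a / \<Delta>) * (B - A)"
    "linepath C D (c / \<Delta>) = C + of_real (c / \<Delta>) * (D - C)"
    unfolding lin by simp_all
  moreover have "A - of_real (a / \<Delta>) * (B - A) = C + of_real (c / \<Delta>) * (D - C)"
  proof -
    define x y where "x = a / \<Delta>" and "y = c / \<Delta>"
    have "a = \<Delta> * x" "c = \<Delta> * y" using \<open>\<Delta> \<noteq> 0\<close> by (simp_all add: x_def y_def)
    with id have "of_real \<Delta> * (C - A + of_real y * (D - C) + of_real x * (B - A)) = 0"
      by (simp add: algebra_simps)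
    then have "C - A + of_real y * (D - C) + of_real x * (B - A) = 0" using \<open>\<Delta> \<noteq> 0\<close> by simp
    then show ?thesis unfolding x_def[symmetric] y_def[symmetric] by (simp add: algebra_simps)
  qed
  ultimately show ?thesis using that[OF s r] by simp
qed

text \<open>
  The four triangles spanned by the vertices have nonzero signed areas.  If no diagonal separated the
  other two vertices, the signs of these areas would force two opposite sides to cross.
\<close>

lemma quadrilateral_diagonal_separates:
  assumes poly: "polygon 4 P"
  shows "orient (P i) (P (i + 2)) (P (i + 1)) * orient (P i) (P (i + 2)) (P (i + 3)) < 0 \<or>
    orient (P (i + 1)) (P (i + 3)) (P (i + 2)) * orient (P (i + 1)) (P (i + 3)) (P i) < 0"
proof -
  define A B C D where "A = P i" and "B = P (i + 1)" and "C = P (i + 2)" and "D = P (i + 3)"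
  have per: "\<And>i. P (i + 4) = P i" using poly by (auto simp: polygon_def)
  have A': "P (i + 4) = A" "P (i - 1) = D" using per[of i] per[of "i - 1"] by (simp_all add: A_def D_def algebra_simps)
  have nz: "orient A B D \<noteq> 0" "orient B C A \<noteq> 0" "orient C D B \<noteq> 0" "orient D A C \<noteq> 0"
    using polygon_orient_nonzero[OF poly, of i] polygon_orient_nonzero[OF poly, of "i + 1"]
      polygon_orient_nonzero[OF poly, of "i + 2"] polygon_orient_nonzero[OF poly, of "i + 3"] A'
    by (simp_all add: A_def B_def C_def D_def algebra_simps)
  have cyc: "orient A B C = orient B C A" "orient A C D = orient D A C" "orient C D A = orient D A C"
    "orient B C D = orient C D B" "orient D A B = orient A B D"
    "orient A C B = - orient B C A" "orient B D A = orient A B D" "orient B D C = - orient C D B"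
    by (auto simp: orient_def algebra_simps)
  have noAB: "linepath A B s \<noteq> linepath C D r" if "0 < s" "s < 1" "0 < r" "r < 1" for s r
  proof
    assume "linepath A B s = linepath C D r"
    then have "linepath (P i) (P (i + 1)) s = linepath (P (i + 2)) (P (i + 2 + 1)) r"
      by (simp add: A_def B_def C_def D_def algebra_simps)
    from polygon_sides_disjoint[OF poly _ _ _ _ this] that
    have "(i + 2) mod 4 = i mod 4" by simp
    then show False by presburger
  qed
  have noBC: "linepath B C s \<noteq> linepath D A r" if "0 < s" "s < 1" "0 < r" "r < 1" for s r
  proof
    assume "linepath B C s = linepath D A r"
    then have "linepath (P (i + 1)) (P (i + 1 + 1)) s = linepath (P (i + 3)) (P (i + 3 + 1)) r"
      using A' by (simp add: A_def B_def C_def D_def algebra_simps)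
    from polygon_sides_disjoint[OF poly _ _ _ _ this] that
    have "(i + 3) mod 4 = (i + 1) mod 4" by simp
    then show False by presburger
  qed
  have "orient A C B * orient A C D < 0 \<or> orient B D C * orient B D A < 0"
  proof (rule ccontr)
    assume "\<not> ?thesis"
    then have "orient B C A * orient D A C < 0" "orient C D B * orient A B D < 0"
      using nz unfolding cyc by (auto simp: mult_less_0_iff not_less zero_le_mult_iff mult_le_0_iff)
    then have "(orient A B C * orient A B D < 0 \<and> orient C D A * orient C D B < 0) \<or>
        (orient B C D * orient B C A < 0 \<and> orient D A B * orient D A C < 0)"
      unfolding cyc by (auto simp: mult_less_0_iff)
    then show False using segments_cross noAB noBC by metis
  qed
  then show ?thesis by (simp add: A_def B_def C_def D_def)
qed

lemma polygon_region_from: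
  assumes "polygon N P"
  shows "polygon_region N P = inside (\<Union>m\<in>{0..<int N}. closed_segment (P (i + m)) (P (i + m + 1)))"
proof -
  have N: "0 < N" and per: "\<And>i. P (i + int N) = P i" using assms by (auto simp: polygon_def)
  have "(\<Union>k. closed_segment (P k) (P (k + 1))) =
      (\<Union>m\<in>{0..<int N}. closed_segment (P (i + m)) (P (i + m + 1)))" (is "?U = ?V")
  proof
    show "?U \<subseteq> ?V"
    proof (rule UN_least)
      fix k
      let ?m = "(k - i) mod int N"
      have "P (?m + i) = P (k - i + i)" "P (?m + (i + 1)) = P (k - i + (i + 1))"
        by (rule periodic_mod[of P "int N", OF per])+
      then have "P k = P (i + ?m)" "P (k + 1) = P (i + ?m + 1)" by (simp_all add: ac_simps)
      then show "closed_segment (P k) (P (k + 1)) \<subseteq> ?V"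
        using UN_upper[of ?m "{0..<int N}" "\<lambda>m. closed_segment (P (i + m)) (P (i + m + 1))"] N by simp
    qed
    show "?V \<subseteq> ?U" by (intro UN_least UN_upper) simp
  qed
  then show ?thesis unfolding polygon_region_def by (simp only: path_image_polygon_path[OF N, of P, OF per])
qed

lemma polygon_3_region:
  assumes "polygon 3 P"
  shows "polygon_region 3 P = inside (triangle_boundary (P i) (P (i + 1)) (P (i + 2)))"
proof -
  have "P (i + 3) = P i" using assms by (simp add: polygon_def)
  moreover have "{0..<int 3} = {0, 1, 2}" by (rule set_eqI) (simp, presburger)
  ultimately show ?thesis unfolding polygon_region_from[OF assms, of i] by (simp add: add.assoc Un_assoc)
qed

lemma polygon_4_region:
  assumes "polygon 4 P"
  shows "polygon_region 4 P = inside (quadrilateral_boundary (P i) (P (i + 1)) (P (i + 2)) (P (i + 3)))"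
proof -
  have "P (i + 4) = P i" using assms by (simp add: polygon_def)
  moreover have "{0..<int 4} = {0, 1, 2, 3}" by (rule set_eqI) (simp, presburger)
  ultimately show ?thesis unfolding polygon_region_from[OF assms, of i] by (simp add: add.assoc Un_assoc)
qed

section \<open>Torque and force in terms of loads\<close>

text \<open>
  The kernel is only specified on \<open>{0<..}\<close>.  Its value at \<open>0\<close> affects the potential on a null set of
  points \<open>w\<close>, so setting it to \<open>0\<close> elsewhere gives a Borel function with the same potentials.
\<close>

definition off_diagonal :: "(real \<Rightarrow> real) \<Rightarrow> real \<Rightarrow> real" where
  "off_diagonal K r = (if 0 < r then K r else 0)"

lemma pair_kernel_off_diagonal:
  assumes "admissible_kernel K"
  shows "pair_kernel (off_diagonal K)"
proof -
  have cont: "continuous_on {0<..} K" and nn: "\<And>r. 0 < r \<Longrightarrow> 0 \<le> K r"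
    and dec: "strict_antimono_on {0<..} K" and int: "set_integrable lborel {0<..<1} (\<lambda>r. K r * r)"
    using assms C1_differentiable_imp_continuous_on by (auto simp: admissible_kernel_def)
  have "(\<lambda>r. indicator {0<..} r *\<^sub>R K r) \<in> borel_measurable borel"
    by (rule borel_measurable_continuous_on_indicator[OF _ cont]) simp
  moreover have "(\<lambda>r. indicator {0<..} r *\<^sub>R K r) = off_diagonal K" by (auto simp: off_diagonal_def indicator_def)
  ultimately have "off_diagonal K \<in> borel_measurable borel" by simp
  moreover have "continuous_on {0<..} (off_diagonal K)"
    by (rule continuous_on_eq[OF cont]) (simp add: off_diagonal_def)
  moreover have "strict_antimono_on {0<..} (off_diagonal K)"
    using dec by (auto simp: monotone_on_def off_diagonal_def)
  moreover have "set_integrable lborel {0<..<1} (\<lambda>r. off_diagonal K r * r)"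
    using int by (rule set_integrable_cong[THEN iffD1, rotated -1]) (auto simp: off_diagonal_def)
  ultimately show ?thesis unfolding pair_kernel_def using nn by (auto simp: off_diagonal_def)
qed

lemma region_measurable_bounded:
  assumes "polygon N P"
  shows "polygon_region N P \<in> sets borel" "bounded (polygon_region N P)"
proof -
  have "path (polygon_path N P)" using assms by (simp add: polygon_def simple_path_def)
  then have c: "compact (path_image (polygon_path N P))" by (rule compact_path_image)
  show "polygon_region N P \<in> sets borel" unfolding polygon_region_def
    using c by (intro borel_open open_inside compact_imp_closed)
  show "bounded (polygon_region N P)" unfolding polygon_region_def
    using c by (intro bounded_inside compact_imp_bounded)
qed

lemma potential_eq_pot:
  assumes K: "admissible_kernel K" and P: "polygon N P"
  shows "potential K N P z = pot (off_diagonal K) (polygon_region N P) z"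
proof -
  note [measurable] = pair_kernel_measurable[OF pair_kernel_off_diagonal[OF K]] region_measurable_bounded(1)[OF P]
  have K0: "K (dist z w) = off_diagonal K (dist z w) + indicator {z} w * K 0" for w
    by (auto simp: off_diagonal_def indicator_def)
  show ?thesis unfolding potential_def pot_def set_lebesgue_integral_def K0
  proof (rule integral_cong_AE)
    show "AE w in lborel. indicator (polygon_region N P) w *\<^sub>R (off_diagonal K (dist z w) + indicator {z} w * K 0) =
        indicator (polygon_region N P) w *\<^sub>R off_diagonal K (dist z w)"
      using AE_lborel_singleton[of z] by eventually_elim simp
  qed measurable
qed

text \<open>
  The half side is the image of the parameters \<open>s < 1 / 2\<close> of the whole side, and the distance to the
  midpoint is half the length times \<open>1 - 2 * s\<close>.  The truncated weight lets both halves be integrated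
  over the same interval.
\<close>

lemma half_side_torque:
  assumes k: "pair_kernel k" and S: "S \<in> sets borel" and AB: "A \<noteq> B"
  shows "(LINT x : closed_segment A (midpoint A B) | hausdorff1. pot k S x * dist x (midpoint A B)) =
    (dist A B)\<^sup>2 / 2 * (LINT s:{0<..<1} | lborel. max (1 - 2 * s) 0 * pot k S (linepath A B s))"
proof -
  define M where "M = midpoint A B"
  define l where "l = dist A B"
  note [measurable] = pot_measurable[OF k S]
  have lin: "linepath A M r = linepath A B (r / 2)" for r
    by (simp add: linepath_def M_def midpoint_def scaleR_conv_of_real algebra_simps)
  have dM: "dist (linepath A M r) M = (1 - r) * (l / 2)" if "r < 1" for r
  proof -
    have "linepath A M r - M = of_real ((r - 1) / 2) * (B - A)"
      by (simp add: linepath_def M_def midpoint_def scaleR_conv_of_real algebra_simps) (simp add: field_simps)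
    then have "dist (linepath A M r) M = \<bar>(r - 1) / 2\<bar> * l"
      unfolding dist_norm l_def by (simp only: norm_mult norm_of_real norm_minus_commute)
    then show ?thesis using that by simp
  qed
  have "A \<noteq> M" using AB midpoint_eq_endpoint(1)[of A B] unfolding M_def by metis
  have dAM: "dist A M = l / 2" by (simp add: M_def l_def dist_midpoint)
  let ?q = "\<lambda>r. indicator {0<..<1} r *\<^sub>R ((1 - r) * pot k S (linepath A B (r / 2)))"
  have "(LINT x : closed_segment A M | hausdorff1. pot k S x * dist x M) =
      dist A M * (LINT s : {0<..<1} | lborel. pot k S (linepath A M s) * dist (linepath A M s) M)"
    by (rule hausdorff1_integral_segment[OF _ \<open>A \<noteq> M\<close>]) measurable
  also have "(LINT s : {0<..<1} | lborel. pot k S (linepath A M s) * dist (linepath A M s) M) =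
      (LINT r | lborel. (l / 2) * ?q r)"
    unfolding set_lebesgue_integral_def
    by (intro Bochner_Integration.integral_cong) (auto simp: indicator_def dM[unfolded lin] lin)
  also have "\<dots> = (l / 2) * (LINT r | lborel. ?q r)" by simp
  also have "(LINT r | lborel. ?q r) = \<bar>2\<bar> *\<^sub>R (LINT s | lborel. ?q (0 + 2 * s))"
    by (rule lborel_integral_real_affine) simp
  also have "(\<lambda>s. ?q (0 + 2 * s)) = (\<lambda>s. indicator {0<..<1} s *\<^sub>R (max (1 - 2 * s) 0 * pot k S (linepath A B s)))"
    by (auto simp: indicator_def max_def fun_eq_iff)
  finally show ?thesis unfolding dAM M_def[symmetric] l_def[symmetric]
    by (simp add: set_lebesgue_integral_def power2_eq_square)
qed

lemma torque_eq_load_difference: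
  assumes k: "pair_kernel k" and S: "S \<in> sets borel" "bounded S" and AB: "A \<noteq> B"
  shows "(LINT x : closed_segment A (midpoint A B) | hausdorff1. pot k S x * dist x (midpoint A B))
      - (LINT x : closed_segment B (midpoint A B) | hausdorff1. pot k S x * dist x (midpoint A B))
    = dist A B / 2 * (load k S B A - load k S A B)"
proof -
  let ?V = "\<lambda>s. pot k S (linepath A B s)"
  have int: "set_integrable lborel {0<..<1} (\<lambda>s. w s * ?V s)" if "continuous_on UNIV w" for w
    by (rule weighted_potential_integrable[OF k S continuous_on_linepath that])
  have "(LINT s:{0<..<1} | lborel. max (1 - 2 * s) 0 * pot k S (linepath B A s)) =
      (LINT s:{0<..<1} | lborel. max (2 * s - 1) 0 * ?V s)"
    by (subst unit_interval_integral_reflect) (simp add: linepath_reverse algebra_simps)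
  note B = half_side_torque[OF k S(1) AB[symmetric], unfolded this midpoint_sym[of B A] dist_commute[of B A]]
  have "(LINT s:{0<..<1} | lborel. max (1 - 2 * s) 0 * ?V s) - (LINT s:{0<..<1} | lborel. max (2 * s - 1) 0 * ?V s)
      = (LINT s:{0<..<1} | lborel. max (1 - 2 * s) 0 * ?V s - max (2 * s - 1) 0 * ?V s)"
    by (intro set_integral_diff(2)[symmetric] int continuous_intros)
  also have "\<dots> = (LINT s:{0<..<1} | lborel. (1 - s) * ?V s - s * ?V s)"
    by (rule arg_cong[where f = "set_lebesgue_integral lborel {0<..<1}"]) (auto simp: fun_eq_iff max_def algebra_simps)
  also have "\<dots> = (LINT s:{0<..<1} | lborel. (1 - s) * ?V s) - (LINT s:{0<..<1} | lborel. s * ?V s)"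
    by (intro set_integral_diff(2) int continuous_intros)
  finally show ?thesis
    unfolding half_side_torque[OF k S(1) AB] B load_reversed[of k S B A] unfolding load_def
    by (simp add: power2_eq_square flip: right_diff_distrib)
qed

lemma force_eq_load_sum:
  assumes k: "pair_kernel k" and S: "S \<in> sets borel" "bounded S" and AB: "A \<noteq> B"
  shows "(LINT x : closed_segment A B | hausdorff1. pot k S x) = load k S B A + load k S A B"
proof -
  let ?V = "\<lambda>s. pot k S (linepath A B s)"
  have int: "set_integrable lborel {0<..<1} (\<lambda>s. w s * ?V s)" if "continuous_on UNIV w" for w
    by (rule weighted_potential_integrable[OF k S continuous_on_linepath that])
  have "(LINT x : closed_segment A B | hausdorff1. pot k S x) = dist A B * (LINT s:{0<..<1} | lborel. ?V s)"
    by (rule hausdorff1_integral_segment[OF pot_measurable[OF k S(1)] AB])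
  also have "(LINT s:{0<..<1} | lborel. ?V s) = (LINT s:{0<..<1} | lborel. (1 - s) * ?V s + s * ?V s)"
    by (simp add: algebra_simps)
  also have "\<dots> = (LINT s:{0<..<1} | lborel. (1 - s) * ?V s) + (LINT s:{0<..<1} | lborel. s * ?V s)"
    by (intro set_integral_add(2) int continuous_intros)
  finally show ?thesis unfolding load_reversed[of k S B A] unfolding load_def by (simp add: distrib_left)
qed

text \<open>
  The two conditions are imposed for the indices from \<open>1\<close> to \<open>N\<close>; periodicity carries them over to all
  integers.
\<close>

lemma representative_side:
  assumes P: "polygon N P"
  obtains j where "j \<in> {1..int N}" "P j = P i" "P (j + 1) = P (i + 1)"
    "interior_angle N P j = interior_angle N P i" "interior_angle N P (j + 1) = interior_angle N P (i + 1)"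
proof -
  define n where "n = int N"
  have n: "0 < n" and per: "\<And>i. P (i + n) = P i" using P by (auto simp: polygon_def n_def)
  define j where "j = (i - 1) mod n + 1"
  have same: "P (j + m) = P (i + m)" for m
    using periodic_mod[of P n, OF per, of "i - 1" "m + 1"] by (simp add: j_def algebra_simps)
  have ang: "interior_angle N P (j + m) = interior_angle N P (i + m)" for m
    using same[of m] same[of "m + 1"] same[of "m - 1"] by (simp add: interior_angle_def algebra_simps)
  have "0 \<le> (i - 1) mod n" "(i - 1) mod n < n" using n by auto
  then have "j \<in> {1..n}" by (auto simp: j_def)
  then show ?thesis using that same[of 0] same[of 1] ang[of 0] ang[of 1] by (simp add: n_def)
qed

lemma torque_condition_load:
  assumes K: "admissible_kernel K" and P: "polygon N P" and T: "torque_condition K N P \<sigma>"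
  defines "k \<equiv> off_diagonal K" and "S \<equiv> polygon_region N P"
  shows "load k S (P (i + 1)) (P i) - load k S (P i) (P (i + 1)) =
    \<sigma> * (\<psi> (interior_angle N P i) - \<psi> (interior_angle N P (i + 1)))" (is "?d = \<sigma> * ?p")
proof -
  note k = pair_kernel_off_diagonal[OF K, folded k_def]
  note S = region_measurable_bounded[OF P, folded S_def]
  obtain j where j: "j \<in> {1..int N}" and same: "P j = P i" "P (j + 1) = P (i + 1)"
    "interior_angle N P j = interior_angle N P i" "interior_angle N P (j + 1) = interior_angle N P (i + 1)"
    using representative_side[OF P] by metis
  have ne: "P i \<noteq> P (i + 1)" using polygon_corner_nondegenerate(1)[OF P, of i] by simp
  let ?l = "dist (P i) (P (i + 1))"
  have "?l / 2 * ?d = \<sigma> * ?l / 2 * ?p"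
    using bspec[OF T[unfolded torque_condition_def] j]
    unfolding side_midpoint_def side_length_def same potential_eq_pot[OF K P, folded k_def S_def]
      torque_eq_load_difference[OF k S ne] .
  then have "(?l / 2) * ?d = (?l / 2) * (\<sigma> * ?p)" by (simp add: mult_ac)
  then show ?thesis using ne by simp
qed

lemma force_condition_load:
  assumes K: "admissible_kernel K" and P: "polygon N P" and F: "force_condition K N P \<sigma>"
  defines "k \<equiv> off_diagonal K" and "S \<equiv> polygon_region N P"
  shows "load k S (P (i + 1)) (P i) + load k S (P i) (P (i + 1)) =
    \<sigma> * (\<psi> (interior_angle N P i) + \<psi> (interior_angle N P (i + 1)))"
proof -
  note k = pair_kernel_off_diagonal[OF K, folded k_def]
  note S = region_measurable_bounded[OF P, folded S_def]
  obtain j where j: "j \<in> {1..int N}" and same: "P j = P i" "P (j + 1) = P (i + 1)"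
    "interior_angle N P j = interior_angle N P i" "interior_angle N P (j + 1) = interior_angle N P (i + 1)"
    using representative_side[OF P] by metis
  have ne: "P i \<noteq> P (i + 1)" using polygon_corner_nondegenerate(1)[OF P, of i] by simp
  show ?thesis
    using bspec[OF F[unfolded force_condition_def] j]
    unfolding same potential_eq_pot[OF K P, folded k_def S_def] force_eq_load_sum[OF k S ne] .
qed

section \<open>Triangles and quadrilaterals in equilibrium\<close>

text \<open>
  The cotangent of half the angle at \<open>A\<close>, that is \<open>(1 + cos \<theta>) / sin \<theta>\<close>, in terms of the vertices.
\<close>

definition half_cot :: "complex \<Rightarrow> complex \<Rightarrow> complex \<Rightarrow> real" where
  "half_cot A B C = (cmod (B - A) * cmod (C - A) + (B - A) \<bullet> (C - A)) / \<bar>orient A B C\<bar>"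

lemma half_cot_commute: "half_cot A B C = half_cot A C B"
proof -
  have "orient A B C = - orient A C B" by (simp add: orient_def algebra_simps)
  then show ?thesis by (simp add: half_cot_def inner_commute mult.commute)
qed

text \<open>
  Of the two angles at \<open>A\<close> and \<open>B\<close>, the one opposite to the shorter side is smaller.  The numerators differ
  by at least \<open>|CA|\<^sup>2 - |CB|\<^sup>2\<close>, the denominators agree.
\<close>

lemma half_cot_less:
  assumes nc: "orient A B C \<noteq> 0" and less: "dist C B < dist C A"
  shows "half_cot B A C < half_cot A B C"
proof -
  have o: "orient B A C = - orient A B C" by (simp add: orient_def algebra_simps)
  have ne: "A \<noteq> B" using nc by (auto simp: orient_def)
  have "(B - A) \<bullet> (C - A) - (A - B) \<bullet> (C - B) = (cmod (C - A))\<^sup>2 - (cmod (C - B))\<^sup>2"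
    unfolding cmod_power2 inner_complex_def by (simp add: power2_eq_square algebra_simps)
  moreover have "(cmod (C - B))\<^sup>2 < (cmod (C - A))\<^sup>2"
    using less by (simp add: dist_norm power_strict_mono)
  ultimately have "(A - B) \<bullet> (C - B) < (B - A) \<bullet> (C - A)" by simp
  moreover have "cmod (A - B) * cmod (C - B) \<le> cmod (B - A) * cmod (C - A)"
    using less by (simp add: dist_norm norm_minus_commute mult_left_mono)
  ultimately show ?thesis unfolding half_cot_def o using nc by (simp add: divide_strict_right_mono)
qed

lemma polygon_corner_half_cot:
  assumes P: "polygon N P"
    and cone: "0 < \<epsilon>" "\<And>a b. 0 < a \<Longrightarrow> 0 < b \<Longrightarrow> a + b < \<epsilon> \<Longrightarrow>
      P i + of_real a * (P (i + 1) - P i) + of_real b * (P (i - 1) - P i) \<in> polygon_region N P"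
    and side: "polygon_region N P \<subseteq> {P i + of_real a * (P (i + 1) - P i) + of_real b * (P (i - 1) - P i) | a b. 0 < b}"
  shows "\<psi> (interior_angle N P i) = half_cot (P i) (P (i + 1)) (P (i - 1))"
    and "(P (i + 1) - P i) \<bullet> (P (i - 1) - P i) = 0 \<Longrightarrow> interior_angle N P i = pi / 2"
proof -
  note nd = polygon_corner_nondegenerate[OF P, of i]
  note ang = interior_angle_convex_corner[OF nd(2) cone side]
  have u: "P (i + 1) - P i \<noteq> 0" using nd by simp
  show "\<psi> (interior_angle N P i) = half_cot (P i) (P (i + 1)) (P (i - 1))"
    unfolding half_cot_def orient_def by (rule psi_convex_corner[OF u ang(3,4)])
  assume "(P (i + 1) - P i) \<bullet> (P (i - 1) - P i) = 0"
  then have "Re ((P (i - 1) - P i) / (P (i + 1) - P i)) = 0"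
    by (simp add: Re_divide inner_complex_def mult.commute)
  then have c: "cos (interior_angle N P i) = cos (pi / 2)" using ang(3) by simp
  show "interior_angle N P i = pi / 2"
    by (rule cos_inj_pi[OF _ _ _ _ c]) (use ang(1,2) in simp_all)
qed

lemma triangle_half_cot:
  assumes P: "polygon 3 P"
  shows "\<psi> (interior_angle 3 P i) = half_cot (P i) (P (i + 1)) (P (i + 2))"
proof -
  have "P (i - 1 + int 3) = P (i - 1)" using P unfolding polygon_def by blast
  then have p: "P (i + 2) = P (i - 1)" by (simp add: algebra_simps)
  have nc: "orient (P i) (P (i + 1)) (P (i - 1)) \<noteq> 0" by (rule polygon_orient_nonzero[OF P])
  have R: "polygon_region 3 P = {P i + of_real s * (P (i + 1) - P i) + of_real t * (P (i - 1) - P i) | s t.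
      0 < s \<and> 0 < t \<and> s + t < 1}"
    unfolding polygon_3_region[OF P, of i] p by (rule inside_triangle_cone[OF nc])
  show ?thesis unfolding p
  proof (rule polygon_corner_half_cot(1)[OF P zero_less_one])
    fix a b :: real assume "0 < a" "0 < b" "a + b < 1"
    then show "P i + of_real a * (P (i + 1) - P i) + of_real b * (P (i - 1) - P i) \<in> polygon_region 3 P"
      unfolding R by blast
  qed (unfold R, blast)
qed

text \<open>
  If \<open>C\<close> were closer to \<open>B\<close>, the load would be larger at \<open>B\<close> but the cotangent larger at \<open>A\<close>.
\<close>

lemma triangle_torque_dist_le:
  assumes k: "pair_kernel k" and nc: "orient A B C \<noteq> 0" and \<sigma>: "0 < \<sigma>"
  defines "S \<equiv> inside (triangle_boundary A B C)"
  assumes T: "load k S B A - load k S A B = \<sigma> * (half_cot A B C - half_cot B A C)"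
  shows "dist C A \<le> dist C B"
proof (rule ccontr)
  assume "\<not> ?thesis"
  then have less: "dist C B < dist C A" by simp
  have "load k S B A < load k S A B" unfolding S_def by (rule triangle_load_less[OF k nc less])
  moreover have "0 < \<sigma> * (half_cot A B C - half_cot B A C)" using half_cot_less[OF nc less] \<sigma> by simp
  ultimately show False using T by simp
qed

lemma triangle_equilateral:
  assumes K: "admissible_kernel K" and P: "polygon 3 P" and \<sigma>: "0 < \<sigma>" and T: "torque_condition K 3 P \<sigma>"
  shows "equilateral_triangle P"
proof -
  let ?k = "off_diagonal K"
  note k = pair_kernel_off_diagonal[OF K]
  have per: "\<And>i. P (i + 3) = P i" using P by (simp add: polygon_def)
  have "side_length P (i + 1) = side_length P (i + 2)" for i
  proof -
    define A B C where "A = P i" and "B = P (i + 1)" and "C = P (i + 2)"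
    have idx: "P (i + 1 + 1) = C" "P (i + 1 + 2) = A" "P (i - 1) = C" "P (i + 2 + 1) = A"
      using per[of i] per[of "i - 1"] by (simp_all add: A_def C_def add.assoc) (simp_all add: algebra_simps)
    have S: "polygon_region 3 P = inside (triangle_boundary A B C)"
      unfolding A_def B_def C_def by (rule polygon_3_region[OF P])
    also have "triangle_boundary A B C =
        triangle_boundary B A C"
      by (simp only: closed_segment_commute Un_ac)
    finally have S': "polygon_region 3 P = inside (triangle_boundary B A C)" .
    have nc: "orient A B C \<noteq> 0" using polygon_orient_nonzero[OF P, of i] by (simp add: A_def B_def idx)
    then have nc': "orient B A C \<noteq> 0" by (auto simp: orient_def algebra_simps)
    have psi: "\<psi> (interior_angle 3 P i) = half_cot A B C" "\<psi> (interior_angle 3 P (i + 1)) = half_cot B A C"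
      unfolding triangle_half_cot[OF P] idx A_def[symmetric] B_def[symmetric] C_def[symmetric]
      by (simp_all add: half_cot_commute)
    have T': "load ?k (polygon_region 3 P) B A - load ?k (polygon_region 3 P) A B = \<sigma> * (half_cot A B C - half_cot B A C)"
      using torque_condition_load[OF K P T, of i] unfolding psi A_def[symmetric] B_def[symmetric] .
    have "dist C A \<le> dist C B"
      by (rule triangle_torque_dist_le[OF k nc \<sigma>]) (use T' S in simp)
    moreover have "dist C B \<le> dist C A"
      by (rule triangle_torque_dist_le[OF k nc' \<sigma>]) (use T' S' in \<open>simp add: algebra_simps\<close>)
    ultimately show ?thesis using idx by (simp add: side_length_def A_def B_def C_def dist_commute add.assoc)
  qed
  then have step: "side_length P (i + 1) = side_length P i" for i
    by (metis add.assoc diff_add_cancel one_add_one)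
  have "side_length P i = side_length P 0" for i
  proof (induction i rule: int_induct[where k = 0])
    case (step1 i) then show ?case using step[of i] by simp
  next
    case (step2 i) then show ?case using step[of "i - 1"] by simp
  qed simp
  then show ?thesis unfolding equilateral_triangle_def using P by metis
qed

lemma quadrilateral_parallelogram_corner:
  assumes P: "polygon 4 P" and par: "P i + P (i + 2) = P (i + 1) + P (i + 3)"
  shows "\<psi> (interior_angle 4 P i) = half_cot (P i) (P (i + 1)) (P (i + 3))"
    and "(P (i + 1) - P i) \<bullet> (P (i + 3) - P i) = 0 \<Longrightarrow> interior_angle 4 P i = pi / 2"
proof -
  have "P (i - 1 + int 4) = P (i - 1)" using P unfolding polygon_def by blast
  then have p: "P (i + 3) = P (i - 1)" by (simp add: algebra_simps)
  have nc: "orient (P i) (P (i + 1)) (P (i - 1)) \<noteq> 0" by (rule polygon_orient_nonzero[OF P])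
  have R: "polygon_region 4 P = {P i + of_real s * (P (i + 1) - P i) + of_real t * (P (i - 1) - P i) | s t.
      0 < s \<and> s < 1 \<and> 0 < t \<and> t < 1}"
    unfolding polygon_4_region[OF P, of i] p by (rule inside_parallelogram_cone[OF nc par[unfolded p]])
  have cone: "P i + of_real a * (P (i + 1) - P i) + of_real b * (P (i - 1) - P i) \<in> polygon_region 4 P"
    if "0 < a" "0 < b" "a + b < 1" for a b :: real
  proof -
    have "a < 1" "b < 1" using that by linarith+
    then show ?thesis unfolding R using that by blast
  qed
  have side: "polygon_region 4 P \<subseteq> {P i + of_real a * (P (i + 1) - P i) + of_real b * (P (i - 1) - P i) | a b. 0 < b}"
    unfolding R by blast
  show "\<psi> (interior_angle 4 P i) = half_cot (P i) (P (i + 1)) (P (i + 3))"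
    unfolding p by (rule polygon_corner_half_cot(1)[OF P zero_less_one cone side])
  show "interior_angle 4 P i = pi / 2" if "(P (i + 1) - P i) \<bullet> (P (i + 3) - P i) = 0"
    by (rule polygon_corner_half_cot(2)[OF P zero_less_one cone side]) (use that p in simp_all)
qed

text \<open>
  The kite argument for one diagonal, and then for the other one.
\<close>

lemma balanced_quadrilateral_rhombus:
  assumes k: "pair_kernel k" and sep: "orient A C B * orient A C D < 0"
  defines "S \<equiv> inside (quadrilateral_boundary A B C D)"
  assumes bal: "load k S A B = load k S C B" "load k S B C = load k S D C"
    "load k S C D = load k S A D" "load k S D A = load k S B A"
  shows "A + C = B + D" "dist B C = dist A B" "dist C D = dist A B" "dist D A = dist A B"
proof -
  have b1: "dist A B = dist C B" "dist A D = dist C D" "orient B D A * orient B D C < 0"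
    using kite[OF k sep, folded S_def] bal by auto
  have S': "S = inside (quadrilateral_boundary B C D A)"
    unfolding S_def by (simp only: Un_ac)
  have "orient B D C * orient B D A < 0" using b1(3) by (simp add: mult.commute)
  from kite[OF k this, folded S'] have b2: "dist B C = dist D C" "dist B A = dist D A" using bal by auto
  show "A + C = B + D" using b1 b2 by (intro rhombus_diagonals[OF sep]) (simp_all add: dist_commute)
  show "dist B C = dist A B" "dist C D = dist A B" "dist D A = dist A B"
    using b1 b2 by (simp_all add: dist_commute)
qed

lemma rhombus_half_cot_difference:
  assumes par: "A + C = B + D" and sides: "dist B C = dist A B" "dist C D = dist A B" "dist D A = dist A B"
  shows "half_cot C D B - half_cot D A C = 2 * ((B - A) \<bullet> (D - A)) / \<bar>orient A B D\<bar>"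
proof -
  define u v where "u = B - A" and "v = D - A"
  have C: "C = A + u + v" using par by (simp add: u_def v_def algebra_simps)
  have B: "B = A + u" and D: "D = A + v" by (simp_all add: u_def v_def)
  have uv: "cmod u = cmod v" using sides by (simp add: u_def v_def dist_norm norm_minus_commute)
  have "orient C D B = orient A B D" "orient D A C = orient A B D"
    unfolding C B D by (simp_all add: orient_def algebra_simps)
  moreover have "D - C = - u" "B - C = - v" "A - D = - v" "C - D = u" "B - A = u" "D - A = v"
    unfolding C B D by simp_all
  ultimately show ?thesis
    by (simp add: half_cot_def uv inner_commute flip: diff_divide_distrib)
qed

text \<open>
  The loads show that the polygon is a rhombus.  If its angles were not right, then for \<open>u = B - A\<close> and
  \<open>w = D - A\<close> the symmetrization inequality for slices parallel to \<open>AB\<close> would give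
  \<open>u \<bullet> w * (\<psi>\<^sub>C - \<psi>\<^sub>D) < 0\<close>, whereas \<open>\<psi>\<^sub>C - \<psi>\<^sub>D\<close> is a positive multiple of \<open>u \<bullet> w\<close>.
\<close>

lemma quadrilateral_square:
  assumes K: "admissible_kernel K" and P: "polygon 4 P" and \<sigma>: "0 < \<sigma>"
    and T: "torque_condition K 4 P \<sigma>" and F: "force_condition K 4 P \<sigma>"
  shows "is_square P"
proof -
  let ?k = "off_diagonal K"
  define S where "S = polygon_region 4 P"
  define \<phi> where "\<phi> i = \<sigma> * \<psi> (interior_angle 4 P i)" for i
  note k = pair_kernel_off_diagonal[OF K]
  have per: "P (i + 4) = P i" for i using P by (simp add: polygon_def)
  have load: "load ?k S (P (i + 1)) (P i) = \<phi> i" "load ?k S (P i) (P (i + 1)) = \<phi> (i + 1)" for i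
    using torque_condition_load[OF K P T, of i] force_condition_load[OF K P F, of i]
    unfolding S_def[symmetric] \<phi>_def distrib_left right_diff_distrib by linarith+
  obtain i where sep: "orient (P i) (P (i + 2)) (P (i + 1)) * orient (P i) (P (i + 2)) (P (i + 3)) < 0"
    using quadrilateral_diagonal_separates[OF P, of 0]
  proof (elim disjE)
    assume "orient (P (0 + 1)) (P (0 + 3)) (P (0 + 2)) * orient (P (0 + 1)) (P (0 + 3)) (P 0) < 0"
    then show ?thesis using that[of 1] per[of 0] by simp
  qed (use that[of 0] in simp)
  define A B C D where "A = P i" and "B = P (i + 1)" and "C = P (i + 2)" and "D = P (i + 3)"
  have idx: "P (i + 1 + 1) = C" "P (i + 2 + 1) = D" "P (i + 3 + 1) = A" "\<phi> (i + 3 + 1) = \<phi> i"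
    using per[of i] per[of "i + 1"] per[of "i - 1"]
    by (simp_all add: A_def C_def D_def \<phi>_def interior_angle_def add.assoc algebra_simps)
  have S: "S = inside (quadrilateral_boundary A B C D)"
    unfolding S_def A_def B_def C_def D_def by (rule polygon_4_region[OF P])
  have loads: "load ?k S A B = \<phi> (i + 1)" "load ?k S B A = \<phi> i" "load ?k S B C = \<phi> (i + 2)" "load ?k S C B = \<phi> (i + 1)"
    "load ?k S C D = \<phi> (i + 3)" "load ?k S D C = \<phi> (i + 2)" "load ?k S D A = \<phi> i" "load ?k S A D = \<phi> (i + 3)"
    using load[of i] load[of "i + 1"] load[of "i + 2"] load[of "i + 3"] unfolding idx
    by (simp_all add: A_def B_def C_def D_def add.assoc)
  note sep' = sep[folded A_def B_def C_def D_def]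
  note rh = balanced_quadrilateral_rhombus[OF k sep', folded S, unfolded loads, OF refl refl refl refl]
  have par: "P j + P (j + 2) = P (j + 1) + P (j + 3)" for j
  proof (induction j rule: int_induct[where k = i])
    case base then show ?case using rh(1) by (simp add: A_def B_def C_def D_def)
  next
    case (step1 j) then show ?case using per[of j] by (simp add: add.assoc add.commute)
  next
    case (step2 j) then show ?case using per[of "j - 1"] by (simp add: algebra_simps)
  qed
  have sides: "dist (P j) (P (j + 1)) = dist A B" for j
  proof -
    have opp: "dist (P j) (P (j + 1)) = dist (P (j + 1 + 1)) (P (j + 1 + 1 + 1))" for j
    proof -
      have "P (j + 1) - P j = P (j + 2) - P (j + 3)" using par[of j] by (simp add: algebra_simps)
      then show ?thesis by (simp add: dist_norm norm_minus_commute[of "P j"] add.assoc)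
    qed
    have "dist (P j) (P (j + 1)) = dist A B \<and> dist (P (j + 1)) (P (j + 1 + 1)) = dist A B"
    proof (induction j rule: int_induct[where k = i])
      case base then show ?case using rh(2) idx by (simp add: A_def B_def C_def)
    next
      case (step1 j) then show ?case using opp[of j] by simp
    next
      case (step2 j) then show ?case using opp[of "j - 1"] by simp
    qed
    then show ?thesis by blast
  qed
  have nc: "orient A B D \<noteq> 0" using polygon_orient_nonzero[OF P, of i] per[of "i - 1"]
    by (simp add: A_def B_def D_def algebra_simps)
  have right: "(B - A) \<bullet> (D - A) = 0"
  proof (rule ccontr)
    assume ne: "(B - A) \<bullet> (D - A) \<noteq> 0"
    have "((B - A) \<bullet> (D - A)) * (\<phi> (i + 2) - \<phi> (i + 3)) < 0"
      using parallelogram_load[OF k nc rh(1) ne] unfolding S[symmetric] loads .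
    moreover have "P (i + 2 + 3) = B" "P (i + 3 + 3) = C"
      using per[of "i + 1"] per[of "i + 2"] by (simp_all add: B_def C_def add.assoc)
    then have "\<phi> (i + 2) - \<phi> (i + 3) = \<sigma> * (half_cot C D B - half_cot D A C)"
      unfolding \<phi>_def quadrilateral_parallelogram_corner(1)[OF P par] idx
      by (simp add: C_def D_def right_diff_distrib)
    then have "\<phi> (i + 2) - \<phi> (i + 3) = \<sigma> * (2 * ((B - A) \<bullet> (D - A)) / \<bar>orient A B D\<bar>)"
      using rhombus_half_cot_difference[OF rh] by simp
    then have "((B - A) \<bullet> (D - A)) * (\<phi> (i + 2) - \<phi> (i + 3)) = (2 * \<sigma> / \<bar>orient A B D\<bar>) * ((B - A) \<bullet> (D - A))\<^sup>2"
      by (simp add: power2_eq_square)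
    moreover have "0 \<le> (2 * \<sigma> / \<bar>orient A B D\<bar>) * ((B - A) \<bullet> (D - A))\<^sup>2" using \<sigma> by simp
    ultimately show False by linarith
  qed
  have angle: "interior_angle 4 P j = pi / 2" for j
  proof (rule quadrilateral_parallelogram_corner(2)[OF P par])
    show "(P (j + 1) - P j) \<bullet> (P (j + 3) - P j) = 0"
    proof (induction j rule: int_induct[where k = i])
      case base then show ?case using right by (simp add: A_def B_def D_def)
    next
      case (step1 j)
      have e: "P (j + 1 + 1) - P (j + 1) = P (j + 3) - P j" "P (j + 1 + 3) = P j"
        using par[of j] per[of j] by (simp_all add: algebra_simps)
      have "(P (j + 1 + 1) - P (j + 1)) \<bullet> (P (j + 1 + 3) - P (j + 1)) = (P (j + 3) - P j) \<bullet> (- (P (j + 1) - P j))"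
        unfolding e by (simp only: minus_diff_eq)
      also have "\<dots> = - ((P (j + 1) - P j) \<bullet> (P (j + 3) - P j))"
        by (simp only: inner_minus_right inner_minus_left inner_commute)
      finally show ?case using step1 by simp
    next
      case (step2 j)
      have e: "P (j - 1 + 1) = P j" "P (j - 1 + 3) - P (j - 1) = P (j + 1) - P j" "P (j + 3) = P (j - 1)"
        using par[of "j - 1"] per[of "j - 1"] by (simp_all add: algebra_simps)
      have "(P (j - 1 + 1) - P (j - 1)) \<bullet> (P (j - 1 + 3) - P (j - 1)) = (- (P (j + 3) - P j)) \<bullet> (P (j + 1) - P j)"
        unfolding e by (simp only: minus_diff_eq)
      also have "\<dots> = - ((P (j + 1) - P j) \<bullet> (P (j + 3) - P j))"
        by (simp only: inner_minus_right inner_minus_left inner_commute)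
      finally show ?case using step2 by simp
    qed
  qed
  show ?thesis unfolding is_square_def side_length_def sides using P angle by simp
qed

theorem theorem1p3:
  fixes K :: "real \<Rightarrow> real"
  assumes "admissible_kernel K"
  shows "(\<forall>P. polygon 3 P \<longrightarrow> (\<exists>\<sigma>>0. torque_condition K 3 P \<sigma>) \<longrightarrow> equilateral_triangle P) \<and>
         (\<forall>P. polygon 4 P \<longrightarrow>
            (\<exists>\<sigma>>0. torque_condition K 4 P \<sigma> \<and> force_condition K 4 P \<sigma>) \<longrightarrow> is_square P)"
  using triangle_equilateral[OF assms] quadrilateral_square[OF assms] by blast

end
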